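(* Let $n\ge 2$, let $M^n$ be a closed connected smooth $n$-dimensional manifold, let $\lambda\in\mathbb{R}$ be a constant, and let $x:M^n\to\mathbb{R}^{n+1}$ be a smooth immersion which is a $\lambda$-self-expander, i.e. $H-\frac12\langle x,\xi\rangle=\lambda$ on $M^n$. If the mean curvature satisfies $H>0$ and the squared norm of the second fundamental form satisfies $S\le\frac{H^2}{n-1}$ everywhere on $M^n$, then $M^n$ is a round sphere centered at the origin.
   Context: Let $x:M^n\to\mathbb{R}^{n+1}$ be an immersed hypersurface with the induced metric $I=\langle dx,dx\rangle$, and let $\xi$ be its smooth global unit normal field, called the inward unit normal (for a round sphere centered at the origin it points towards the center). For a local orthonormal frame $e_1,\dots,e_n$ with dual coframe $\omega_1,\dots,\omega_n$, the second fundamental form $h=\sum_{i,j}h_{ij}\,\omega_i\otimes\omega_j$ is given by $d\xi=-\sum_{i,j}h_{ij}\omega_j e_i$. The mean curvature is the trace $H=\sum_i h_{ii}$ (not divided by $n$; so the round sphere of radius $r$ has $H=n/r$), and $S=|h|^2=\sum_{i,j}h_{ij}^2$. "Closed" means compact without boundary. The immersion $x$ is a $\lambda$-self-expander if $H-\frac12\langle x,\xi\rangle=\lambda$ on $M^n$ for the constant $\lambda$. "$M^n$ is a round sphere centered at the origin" means that $x(M^n)=\{y\in\mathbb{R}^{n+1}:|y|=r\}$ for some $r>0$. *)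

theory Defs
  imports "HOL-Analysis.Analysis"
begin

section \<open>Smooth maps between Euclidean spaces\<close>

text \<open>Meant for open \<open>S\<close> and Euclidean source and target. There \<open>C\<^sup>k\<^sup>+\<^sup>1\<close> amounts to being
  differentiable with all directional derivatives of class \<open>C\<^sup>k\<close>.\<close>

fun Ck_on :: "nat \<Rightarrow> ('a::real_normed_vector \<Rightarrow> 'b::real_normed_vector) \<Rightarrow> 'a set \<Rightarrow> bool" where
  "Ck_on 0 f S \<longleftrightarrow> continuous_on S f"
| "Ck_on (Suc k) f S \<longleftrightarrow>
     (\<forall>y\<in>S. f differentiable (at y)) \<and> (\<forall>v. Ck_on k (\<lambda>y. frechet_derivative f (at y) v) S)"

definition smooth_on :: "'a::real_normed_vector set \<Rightarrow> ('a \<Rightarrow> 'b::real_normed_vector) \<Rightarrow> bool" where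
  "smooth_on S f \<longleftrightarrow> (\<forall>k. Ck_on k f S)"

section \<open>Smooth manifolds without boundary\<close>

text \<open>A chart is its domain together with the coordinate map. The coordinate map is a total
  function, but only its values on the domain matter.\<close>

type_synonym ('a, 'n) chart = "'a set \<times> ('a \<Rightarrow> real ^ 'n)"

definition coord_rep :: "('a, 'n::finite) chart \<Rightarrow> ('a \<Rightarrow> 'b) \<Rightarrow> real ^ 'n \<Rightarrow> 'b" where
  "coord_rep c f = f \<circ> inv_into (fst c) (snd c)"

definition chart_on :: "'a topology \<Rightarrow> ('a, 'n::finite) chart \<Rightarrow> bool" where
  "chart_on M c \<longleftrightarrow> openin M (fst c) \<and> open (snd c ` fst c) \<and>
     homeomorphic_map (subtopology M (fst c)) (top_of_set (snd c ` fst c)) (snd c)"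

text \<open>The smooth structure is given by any smooth atlas, not necessarily a maximal one.\<close>

definition smooth_atlas :: "'a topology \<Rightarrow> ('a, 'n::finite) chart set \<Rightarrow> bool" where
  "smooth_atlas M A \<longleftrightarrow> (\<Union>c\<in>A. fst c) = topspace M \<and> (\<forall>c\<in>A. chart_on M c) \<and>
     (\<forall>c\<in>A. \<forall>d\<in>A. smooth_on (snd c ` (fst c \<inter> fst d)) (coord_rep c (snd d)))"

definition smooth_manifold :: "'a topology \<Rightarrow> ('a, 'n::finite) chart set \<Rightarrow> bool" where
  "smooth_manifold M A \<longleftrightarrow> Hausdorff_space M \<and> second_countable M \<and> smooth_atlas M A"

text \<open>A connected manifold is understood to be nonempty, whereas \<^const>\<open>connected_space\<close> admits
  the empty space.\<close>

definition closed_connected_manifold :: "'a topology \<Rightarrow> ('a, 'n::finite) chart set \<Rightarrow> bool" where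
  "closed_connected_manifold M A \<longleftrightarrow>
     smooth_manifold M A \<and> compact_space M \<and> connected_space M \<and> topspace M \<noteq> {}"

definition smooth_map :: "('a, 'n::finite) chart set \<Rightarrow> ('a \<Rightarrow> 'b::real_normed_vector) \<Rightarrow> bool" where
  "smooth_map A f \<longleftrightarrow> (\<forall>c\<in>A. smooth_on (snd c ` fst c) (coord_rep c f))"

text \<open>\<open>differential c f p v\<close> is \<open>df\<close> applied to the tangent vector at \<open>p\<close> whose components
  in the chart \<open>c\<close> are \<open>v\<close>.\<close>

definition differential ::
  "('a, 'n::finite) chart \<Rightarrow> ('a \<Rightarrow> 'b::real_normed_vector) \<Rightarrow> 'a \<Rightarrow> real ^ 'n \<Rightarrow> 'b" where
  "differential c f p = frechet_derivative (coord_rep c f) (at (snd c p))"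

definition immersion :: "('a, 'n::finite) chart set \<Rightarrow> ('a \<Rightarrow> 'b::real_normed_vector) \<Rightarrow> bool" where
  "immersion A x \<longleftrightarrow> smooth_map A x \<and> (\<forall>c\<in>A. \<forall>p\<in>fst c. inj (differential c x p))"

section \<open>Immersed hypersurfaces\<close>

text \<open>Either of the two choices \<open>\<xi>\<close>, \<open>-\<xi>\<close> is allowed. If the mean curvature is positive on a
  closed hypersurface, then \<open>\<xi>\<close> is the inward one: it points inward where \<open>norm x\<close> is maximal.\<close>

definition unit_normal_field ::
  "('a, 'n::finite) chart set \<Rightarrow> ('a \<Rightarrow> real ^ 'k) \<Rightarrow> ('a \<Rightarrow> real ^ 'k) \<Rightarrow> bool" where
  "unit_normal_field A x \<xi> \<longleftrightarrow> smooth_map A \<xi> \<and>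
     (\<forall>c\<in>A. \<forall>p\<in>fst c. norm (\<xi> p) = 1 \<and> (\<forall>v. \<xi> p \<bullet> differential c x p v = 0))"

text \<open>The frame vectors \<open>e i\<close> are given by their components in the chart \<open>c\<close> and are
  orthonormal for the induced metric.\<close>

definition orthonormal_frame ::
  "('a, 'n::finite) chart \<Rightarrow> ('a \<Rightarrow> real ^ 'k) \<Rightarrow> 'a \<Rightarrow> ('n \<Rightarrow> real ^ 'n) \<Rightarrow> bool" where
  "orthonormal_frame c x p e \<longleftrightarrow>
     (\<forall>i j. differential c x p (e i) \<bullet> differential c x p (e j) = (if i = j then 1 else 0))"

text \<open>The matrix \<open>h\<close> of the second fundamental form in a frame \<open>e\<close>: evaluating
  \<open>d\<xi> = - (\<Sum>i j. h\<^sub>i\<^sub>j \<omega>\<^sub>j e\<^sub>i)\<close> on \<open>e\<^sub>j\<close>, where \<open>e\<^sub>i\<close> on the right-hand side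
  stands for the vector \<open>dx(e\<^sub>i)\<close> of the ambient space. Only the values at \<open>p\<close> of a local frame
  enter, so a frame of the tangent space at \<open>p\<close> suffices.\<close>

definition second_fundamental_form ::
  "('a, 'n::finite) chart \<Rightarrow> ('a \<Rightarrow> real ^ 'k) \<Rightarrow> ('a \<Rightarrow> real ^ 'k) \<Rightarrow> 'a \<Rightarrow> ('n \<Rightarrow> real ^ 'n) \<Rightarrow>
     real ^ 'n ^ 'n \<Rightarrow> bool" where
  "second_fundamental_form c x \<xi> p e h \<longleftrightarrow>
     (\<forall>j. differential c \<xi> p (e j) = - (\<Sum>i\<in>UNIV. h $ i $ j *\<^sub>R differential c x p (e i)))"

text \<open>\<open>h\<close> is the matrix of the second fundamental form at \<open>p\<close> in some chart and frame.\<close>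

definition sff_matrix_at ::
  "('a, 'n::finite) chart set \<Rightarrow> ('a \<Rightarrow> real ^ 'k) \<Rightarrow> ('a \<Rightarrow> real ^ 'k) \<Rightarrow> 'a \<Rightarrow> real ^ 'n ^ 'n \<Rightarrow> bool" where
  "sff_matrix_at A x \<xi> p h \<longleftrightarrow>
     (\<exists>c\<in>A. \<exists>e. p \<in> fst c \<and> orthonormal_frame c x p e \<and> second_fundamental_form c x \<xi> p e h)"

text \<open>Both quantities below are independent of the chart and the frame, so the definite
  descriptions are proper; see \<open>mean_curvature_eq\<close>, \<open>sff_norm_sq_eq\<close> and
  \<open>sff_matrix_exists\<close>. The mean curvature is the unnormalised trace.\<close>

definition mean_curvature ::
  "('a, 'n::finite) chart set \<Rightarrow> ('a \<Rightarrow> real ^ 'k) \<Rightarrow> ('a \<Rightarrow> real ^ 'k) \<Rightarrow> 'a \<Rightarrow> real" where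
  "mean_curvature A x \<xi> p = (THE H. \<exists>h. sff_matrix_at A x \<xi> p h \<and> H = (\<Sum>i\<in>UNIV. h $ i $ i))"

definition sff_norm_sq ::
  "('a, 'n::finite) chart set \<Rightarrow> ('a \<Rightarrow> real ^ 'k) \<Rightarrow> ('a \<Rightarrow> real ^ 'k) \<Rightarrow> 'a \<Rightarrow> real" where
  "sff_norm_sq A x \<xi> p =
     (THE S. \<exists>h. sff_matrix_at A x \<xi> p h \<and> S = (\<Sum>i\<in>UNIV. \<Sum>j\<in>UNIV. (h $ i $ j)\<^sup>2))"

definition self_expander ::
  "real \<Rightarrow> ('a, 'n::finite) chart set \<Rightarrow> 'a topology \<Rightarrow> ('a \<Rightarrow> real ^ 'k) \<Rightarrow> ('a \<Rightarrow> real ^ 'k) \<Rightarrow> bool" where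
  "self_expander lam A M x \<xi> \<longleftrightarrow>
     (\<forall>p\<in>topspace M. mean_curvature A x \<xi> p - 1/2 * (x p \<bullet> \<xi> p) = lam)"

definition round_sphere_at_origin :: "'a topology \<Rightarrow> ('a \<Rightarrow> real ^ 'k) \<Rightarrow> bool" where
  "round_sphere_at_origin M x \<longleftrightarrow> (\<exists>r>0. x ` topspace M = {y. norm y = r})"

section \<open>The curvatures are well defined\<close>

lemma chart_inj_on:
  assumes "chart_on M c" shows "inj_on (snd c) (fst c)"
proof -
  have "fst c \<subseteq> topspace M" using assms by (simp add: chart_on_def openin_subset)
  then have "topspace (subtopology M (fst c)) = fst c" by auto
  then show ?thesis using assms homeomorphic_imp_injective_map
    unfolding chart_on_def by metis
qed

lemma chart_open_image:
  assumes "chart_on M c" "openin M V" "V \<subseteq> fst c" shows "open (snd c ` V)"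
proof -
  have "openin (subtopology M (fst c)) V"
    using assms by (metis inf.absorb_iff2 openin_subtopology_Int2)
  then have "openin (top_of_set (snd c ` fst c)) (snd c ` V)"
    using assms(1) homeomorphic_imp_open_map unfolding chart_on_def open_map_def by blast
  then show ?thesis using assms(1) openin_open_trans unfolding chart_on_def by blast
qed

lemma smooth_map_differentiable:
  assumes "smooth_map A f" "c \<in> A" "p \<in> fst c"
  shows "coord_rep c f differentiable (at (snd c p))"
proof -
  have "Ck_on (Suc 0) (coord_rep c f) (snd c ` fst c)"
    using assms unfolding smooth_map_def smooth_on_def by blast
  then show ?thesis using assms(3) by simp
qed

lemma differential_has_derivative:
  assumes "smooth_map A f" "c \<in> A" "p \<in> fst c"
  shows "(coord_rep c f has_derivative differential c f p) (at (snd c p))"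
  using smooth_map_differentiable[OF assms] frechet_derivative_works
  unfolding differential_def by blast

lemma linear_differential:
  assumes "smooth_map A f" "c \<in> A" "p \<in> fst c"
  shows "linear (differential c f p)"
  using differential_has_derivative[OF assms] has_derivative_linear by blast

lemma differential_change_of_chart:
  assumes A: "smooth_atlas M A" and f: "smooth_map A f"
    and c: "c \<in> A" "p \<in> fst c" and d: "d \<in> A" "p \<in> fst d"
  shows "differential c f p v = differential d f p (differential c (snd d) p v)"
proof -
  let ?W = "snd c ` (fst c \<inter> fst d)"
  have cc: "chart_on M c" and cd: "chart_on M d"
    using A c d unfolding smooth_atlas_def by auto
  have op: "openin M (fst c \<inter> fst d)" using cc cd unfolding chart_on_def by blast
  have W: "open ?W" using chart_open_image[OF cc op] by simp
  have pW: "snd c p \<in> ?W" using c d by auto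
  have ic: "inv_into (fst c) (snd c) (snd c q) = q" if "q \<in> fst c" for q
    using chart_inj_on[OF cc] that by simp
  have id: "inv_into (fst d) (snd d) (snd d q) = q" if "q \<in> fst d" for q
    using chart_inj_on[OF cd] that by simp
  have "Ck_on (Suc 0) (coord_rep c (snd d)) ?W"
    using A c d unfolding smooth_atlas_def smooth_on_def by blast
  then have "coord_rep c (snd d) differentiable (at (snd c p))"
    using pW unfolding Ck_on.simps by blast
  then have t: "(coord_rep c (snd d) has_derivative differential c (snd d) p) (at (snd c p))"
    unfolding differential_def using frechet_derivative_works by blast
  have v: "coord_rep c (snd d) (snd c p) = snd d p" using ic c by (simp add: coord_rep_def)
  have "(coord_rep d f \<circ> coord_rep c (snd d) has_derivative
     differential d f p \<circ> differential c (snd d) p) (at (snd c p))"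
    using diff_chain_at[OF t] differential_has_derivative[OF f d] v by simp
  then have "(coord_rep c f has_derivative differential d f p \<circ> differential c (snd d) p)
     (at (snd c p))"
  proof (rule has_derivative_transform_within_open[OF _ W pW])
    fix y assume "y \<in> ?W"
    then obtain q where "q \<in> fst c" "q \<in> fst d" "y = snd c q" by auto
    then show "(coord_rep d f \<circ> coord_rep c (snd d)) y = coord_rep c f y"
      using ic id by (simp add: coord_rep_def)
  qed
  then show ?thesis
    using has_derivative_unique[OF differential_has_derivative[OF f c]] by force
qed

lemma sum_Kronecker:
  fixes a :: "'n::finite \<Rightarrow> real"
  shows "(\<Sum>i\<in>UNIV. a i * (if i = k then 1 else 0)) = a k"
        "(\<Sum>i\<in>UNIV. a i * (if k = i then 1 else 0)) = a k"
  by (simp_all add: if_distrib cong: if_cong)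

lemma orthonormal_inner_sum:
  fixes v :: "'n::finite \<Rightarrow> 'b::real_inner"
  assumes "\<And>i j. v i \<bullet> v j = (if i = j then 1 else 0)"
  shows "(\<Sum>i\<in>UNIV. a i *\<^sub>R v i) \<bullet> v k = a k"
  by (simp add: inner_sum_left assms sum_Kronecker)

lemma orthonormal_frame_spans:
  assumes lin: "linear (differential c x p)" and e: "orthonormal_frame c x p e"
  obtains a where "u = (\<Sum>i\<in>UNIV. (a i :: real) *\<^sub>R e i)"
proof -
  let ?D = "differential c x p"
  define E where "E = (\<lambda>a :: real ^ 'a. \<Sum>i\<in>UNIV. (a $ i) *\<^sub>R e i)"
  have on: "?D (e i) \<bullet> ?D (e j) = (if i = j then 1 else 0)" for i j
    using e unfolding orthonormal_frame_def by blast
  have lE: "linear E"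
    unfolding E_def by (auto intro!: linearI simp: scaleR_left_distrib sum.distrib scaleR_sum_right)
  have "inj E"
  proof (subst linear_injective_0[OF lE], intro allI impI)
    fix a assume "E a = 0"
    then have "(\<Sum>i\<in>UNIV. (a $ i) *\<^sub>R ?D (e i)) = 0"
      using linear_0[OF lin] unfolding E_def
      by (simp add: linear_sum[OF lin, symmetric] linear_cmul[OF lin, symmetric])
    then have "a $ k = 0" for k
      using orthonormal_inner_sum[of "\<lambda>i. ?D (e i)" "\<lambda>i. a $ i" k] on by simp
    then show "a = 0" by (simp add: vec_eq_iff)
  qed
  then have "surj E" using lE linear_injective_imp_surjective by blast
  then obtain a where "u = E a" by blast
  then show thesis using that unfolding E_def by blast
qed

lemma sff_same_chart:
  assumes lx: "linear (differential c x p)" and l\<xi>: "linear (differential c \<xi> p)"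
    and e: "orthonormal_frame c x p e" and h: "second_fundamental_form c x \<xi> p e h"
    and e': "orthonormal_frame c x p e'" and h': "second_fundamental_form c x \<xi> p e' h'"
  obtains Q where "orthogonal_matrix Q" "h' = transpose Q ** h ** Q"
proof -
  let ?D = "differential c x p" and ?N = "differential c \<xi> p"
  have on: "?D (e i) \<bullet> ?D (e j) = (if i = j then 1 else 0)" for i j
    using e unfolding orthonormal_frame_def by blast
  have on': "?D (e' i) \<bullet> ?D (e' j) = (if i = j then 1 else 0)" for i j
    using e' unfolding orthonormal_frame_def by blast
  have "\<forall>j. \<exists>a. e' j = (\<Sum>i\<in>UNIV. a i *\<^sub>R e i)"
    using orthonormal_frame_spans[OF lx e] by metis
  then obtain q where q: "\<And>j. e' j = (\<Sum>i\<in>UNIV. q j i *\<^sub>R e i)" by metis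
  define Q :: "real^'a^'a" where "Q = (\<chi> i j. q j i)"
  have De': "?D (e' j) = (\<Sum>i\<in>UNIV. q j i *\<^sub>R ?D (e i))" for j
    unfolding q by (simp add: linear_sum[OF lx] linear_cmul[OF lx])
  have Ne': "?N (e' j) = (\<Sum>i\<in>UNIV. q j i *\<^sub>R ?N (e i))" for j
    unfolding q by (simp add: linear_sum[OF l\<xi>] linear_cmul[OF l\<xi>])
  have De'e: "?D (e' j) \<bullet> ?D (e i) = q j i" for i j
    unfolding De' using orthonormal_inner_sum[of "\<lambda>i. ?D (e i)"] on by blast
  have "(\<Sum>i\<in>UNIV. q j i * q k i) = (if j = k then 1 else 0)" for j k
  proof -
    have "?D (e' j) \<bullet> ?D (e' k) = (\<Sum>i\<in>UNIV. q k i * (?D (e' j) \<bullet> ?D (e i)))"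
      unfolding De'[of k] by (simp add: inner_sum_right)
    then show ?thesis using on'[of j k] by (simp add: De'e mult.commute)
  qed
  then have QQ: "transpose Q ** Q = mat 1"
    by (simp add: vec_eq_iff matrix_matrix_mult_def transpose_def mat_def Q_def)
  then have oQ: "orthogonal_matrix Q" by (simp add: orthogonal_matrix)
  have Ne: "?N (e l) \<bullet> ?D (e i) = - h $ i $ l" for l i
    using h orthonormal_inner_sum[of "\<lambda>i. ?D (e i)" "\<lambda>i. h $ i $ l" i] on
    unfolding second_fundamental_form_def by simp
  have "h ** Q = Q ** h'"
  proof -
    have "(\<Sum>l\<in>UNIV. h $ i $ l * q j l) = (\<Sum>k\<in>UNIV. q k i * h' $ k $ j)" for i j
    proof -
      have "?N (e' j) \<bullet> ?D (e i) = (\<Sum>l\<in>UNIV. q j l * (?N (e l) \<bullet> ?D (e i)))"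
        unfolding Ne' by (simp add: inner_sum_left)
      also have "\<dots> = - (\<Sum>l\<in>UNIV. h $ i $ l * q j l)"
        by (simp add: Ne sum_negf mult.commute)
      finally have 1: "?N (e' j) \<bullet> ?D (e i) = - (\<Sum>l\<in>UNIV. h $ i $ l * q j l)" .
      have "?N (e' j) = - (\<Sum>k\<in>UNIV. h' $ k $ j *\<^sub>R ?D (e' k))"
        using h' unfolding second_fundamental_form_def by blast
      then have "?N (e' j) \<bullet> ?D (e i) = - (\<Sum>k\<in>UNIV. q k i * h' $ k $ j)"
        by (simp add: inner_sum_left De'e mult.commute)
      with 1 show ?thesis by simp
    qed
    then show ?thesis by (simp add: vec_eq_iff matrix_matrix_mult_def Q_def)
  qed
  then have "transpose Q ** h ** Q = h'"
    using QQ by (metis matrix_mul_assoc matrix_mul_lid)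
  then show thesis using that oQ by blast
qed

lemma sff_matrix_unique:
  assumes A: "smooth_atlas M A" and x: "smooth_map A x" and \<xi>: "smooth_map A \<xi>"
    and h: "sff_matrix_at A x \<xi> p h" and h': "sff_matrix_at A x \<xi> p h'"
  obtains Q where "orthogonal_matrix Q" "h' = transpose Q ** h ** Q"
proof -
  obtain c e where c: "c \<in> A" "p \<in> fst c" and e: "orthonormal_frame c x p e"
    and he: "second_fundamental_form c x \<xi> p e h" using h unfolding sff_matrix_at_def by blast
  obtain d e' where d: "d \<in> A" "p \<in> fst d" and e': "orthonormal_frame d x p e'"
    and he': "second_fundamental_form d x \<xi> p e' h'" using h' unfolding sff_matrix_at_def by blast
  let ?f = "\<lambda>i. differential c (snd d) p (e i)"
  have 1: "differential c x p v = differential d x p (differential c (snd d) p v)" for v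
    using differential_change_of_chart[OF A x c d] .
  have 2: "differential c \<xi> p v = differential d \<xi> p (differential c (snd d) p v)" for v
    using differential_change_of_chart[OF A \<xi> c d] .
  have f: "orthonormal_frame d x p ?f" using e unfolding orthonormal_frame_def 1 .
  have hf: "second_fundamental_form d x \<xi> p ?f h"
    using he unfolding second_fundamental_form_def 1 2 .
  show thesis
    using sff_same_chart[OF linear_differential[OF x d] linear_differential[OF \<xi> d] f hf e' he'] that
    by blast
qed

lemma sff_trace_unique:
  assumes "smooth_atlas M A" "smooth_map A x" "smooth_map A \<xi>"
    "sff_matrix_at A x \<xi> p h" "sff_matrix_at A x \<xi> p h'"
  shows "(\<Sum>i\<in>UNIV. h' $ i $ i) = (\<Sum>i\<in>UNIV. h $ i $ i)"
    and "(\<Sum>i\<in>UNIV. \<Sum>j\<in>UNIV. (h' $ i $ j)\<^sup>2) = (\<Sum>i\<in>UNIV. \<Sum>j\<in>UNIV. (h $ i $ j)\<^sup>2)"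
proof -
  obtain Q where Q: "orthogonal_matrix Q" and h': "h' = transpose Q ** h ** Q"
    using sff_matrix_unique[OF assms] by blast
  have QQ: "Q ** transpose Q = mat 1" using Q unfolding orthogonal_matrix_def by blast
  have conj: "trace (transpose Q ** B ** Q) = trace B" for B
    unfolding trace_mul_sym[of "transpose Q ** B" Q] by (simp add: matrix_mul_assoc QQ)
  show "(\<Sum>i\<in>UNIV. h' $ i $ i) = (\<Sum>i\<in>UNIV. h $ i $ i)"
    using conj[of h] h' unfolding trace_def by simp
  have fro: "(\<Sum>i\<in>UNIV. \<Sum>j\<in>UNIV. (B $ i $ j)\<^sup>2) = trace (B ** transpose B)" for B :: "real^'b^'b"
    by (simp add: trace_def matrix_matrix_mult_def transpose_def power2_eq_square)
  have "transpose h' = transpose Q ** transpose h ** Q"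
    unfolding h' by (simp add: matrix_transpose_mul matrix_mul_assoc)
  then have "h' ** transpose h' = transpose Q ** (h ** transpose h) ** Q"
    unfolding h' using arg_cong[OF QQ, of "\<lambda>B. transpose Q ** h ** B ** transpose h ** Q"]
    by (simp only: matrix_mul_assoc matrix_mul_rid)
  then show "(\<Sum>i\<in>UNIV. \<Sum>j\<in>UNIV. (h' $ i $ j)\<^sup>2) = (\<Sum>i\<in>UNIV. \<Sum>j\<in>UNIV. (h $ i $ j)\<^sup>2)"
    unfolding fro using conj by simp
qed

lemma mean_curvature_eq:
  assumes "smooth_atlas M A" "smooth_map A x" "smooth_map A \<xi>" "sff_matrix_at A x \<xi> p h"
  shows "mean_curvature A x \<xi> p = (\<Sum>i\<in>UNIV. h $ i $ i)"
  unfolding mean_curvature_def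
proof (rule the_equality)
  show "\<exists>k. sff_matrix_at A x \<xi> p k \<and> (\<Sum>i\<in>UNIV. h $ i $ i) = (\<Sum>i\<in>UNIV. k $ i $ i)"
    by (rule exI[of _ h]) (simp add: assms(4))
next
  fix y assume "\<exists>k. sff_matrix_at A x \<xi> p k \<and> y = (\<Sum>i\<in>UNIV. k $ i $ i)"
  then obtain k where k: "sff_matrix_at A x \<xi> p k" and y: "y = (\<Sum>i\<in>UNIV. k $ i $ i)" by (elim exE conjE)
  show "y = (\<Sum>i\<in>UNIV. h $ i $ i)" unfolding y using sff_trace_unique(1)[OF assms k] .
qed

lemma sff_norm_sq_eq:
  assumes "smooth_atlas M A" "smooth_map A x" "smooth_map A \<xi>" "sff_matrix_at A x \<xi> p h"
  shows "sff_norm_sq A x \<xi> p = (\<Sum>i\<in>UNIV. \<Sum>j\<in>UNIV. (h $ i $ j)\<^sup>2)"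
  unfolding sff_norm_sq_def
proof (rule the_equality)
  show "\<exists>k. sff_matrix_at A x \<xi> p k \<and> (\<Sum>i\<in>UNIV. \<Sum>j\<in>UNIV. (h $ i $ j)\<^sup>2) = (\<Sum>i\<in>UNIV. \<Sum>j\<in>UNIV. (k $ i $ j)\<^sup>2)"
    by (rule exI[of _ h]) (simp add: assms(4))
next
  fix y assume "\<exists>k. sff_matrix_at A x \<xi> p k \<and> y = (\<Sum>i\<in>UNIV. \<Sum>j\<in>UNIV. (k $ i $ j)\<^sup>2)"
  then obtain k where k: "sff_matrix_at A x \<xi> p k" and y: "y = (\<Sum>i\<in>UNIV. \<Sum>j\<in>UNIV. (k $ i $ j)\<^sup>2)" by (elim exE conjE)
  show "y = (\<Sum>i\<in>UNIV. \<Sum>j\<in>UNIV. (h $ i $ j)\<^sup>2)" unfolding y using sff_trace_unique(2)[OF assms k] .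
qed

lemma orthonormal_frame_exists:
  assumes x: "immersion A x" and c: "c \<in> A" "p \<in> fst c"
  obtains e where "orthonormal_frame c x p e"
proof -
  let ?D = "differential c x p"
  have lin: "linear ?D" and inj: "inj ?D"
    using x c linear_differential[OF _ c, of x] unfolding immersion_def by simp_all
  have sub: "subspace (range ?D)" using lin linear_subspace_image subspace_UNIV by blast
  have "dim (range ?D) = CARD('b)" using dim_image_eq[OF lin, of UNIV] inj by simp
  then obtain B where B: "B \<subseteq> range ?D" "pairwise orthogonal B" "\<And>b. b \<in> B \<Longrightarrow> norm b = 1"
      "independent B" "card B = CARD('b)"
    using orthonormal_basis_subspace[OF sub] by metis
  then have "finite B" using independent_imp_finite by blast
  then obtain g :: "'b \<Rightarrow> _" where g: "bij_betw g UNIV B"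
    using B(5) finite_same_card_bij[of "UNIV :: 'b set" B] by auto
  have "\<forall>i. \<exists>u. ?D u = g i" using g B(1) unfolding bij_betw_def by (metis rangeE rangeI subsetD)
  then obtain e where e: "\<And>i. ?D (e i) = g i" by metis
  have "g i \<bullet> g j = (if i = j then 1 else 0)" for i j
  proof (cases "i = j")
    case True
    then show ?thesis using g B(3)[of "g i"] by (simp add: bij_betw_apply dot_square_norm)
  next
    case False
    then have "g i \<noteq> g j" using g by (metis UNIV_I bij_betw_inv_into_left)
    then show ?thesis using g B(2) False
      unfolding pairwise_def orthogonal_def by (simp add: bij_betw_apply)
  qed
  then show thesis using that e unfolding orthonormal_frame_def by metis
qed

lemma differential_normal_tangent:
  assumes A: "smooth_atlas M A" and N: "unit_normal_field A x \<xi>" and c: "c \<in> A" "p \<in> fst c"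
  shows "differential c \<xi> p v \<bullet> \<xi> p = 0"
proof -
  let ?U = "snd c ` fst c" and ?f = "coord_rep c \<xi>"
  have cc: "chart_on M c" using A c unfolding smooth_atlas_def by blast
  have \<xi>: "smooth_map A \<xi>" using N unfolding unit_normal_field_def by blast
  have inv: "?f (snd c q) = \<xi> q" if "q \<in> fst c" for q
    using chart_inj_on[OF cc] that by (simp add: coord_rep_def)
  have D: "(?f has_derivative differential c \<xi> p) (at (snd c p))"
    using differential_has_derivative[OF \<xi> c] .
  have op: "open ?U" and pU: "snd c p \<in> ?U" using cc c unfolding chart_on_def by auto
  have "((\<lambda>y. ?f y \<bullet> ?f y) has_derivative
     (\<lambda>v. ?f (snd c p) \<bullet> differential c \<xi> p v + differential c \<xi> p v \<bullet> ?f (snd c p))) (at (snd c p))"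
    using has_derivative_inner[OF D D] .
  then have 1: "((\<lambda>y. 1::real) has_derivative
     (\<lambda>v. ?f (snd c p) \<bullet> differential c \<xi> p v + differential c \<xi> p v \<bullet> ?f (snd c p))) (at (snd c p))"
  proof (rule has_derivative_transform_within_open[OF _ op pU])
    fix y assume "y \<in> ?U"
    then show "?f y \<bullet> ?f y = 1"
      using inv N c unfolding unit_normal_field_def by (auto simp: dot_square_norm)
  qed
  have "(\<lambda>v. ?f (snd c p) \<bullet> differential c \<xi> p v + differential c \<xi> p v \<bullet> ?f (snd c p)) = (\<lambda>v. 0)"
    using has_derivative_unique[OF 1 has_derivative_const] .
  then have "?f (snd c p) \<bullet> differential c \<xi> p v + differential c \<xi> p v \<bullet> ?f (snd c p) = 0"
    by (rule fun_cong)
  then show ?thesis using inv c by (simp add: inner_commute)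
qed

lemma sff_matrix_exists:
  fixes A :: "('a, 'n::finite) chart set" and x :: "'a \<Rightarrow> real ^ 'k"
  assumes dim: "CARD('k) = CARD('n) + 1" and A: "smooth_atlas M A" and x: "immersion A x"
    and N: "unit_normal_field A x \<xi>" and p: "p \<in> topspace M"
  obtains h where "sff_matrix_at A x \<xi> p h"
proof -
  obtain c where c: "c \<in> A" "p \<in> fst c" using A p unfolding smooth_atlas_def by blast
  obtain e where e: "orthonormal_frame c x p e" using orthonormal_frame_exists[OF x c] .
  let ?D = "differential c x p"
  have lin: "linear ?D" and inj: "inj ?D"
    using x c linear_differential[OF _ c, of x] unfolding immersion_def by simp_all
  have no: "norm (\<xi> p) = 1" and perp: "\<xi> p \<bullet> ?D v = 0" for v
    using N c unfolding unit_normal_field_def by blast+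
  have nz: "\<xi> p \<noteq> 0" using no by auto
  have "range ?D = {w. \<xi> p \<bullet> w = 0}"
  proof (rule subspace_dim_equal)
    show "subspace (range ?D)" using lin linear_subspace_image subspace_UNIV by blast
    show "subspace {w. \<xi> p \<bullet> w = 0}" by (rule subspace_hyperplane)
    show "range ?D \<subseteq> {w. \<xi> p \<bullet> w = 0}" using perp by blast
    show "dim (range ?D) \<ge> dim {w. \<xi> p \<bullet> w = 0}"
      using dim_image_eq[OF lin, of UNIV] inj dim_hyperplane[OF nz] dim by simp
  qed
  then have "\<exists>u. differential c \<xi> p v = ?D u" for v
    using differential_normal_tangent[OF A N c] by (auto simp: inner_commute)
  moreover have "\<exists>a. u = (\<Sum>i\<in>UNIV. (a i :: real) *\<^sub>R e i)" for u
    using orthonormal_frame_spans[OF lin e] by metis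
  ultimately have "\<forall>j. \<exists>a. differential c \<xi> p (e j) = ?D (\<Sum>i\<in>UNIV. (a i :: real) *\<^sub>R e i)"
    by metis
  then obtain a where "\<And>j. differential c \<xi> p (e j) = ?D (\<Sum>i\<in>UNIV. (a j i :: real) *\<^sub>R e i)"
    by metis
  then have "second_fundamental_form c x \<xi> p e (\<chi> i j. - a j i)"
    unfolding second_fundamental_form_def
    by (simp add: linear_sum[OF lin] linear_cmul[OF lin] sum_negf)
  then show thesis using that c e unfolding sff_matrix_at_def by blast
qed

text \<open>Sign convention: \<open>\<xi> = - x / r\<close> (pointing towards the centre) gives \<open>H = n / r\<close>.\<close>

lemma mean_curvature_round_sphere:
  fixes A :: "('a, 'n::finite) chart set" and x :: "'a \<Rightarrow> real ^ 'k"
  assumes A: "smooth_atlas M A" and x: "immersion A x" and N: "unit_normal_field A x \<xi>"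
    and r: "r > 0" and \<xi>: "\<And>q. q \<in> topspace M \<Longrightarrow> \<xi> q = - (1 / r) *\<^sub>R x q"
    and p: "p \<in> topspace M"
  shows "mean_curvature A x \<xi> p = CARD('n) / r"
proof -
  obtain c where c: "c \<in> A" "p \<in> fst c" using A p unfolding smooth_atlas_def by blast
  obtain e where e: "orthonormal_frame c x p e" using orthonormal_frame_exists[OF x c] .
  let ?U = "snd c ` fst c"
  have cc: "chart_on M c" using A c unfolding smooth_atlas_def by blast
  have op: "open ?U" and pU: "snd c p \<in> ?U" using cc c unfolding chart_on_def by auto
  have sx: "smooth_map A x" and s\<xi>: "smooth_map A \<xi>"
    using x N unfolding immersion_def unit_normal_field_def by auto
  have "((\<lambda>y. - (1 / r) *\<^sub>R coord_rep c x y) has_derivative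
      (\<lambda>v. - (1 / r) *\<^sub>R differential c x p v)) (at (snd c p))"
    using has_derivative_scaleR_right[OF differential_has_derivative[OF sx c]] .
  then have "(coord_rep c \<xi> has_derivative (\<lambda>v. - (1 / r) *\<^sub>R differential c x p v)) (at (snd c p))"
  proof (rule has_derivative_transform_within_open[OF _ op pU])
    fix y assume "y \<in> ?U"
    then have "inv_into (fst c) (snd c) y \<in> topspace M"
      using cc inv_into_into[of y "snd c" "fst c"] openin_subset unfolding chart_on_def by blast
    then show "- (1 / r) *\<^sub>R coord_rep c x y = coord_rep c \<xi> y"
      using \<xi> by (simp add: coord_rep_def)
  qed
  then have D: "differential c \<xi> p = (\<lambda>v. - (1 / r) *\<^sub>R differential c x p v)"
    using has_derivative_unique[OF differential_has_derivative[OF s\<xi> c]] by blast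
  have "second_fundamental_form c x \<xi> p e (\<chi> i j. if i = j then 1 / r else 0)"
    unfolding second_fundamental_form_def D
    by (simp add: if_distrib[of "\<lambda>a. a *\<^sub>R _"] cong: if_cong)
  then have "sff_matrix_at A x \<xi> p (\<chi> i j. if i = j then 1 / r else 0)"
    using c e unfolding sff_matrix_at_def by blast
  from mean_curvature_eq[OF A sx s\<xi> this] show ?thesis by simp
qed

end

theory Submission
  imports Defs
begin

text \<open>Differentiating \<open>H = \<lambda> + \<langle>x, \<xi>\<rangle> / 2\<close> twice gives, for the operator \<open>L = \<Delta> + 1/2 \<langle>x\<^sup>T, \<nabla>\<rangle>\<close>,
  \<open>L h = \<lambda> h\<^sup>2 - (1/2 + |h|\<^sup>2) h\<close> and \<open>L H = \<lambda> |h|\<^sup>2 - (1/2 + |h|\<^sup>2) H\<close>. The pinching condition forces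
  \<open>h \<ge> 0\<close>, and at a point of maximal \<open>|x|\<close> one sees that \<open>\<lambda> > 0\<close>.

  First, \<open>h > 0\<close>. By Sard's theorem some unit vector \<open>-y\<close> is not a normal at any point where \<open>h\<close> is
  degenerate; then \<open>exp (a \<langle>x, y\<rangle>)\<close> with \<open>a\<close> large is strictly \<open>L\<close>-subharmonic near all those points. If there
  were any, the minimum of \<open>h(w, w) - \<epsilon> exp (a \<langle>x, y\<rangle>)\<close> over unit tangent vectors \<open>w\<close> would contradict the
  maximum principle for small \<open>\<epsilon>\<close>. So the strong maximum principle is not needed.

  Next, at a minimum of \<open>h(w, w) / H\<close> the maximum principle yields \<open>|h|\<^sup>2 \<le> \<kappa> H\<close> for the least principal
  curvature \<open>\<kappa>\<close>. Hence that point is umbilic and the minimum is \<open>1/n\<close>, so all points are umbilic. Then \<open>H\<close> is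
  constant, and \<open>0 = \<nabla>H = - h(x\<^sup>T) / 2\<close> gives \<open>x\<^sup>T = 0\<close>, so \<open>|x|\<close> is constant.\<close>

section \<open>Calculus of smooth maps\<close>

text \<open>Strict convexity has to come first: if the minimum \<open>r\<close> of
  \<open>h(w, w) / H\<close> were 0, comparing \<open>r H\<close> with \<open>h\<close> would only
  yield 0 \<le> 0; the comparison becomes useful after division by \<open>r * lam\<close>. The
  excluded normal is \<open>-y\<close> alone for this reason: \<open>L\<close> applied to
  \<open>exp (a (x \<bullet> y))\<close> is a positive multiple of \<open>lam (\<xi> \<bullet> y) +
  (x \<bullet> y) / 2 + a (1 - (\<xi> \<bullet> y)^2)\<close>. A large \<open>a\<close> helps except
  where \<xi> = y or \<xi> = -y. There the other two terms add up to H > 0 and to -H respectively,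
  and Sard's theorem removes the degenerate points of the second kind. All tensor computations are
  made at a single point, in graph coordinates over the tangent plane there. The metric is the
  identity plus the square of \<open>df\<close>, and \<open>h\<close> is \<rho> times the Hessian of
  \<open>f\<close>. So the metric is euclidean to first order at that point, covariant derivatives
  become commuting partial derivatives, and curvature enters only through second derivatives of
  \<rho> and of the metric.\<close>

definition dir_deriv :: "'a \<Rightarrow> ('a::real_normed_vector \<Rightarrow> 'b::real_normed_vector) \<Rightarrow> 'a \<Rightarrow> 'b" where
  "dir_deriv v f y = frechet_derivative f (at y) v"

lemma dir_deriv_eqI: "(f has_derivative f') (at y) \<Longrightarrow> dir_deriv v f y = f' v"
  unfolding dir_deriv_def using frechet_derivative_at by metis

lemma Ck_on_cong:
  fixes f g :: "'a::real_normed_vector \<Rightarrow> 'b::real_normed_vector"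
  assumes "open S" "Ck_on k f S" "\<And>y. y \<in> S \<Longrightarrow> f y = g y"
  shows "Ck_on k g S"
  using assms(2,3)
proof (induction k arbitrary: f g)
  case 0
  then show ?case by (simp cong: continuous_on_cong)
next
  case (Suc k)
  have D: "(g has_derivative frechet_derivative f (at y)) (at y)" if y: "y \<in> S" for y
  proof -
    have "(f has_derivative frechet_derivative f (at y)) (at y)"
      using Suc.prems(1) y frechet_derivative_works by auto
    then show ?thesis
      by (rule has_derivative_transform_within_open[OF _ assms(1) y]) (use Suc.prems in auto)
  qed
  have "Ck_on k (\<lambda>y. frechet_derivative g (at y) v) S" for v
    by (rule Suc.IH[of "\<lambda>y. frechet_derivative f (at y) v"])
      (use Suc.prems(1) frechet_derivative_at[OF D] in auto)
  then show ?case using D unfolding Ck_on.simps by (blast intro: differentiableI)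
qed

text \<open>Lets any derivative formula replace the \<open>frechet_derivative\<close> of the
  definition; the closure rules are proved through it.\<close>

lemma Ck_on_SucI:
  assumes "open S" "\<And>y. y \<in> S \<Longrightarrow> (f has_derivative f' y) (at y)" "\<And>v. Ck_on k (\<lambda>y. f' y v) S"
  shows "Ck_on (Suc k) f S"
  unfolding Ck_on.simps
proof (intro conjI ballI allI)
  show "f differentiable at y" if "y \<in> S" for y using assms(2)[OF that] by (rule differentiableI)
  show "Ck_on k (\<lambda>y. frechet_derivative f (at y) v) S" for v
    by (rule Ck_on_cong[OF assms(1) assms(3)[of v]]) (use frechet_derivative_at[OF assms(2)] in auto)
qed

lemma Ck_on_SucD:
  assumes "Ck_on (Suc k) f S"
  shows "y \<in> S \<Longrightarrow> (f has_derivative (\<lambda>v. dir_deriv v f y)) (at y)" "Ck_on k (dir_deriv v f) S"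
  using assms frechet_derivative_works by (auto simp: dir_deriv_def[abs_def])

lemma Ck_on_lower: "Ck_on (Suc k) f S \<Longrightarrow> Ck_on k f S"
proof (induction k arbitrary: f)
  case 0
  then show ?case by (auto intro!: continuous_at_imp_continuous_on differentiable_imp_continuous_within)
next
  case (Suc k)
  have "Ck_on k (\<lambda>y. frechet_derivative f (at y) v) S" for v
    by (rule Suc.IH) (use Suc.prems in simp)
  then show ?case using Suc.prems unfolding Ck_on.simps by blast
qed

lemma Ck_on_subset: "Ck_on k f S \<Longrightarrow> T \<subseteq> S \<Longrightarrow> Ck_on k f T"
  by (induction k arbitrary: f) (auto intro: continuous_on_subset)

lemma Ck_on_const: "Ck_on k (\<lambda>_. c) S"
  by (induction k arbitrary: c) auto

lemma Ck_on_add: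
  assumes "open S" "Ck_on k f S" "Ck_on k g S" shows "Ck_on k (\<lambda>y. f y + g y) S"
  using assms(2,3)
proof (induction k arbitrary: f g)
  case 0
  then show ?case by (simp add: continuous_on_add)
next
  case (Suc k)
  show ?case
    by (rule Ck_on_SucI[OF assms(1) has_derivative_add[OF Ck_on_SucD(1) Ck_on_SucD(1)]])
      (use Suc Ck_on_SucD in blast)+
qed

lemma Ck_on_bounded_linear:
  assumes "open S" "bounded_linear h" "Ck_on k f S" shows "Ck_on k (\<lambda>y. h (f y)) S"
  using assms(3)
proof (induction k arbitrary: f)
  case 0
  then show ?case by (simp add: bounded_linear.continuous_on[OF assms(2)])
next
  case (Suc k)
  show ?case
    by (rule Ck_on_SucI[OF assms(1) bounded_linear.has_derivative[OF assms(2) Ck_on_SucD(1)]])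
      (use Suc Ck_on_SucD in blast)+
qed

lemma Ck_on_bilinear:
  assumes "open S" "bounded_bilinear prd" "Ck_on k f S" "Ck_on k g S"
  shows "Ck_on k (\<lambda>y. prd (f y) (g y)) S"
  using assms(3,4)
proof (induction k arbitrary: f g)
  case 0
  then show ?case by (simp add: bounded_bilinear.continuous_on[OF assms(2)])
next
  case (Suc k)
  \<comment> \<open>The Leibniz formula keeps one factor undifferentiated, and the induction
    hypothesis wants that factor one order lower.\<close>
  have low: "Ck_on k f S" "Ck_on k g S" using Suc.prems Ck_on_lower by blast+
  show ?case
    by (rule Ck_on_SucI[OF assms(1) bounded_bilinear.FDERIV[OF assms(2) Ck_on_SucD(1) Ck_on_SucD(1)]])
      (use Suc.prems low in \<open>auto intro!: Ck_on_add[OF assms(1)] Suc.IH Ck_on_SucD(2)\<close>)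
qed

section \<open>Closure properties of smooth maps\<close>

lemma smooth_onI_Ck: "(\<And>k. Ck_on k f S) \<Longrightarrow> smooth_on S f"
  by (simp add: smooth_on_def)

lemma smooth_on_has_derivative:
  "smooth_on S f \<Longrightarrow> y \<in> S \<Longrightarrow> (f has_derivative (\<lambda>v. dir_deriv v f y)) (at y)"
  using Ck_on_SucD(1)[of 0] unfolding smooth_on_def by blast

lemma smooth_on_dir_deriv: "smooth_on S f \<Longrightarrow> smooth_on S (dir_deriv v f)"
  using Ck_on_SucD(2) unfolding smooth_on_def by blast

lemma smooth_on_continuous: "smooth_on S f \<Longrightarrow> continuous_on S f"
  unfolding smooth_on_def using Ck_on.simps(1) by blast

lemma smooth_on_subset: "smooth_on S f \<Longrightarrow> T \<subseteq> S \<Longrightarrow> smooth_on T f"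
  unfolding smooth_on_def using Ck_on_subset by blast

lemma smooth_on_cong:
  "open S \<Longrightarrow> smooth_on S f \<Longrightarrow> (\<And>y. y \<in> S \<Longrightarrow> f y = g y) \<Longrightarrow> smooth_on S g"
  unfolding smooth_on_def using Ck_on_cong by blast

lemma smooth_on_const: "smooth_on S (\<lambda>_. c)"
  by (simp add: smooth_on_def Ck_on_const)

lemma smooth_on_add:
  "open S \<Longrightarrow> smooth_on S f \<Longrightarrow> smooth_on S g \<Longrightarrow> smooth_on S (\<lambda>y. f y + g y)"
  by (simp add: smooth_on_def Ck_on_add)

lemma smooth_on_bounded_linear:
  "open S \<Longrightarrow> bounded_linear h \<Longrightarrow> smooth_on S f \<Longrightarrow> smooth_on S (\<lambda>y. h (f y))"
  by (simp add: smooth_on_def Ck_on_bounded_linear)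

lemma smooth_on_bilinear:
  "open S \<Longrightarrow> bounded_bilinear prd \<Longrightarrow> smooth_on S f \<Longrightarrow> smooth_on S g \<Longrightarrow>
     smooth_on S (\<lambda>y. prd (f y) (g y))"
  by (simp add: smooth_on_def Ck_on_bilinear)

lemma smooth_on_mult:
  fixes f g :: "'a::real_normed_vector \<Rightarrow> 'b::real_normed_algebra"
  shows "open S \<Longrightarrow> smooth_on S f \<Longrightarrow> smooth_on S g \<Longrightarrow> smooth_on S (\<lambda>y. f y * g y)"
  by (rule smooth_on_bilinear[OF _ bounded_bilinear_mult])

lemma smooth_on_inner:
  fixes f g :: "'a::real_normed_vector \<Rightarrow> 'b::real_inner"
  shows "open S \<Longrightarrow> smooth_on S f \<Longrightarrow> smooth_on S g \<Longrightarrow> smooth_on S (\<lambda>y. f y \<bullet> g y)"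
  by (rule smooth_on_bilinear[OF _ bounded_bilinear_inner])

lemma smooth_on_scaleR:
  "open S \<Longrightarrow> smooth_on S f \<Longrightarrow> smooth_on S g \<Longrightarrow> smooth_on S (\<lambda>y. f y *\<^sub>R g y)"
  by (rule smooth_on_bilinear[OF _ bounded_bilinear_scaleR])

lemma smooth_on_minus: "open S \<Longrightarrow> smooth_on S f \<Longrightarrow> smooth_on S (\<lambda>y. - f y)"
  by (rule smooth_on_bounded_linear[OF _ bounded_linear_minus[OF bounded_linear_ident]])

lemma smooth_on_diff:
  "open S \<Longrightarrow> smooth_on S f \<Longrightarrow> smooth_on S g \<Longrightarrow> smooth_on S (\<lambda>y. f y - g y)"
  using smooth_on_add[OF _ _ smooth_on_minus, of S f g] by simp

lemma smooth_on_sum: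
  "open S \<Longrightarrow> (\<And>i. i \<in> I \<Longrightarrow> smooth_on S (f i)) \<Longrightarrow> smooth_on S (\<lambda>y. \<Sum>i\<in>I. f i y)"
  by (induction I rule: infinite_finite_induct) (auto simp: smooth_on_const smooth_on_add)

lemma smooth_on_prod:
  fixes f :: "'i \<Rightarrow> 'a::real_normed_vector \<Rightarrow> real"
  shows "open S \<Longrightarrow> (\<And>i. i \<in> I \<Longrightarrow> smooth_on S (f i)) \<Longrightarrow> smooth_on S (\<lambda>y. \<Prod>i\<in>I. f i y)"
  by (induction I rule: infinite_finite_induct) (auto simp: smooth_on_const smooth_on_mult)

text \<open>The derivative \<open>exp (f y) * dir_deriv v f y\<close> reproduces the function
  itself, so an induction on the order with \<open>f\<close> fixed closes. The same works for
  \<open>smooth_on_inverse\<close>.\<close>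

lemma smooth_on_exp:
  fixes f :: "'a::real_normed_vector \<Rightarrow> real"
  assumes "open S" "smooth_on S f" shows "smooth_on S (\<lambda>y. exp (f y))"
proof (rule smooth_onI_Ck)
  fix k show "Ck_on k (\<lambda>y. exp (f y)) S"
  proof (induction k)
    case 0
    then show ?case using smooth_on_continuous[OF assms(2)] by (simp add: continuous_on_exp)
  next
    case (Suc k)
    have "((\<lambda>y. exp (f y)) has_derivative (\<lambda>v. exp (f y) * dir_deriv v f y)) (at y)" if "y \<in> S" for y
      using DERIV_exp[THEN DERIV_compose_FDERIV, OF smooth_on_has_derivative[OF assms(2) that]]
      by (simp add: mult.commute)
    moreover have "Ck_on k (\<lambda>y. exp (f y) * dir_deriv v f y) S" for v
      using Ck_on_bilinear[OF assms(1) bounded_bilinear_mult Suc] smooth_on_dir_deriv[OF assms(2)]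
      unfolding smooth_on_def by blast
    ultimately show ?case by (rule Ck_on_SucI[OF assms(1)])
  qed
qed

lemma smooth_on_inverse:
  fixes f :: "'a::real_normed_vector \<Rightarrow> real"
  assumes "open S" "smooth_on S f" "\<And>y. y \<in> S \<Longrightarrow> f y \<noteq> 0" shows "smooth_on S (\<lambda>y. inverse (f y))"
proof (rule smooth_onI_Ck)
  fix k show "Ck_on k (\<lambda>y. inverse (f y)) S"
  proof (induction k)
    case 0
    then show ?case using smooth_on_continuous[OF assms(2)] assms(3) by (simp add: continuous_on_inverse)
  next
    case (Suc k)
    have "((\<lambda>y. inverse (f y)) has_derivative
        (\<lambda>v. - (inverse (f y) * dir_deriv v f y * inverse (f y)))) (at y)" if "y \<in> S" for y
      using Deriv.has_derivative_inverse[OF assms(3)[OF that] smooth_on_has_derivative[OF assms(2) that]] .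
    moreover have "Ck_on k (\<lambda>y. - (inverse (f y) * dir_deriv v f y * inverse (f y))) S" for v
      using smooth_on_dir_deriv[OF assms(2), of v] unfolding smooth_on_def
      by (intro Ck_on_bounded_linear[OF assms(1) bounded_linear_minus[OF bounded_linear_ident]]
           Ck_on_bilinear[OF assms(1) bounded_bilinear_mult] Suc) blast
    ultimately show ?case by (rule Ck_on_SucI[OF assms(1)])
  qed
qed

lemma smooth_on_det:
  fixes B :: "'a::real_normed_vector \<Rightarrow> real ^ 'n ^ 'n"
  assumes "open S" "\<And>i j. smooth_on S (\<lambda>y. B y $ i $ j)"
  shows "smooth_on S (\<lambda>y. det (B y))"
  unfolding det_def
  by (intro smooth_on_sum smooth_on_mult smooth_on_prod smooth_on_const assms)

lemma dir_deriv_cong: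
  assumes "open S" "y \<in> S" "\<And>z. z \<in> S \<Longrightarrow> f z = g z"
  shows "dir_deriv v f y = dir_deriv v g y"
proof -
  have "(f has_derivative f') (at y) \<longleftrightarrow> (g has_derivative f') (at y)" for f'
    using assms has_derivative_transform_within_open[OF _ assms(1,2), of f f' UNIV g]
      has_derivative_transform_within_open[OF _ assms(1,2), of g f' UNIV f] by auto
  then show ?thesis by (simp add: dir_deriv_def frechet_derivative_def)
qed

section \<open>Second derivatives: symmetry and behaviour at a minimum\<close>

lemma dir_deriv_line:
  assumes "(f has_derivative (\<lambda>v. dir_deriv v f (a + t *\<^sub>R v0))) (at (a + t *\<^sub>R v0))"
  shows "((\<lambda>t. f (a + t *\<^sub>R v0)) has_vector_derivative dir_deriv v0 f (a + t *\<^sub>R v0)) (at t)"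
proof -
  have "((\<lambda>t. a + t *\<^sub>R v0) has_derivative (\<lambda>s. s *\<^sub>R v0)) (at t)"
    by (auto intro!: derivative_eq_intros)
  from diff_chain_at[OF this assms] show ?thesis
    using linear_cmul[OF has_derivative_linear[OF assms]]
    by (simp add: has_vector_derivative_def o_def)
qed

lemma dir_deriv_line_real:
  fixes f :: "'a::real_normed_vector \<Rightarrow> real"
  assumes "smooth_on S f" "a + t *\<^sub>R v \<in> S"
  shows "((\<lambda>t. f (a + t *\<^sub>R v)) has_real_derivative dir_deriv v f (a + t *\<^sub>R v)) (at t)"
  using dir_deriv_line[OF smooth_on_has_derivative[OF assms]]
  by (simp add: has_real_derivative_iff_has_vector_derivative)

text \<open>Two uses of the mean value theorem: along \<open>v\<close> for the difference of
  \<open>f\<close> on two parallel segments, then along \<open>w\<close>. The second difference is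
  symmetric in \<open>v\<close> and \<open>w\<close>, which is what \<open>dir_deriv_commute\<close>
  exploits.\<close>

lemma second_difference:
  fixes f :: "'a::real_normed_vector \<Rightarrow> real"
  assumes f: "smooth_on S f" and S: "\<And>s t. 0 \<le> s \<Longrightarrow> s \<le> h \<Longrightarrow> 0 \<le> t \<Longrightarrow> t \<le> h \<Longrightarrow> a + s *\<^sub>R v + t *\<^sub>R w \<in> S"
    and h: "h > 0"
  obtains s t where "0 < s" "s < h" "0 < t" "t < h"
    "f (a + h *\<^sub>R v + h *\<^sub>R w) - f (a + h *\<^sub>R v) - f (a + h *\<^sub>R w) + f a
       = h * h * dir_deriv w (dir_deriv v f) (a + s *\<^sub>R v + t *\<^sub>R w)"
proof -
  let ?g = "\<lambda>s. f (a + h *\<^sub>R w + s *\<^sub>R v) - f (a + s *\<^sub>R v)"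
  have "\<exists>z>0. z < h \<and> ?g h - ?g 0 = (h - 0) *
      (dir_deriv v f (a + h *\<^sub>R w + z *\<^sub>R v) - dir_deriv v f (a + z *\<^sub>R v))"
  proof (rule MVT2[OF h])
    fix s assume s: "0 \<le> s" "s \<le> h"
    show "(?g has_real_derivative dir_deriv v f (a + h *\<^sub>R w + s *\<^sub>R v) - dir_deriv v f (a + s *\<^sub>R v)) (at s)"
      using S[OF s, of h] S[OF s, of 0] h
      by (intro DERIV_diff dir_deriv_line_real[OF f]) (auto simp: ac_simps)
  qed
  then obtain s where s: "0 < s" "s < h" "?g h - ?g 0 = h *
      (dir_deriv v f (a + h *\<^sub>R w + s *\<^sub>R v) - dir_deriv v f (a + s *\<^sub>R v))" by auto
  let ?k = "\<lambda>t. dir_deriv v f (a + s *\<^sub>R v + t *\<^sub>R w)"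
  have "\<exists>z>0. z < h \<and> ?k h - ?k 0 = (h - 0) * dir_deriv w (dir_deriv v f) (a + s *\<^sub>R v + z *\<^sub>R w)"
    using s S by (intro MVT2[OF h] dir_deriv_line_real[OF smooth_on_dir_deriv[OF f]]) auto
  then obtain t where t: "0 < t" "t < h"
      "?k h - ?k 0 = h * dir_deriv w (dir_deriv v f) (a + s *\<^sub>R v + t *\<^sub>R w)" by auto
  show thesis
  proof (rule that[OF s(1,2) t(1,2)])
    show "f (a + h *\<^sub>R v + h *\<^sub>R w) - f (a + h *\<^sub>R v) - f (a + h *\<^sub>R w) + f a
       = h * h * dir_deriv w (dir_deriv v f) (a + s *\<^sub>R v + t *\<^sub>R w)"
      using s(3) t(3) by (simp add: algebra_simps)
  qed
qed

text \<open>The symmetric second difference over a small parallelogram equals a value of either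
  mixed derivative near \<open>a\<close>; by continuity the two cannot differ at
  \<open>a\<close>.\<close>

lemma dir_deriv_commute:
  fixes f :: "'a::real_normed_vector \<Rightarrow> real"
  assumes S: "open S" and f: "smooth_on S f" and a: "a \<in> S"
  shows "dir_deriv v (dir_deriv w f) a = dir_deriv w (dir_deriv v f) a"
proof (rule ccontr)
  let ?F = "dir_deriv v (dir_deriv w f)" and ?G = "dir_deriv w (dir_deriv v f)"
  assume ne: "?F a \<noteq> ?G a"
  \<comment> \<open>Half the gap: values within \<open>e\<close> of \<open>?F a\<close> and values
    within \<open>e\<close> of \<open>?G a\<close> cannot coincide.\<close>
  define e where "e = \<bar>?F a - ?G a\<bar> / 2"
  have e: "e > 0" using ne by (simp add: e_def)
  have "isCont ?F a" "isCont ?G a"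
    using smooth_on_continuous[OF smooth_on_dir_deriv[OF smooth_on_dir_deriv[OF f]]] S a
      continuous_on_eq_continuous_at by blast+
  then have "eventually (\<lambda>y. dist (?F y) (?F a) < e \<and> dist (?G y) (?G a) < e \<and> y \<in> S) (at a)"
    using e eventually_at_in_open'[OF S a] unfolding isCont_def tendsto_iff by (simp add: eventually_conj)
  then obtain d where d: "d > 0" "\<And>y. y \<noteq> a \<Longrightarrow> dist y a < d \<Longrightarrow> dist (?F y) (?F a) < e \<and> dist (?G y) (?G a) < e \<and> y \<in> S"
    unfolding eventually_at by auto
  then have d': "dist (?F y) (?F a) < e \<and> dist (?G y) (?G a) < e \<and> y \<in> S" if "dist y a < d" for y
    using that e a by (cases "y = a") auto
  \<comment> \<open>Small enough to keep the whole parallelogram in the ball of radius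
    \<open>d\<close>; the summand 1 covers v = w = 0.\<close>
  define h where "h = d / (2 * (norm v + norm w + 1))"
  have pos: "norm v + norm w + 1 > 0" by (smt (verit) norm_ge_zero)
  have h: "h > 0" using d(1) pos by (simp add: h_def)
  have near: "dist (a + s *\<^sub>R v' + t *\<^sub>R w') a < d"
    if "0 \<le> s" "s \<le> h" "0 \<le> t" "t \<le> h" "(v', w') = (v, w) \<or> (v', w') = (w, v)" for s t v' w'
  proof -
    have "norm (s *\<^sub>R v' + t *\<^sub>R w') \<le> s * norm v' + t * norm w'"
      using that norm_triangle_ineq[of "s *\<^sub>R v'" "t *\<^sub>R w'"] by simp
    also have "\<dots> \<le> h * norm v' + h * norm w'"
      using that by (intro add_mono mult_right_mono) auto
    also have "\<dots> \<le> h * (norm v + norm w + 1)" using that h by (auto simp: algebra_simps)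
    also have "\<dots> = d / 2" using pos by (auto simp: h_def divide_simps)
    finally show ?thesis using d(1) by (simp add: dist_norm add.assoc)
  qed
  obtain s t where 1: "0 < s" "s < h" "0 < t" "t < h"
    "f (a + h *\<^sub>R v + h *\<^sub>R w) - f (a + h *\<^sub>R v) - f (a + h *\<^sub>R w) + f a
       = h * h * ?G (a + s *\<^sub>R v + t *\<^sub>R w)"
    by (rule second_difference[OF f _ h, of a v w]) (use d' near in auto)
  obtain s' t' where 2: "0 < s'" "s' < h" "0 < t'" "t' < h"
    "f (a + h *\<^sub>R w + h *\<^sub>R v) - f (a + h *\<^sub>R w) - f (a + h *\<^sub>R v) + f a
       = h * h * ?F (a + s' *\<^sub>R w + t' *\<^sub>R v)"
    by (rule second_difference[OF f _ h, of a w v]) (use d' near in auto)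
  have "h * h * ?F (a + s' *\<^sub>R w + t' *\<^sub>R v) = h * h * ?G (a + s *\<^sub>R v + t *\<^sub>R w)"
    using 1(5) 2(5) add.commute[of "h *\<^sub>R v" "h *\<^sub>R w"] by (simp only: add.assoc)
  then have "?F (a + s' *\<^sub>R w + t' *\<^sub>R v) = ?G (a + s *\<^sub>R v + t *\<^sub>R w)" using h by simp
  moreover have "dist (?F (a + s' *\<^sub>R w + t' *\<^sub>R v)) (?F a) < e"
    using d'[OF near[of s' t' w v]] 2 by auto
  moreover have "dist (?G (a + s *\<^sub>R v + t *\<^sub>R w)) (?G a) < e"
    using d'[OF near[of s t v w]] 1 by auto
  ultimately show False unfolding e_def dist_real_def by (simp add: abs_if field_simps split: if_splits)
qed

text \<open>A negative second derivative would make the first derivative negative just after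
  \<open>a\<close> on the line in direction \<open>v\<close>, and the mean value theorem would then
  give a value below the minimum.\<close>

lemma local_min_second_deriv:
  fixes f :: "'a::real_normed_vector \<Rightarrow> real"
  assumes S: "open S" and f: "smooth_on S f" and a: "a \<in> S" and mn: "\<And>y. y \<in> S \<Longrightarrow> f a \<le> f y"
  shows "dir_deriv v f a = 0" and "dir_deriv v (dir_deriv v f) a \<ge> 0"
proof -
  define T where "T = (\<lambda>t. a + t *\<^sub>R v) -` S"
  have T: "open T" "0 \<in> T"
    unfolding T_def using S a by (auto intro!: open_vimage continuous_intros)
  then obtain d where "d > 0" "\<And>t. dist t 0 < d \<Longrightarrow> t \<in> T"
    unfolding open_dist by metis
  then have d: "d > 0" "\<And>t. \<bar>t\<bar> < d \<Longrightarrow> a + t *\<^sub>R v \<in> S"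
    by (simp_all add: T_def dist_real_def)
  have D1: "((\<lambda>t. f (a + t *\<^sub>R v)) has_real_derivative dir_deriv v f (a + t *\<^sub>R v)) (at t)" if "\<bar>t\<bar> < d" for t
    using dir_deriv_line_real[OF f] d(2)[OF that] by blast
  show z: "dir_deriv v f a = 0"
    using DERIV_local_min[OF D1[of 0] d(1)] d mn by simp
  show "dir_deriv v (dir_deriv v f) a \<ge> 0"
  proof (rule ccontr)
    assume neg: "\<not> dir_deriv v (dir_deriv v f) a \<ge> 0"
    have "((\<lambda>t. dir_deriv v f (a + t *\<^sub>R v)) has_real_derivative dir_deriv v (dir_deriv v f) (a + 0 *\<^sub>R v)) (at 0)"
      using dir_deriv_line_real[OF smooth_on_dir_deriv[OF f], of a 0 v v] d a by simp
    from DERIV_neg_dec_right[OF this] neg obtain e where e: "e > 0"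
      "\<And>h. h > 0 \<Longrightarrow> h < e \<Longrightarrow> dir_deriv v f (a + h *\<^sub>R v) < 0" using z by auto
    define h where "h = min d e / 2"
    have h: "h > 0" "h < d" "h < e" using d e by (auto simp: h_def)
    have "\<exists>z>0. z < h \<and> f (a + h *\<^sub>R v) - f (a + 0 *\<^sub>R v) = (h - 0) * dir_deriv v f (a + z *\<^sub>R v)"
      using h by (intro MVT2[OF h(1)] D1) auto
    then obtain z where "0 < z" "z < h" "f (a + h *\<^sub>R v) - f a = h * dir_deriv v f (a + z *\<^sub>R v)" by auto
    then have "f (a + h *\<^sub>R v) < f a" using e(2)[of z] h by (smt (verit) mult_pos_neg)
    then show False using mn[of "a + h *\<^sub>R v"] d(2)[of h] h by force
  qed
qed

section \<open>Positive semidefinite matrices\<close>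

text \<open>Otherwise a small step from \<open>w\<close> against the gradient direction
  \<open>z = h *v w\<close> would make the quadratic form negative.\<close>

lemma psd_null_vector:
  fixes h :: "real ^ 'n::finite ^ 'n"
  assumes sym: "transpose h = h" and psd: "\<And>v. v \<bullet> (h *v v) \<ge> 0" and null: "w \<bullet> (h *v w) = 0"
  shows "h *v w = 0"
proof (rule ccontr)
  define z where "z = h *v w"
  assume "h *v w \<noteq> 0"
  then have d: "z \<bullet> z > 0" by (simp add: z_def)
  define c where "c = z \<bullet> (h *v z)"
  have c: "c \<ge> 0" using psd by (simp add: c_def)
  \<comment> \<open>The form at \<open>w - t *\<^sub>R z\<close> is
    \<open>t * (t * c - 2 * (z \<bullet> z))\<close>; this \<open>t\<close> makes
    \<open>t * c\<close> at most \<open>z \<bullet> z\<close>, and the summand 1 covers c =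
    0.\<close>
  define t where "t = z \<bullet> z / (c + 1)"
  have t: "t > 0" using c d by (simp add: t_def)
  have wz: "w \<bullet> (h *v z) = z \<bullet> z"
    using dot_lmul_matrix[of w h z] sym by (metis inner_commute transpose_matrix_vector z_def)
  have lin: "h *v (w - t *\<^sub>R z) = z - t *\<^sub>R (h *v z)"
    by (simp add: z_def matrix_vector_mult_diff_distrib matrix_vector_mult_scaleR)
  have "0 \<le> (w - t *\<^sub>R z) \<bullet> (h *v (w - t *\<^sub>R z))" by (rule psd)
  also have "\<dots> = w \<bullet> z - t * (w \<bullet> (h *v z)) - t * (z \<bullet> z) + t * t * c"
    unfolding lin c_def by (simp add: inner_diff_left inner_diff_right inner_commute algebra_simps)
  also have "\<dots> = t * (t * c - 2 * (z \<bullet> z))" using null by (simp add: wz algebra_simps flip: z_def)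
  finally have "t * c \<ge> 2 * (z \<bullet> z)" using t by (simp add: zero_le_mult_iff)
  moreover have "t * c \<le> z \<bullet> z" using c d by (simp add: t_def divide_simps mult_left_mono)
  ultimately show False using d by simp
qed

text \<open>The squared distance of \<open>h\<close> from a model matrix is nonnegative. The model
  has eigenvalue \<open>k\<close> on \<open>v\<close> and one common eigenvalue \<alpha> on the
  complement of \<open>v\<close>, so \<open>v\<close> need not be an eigenvector of
  \<open>h\<close>. The outcome is k^2 + (H - k)^2 / (n - 1) \<le> S, and pinching turns this into n
  k^2 \<le> 2 H k.\<close>

lemma psd_from_pinching:
  fixes h :: "real ^ 'n::finite ^ 'n"
  assumes n: "CARD('n) \<ge> 2" and H: "(\<Sum>i\<in>UNIV. h $ i $ i) > 0"
    and S: "(\<Sum>i\<in>UNIV. \<Sum>j\<in>UNIV. (h $ i $ j)\<^sup>2) \<le> (\<Sum>i\<in>UNIV. h $ i $ i)\<^sup>2 / (real CARD('n) - 1)"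
    and v: "v \<bullet> v = 1"
  shows "v \<bullet> (h *v v) \<ge> 0"
proof -
  let ?H = "\<Sum>i\<in>UNIV. h $ i $ i" and ?S = "\<Sum>i\<in>UNIV. \<Sum>j\<in>UNIV. (h $ i $ j)\<^sup>2" and ?n = "real CARD('n)"
  define k where "k = v \<bullet> (h *v v)"
  \<comment> \<open>The value for which the model matrix has the same trace as
    \<open>h\<close>.\<close>
  define \<alpha> where "\<alpha> = (?H - k) / (?n - 1)"
  have vv: "(\<Sum>i\<in>UNIV. v $ i * v $ i) = 1" using v by (simp add: inner_vec_def)
  let ?d = "\<lambda>i j. if i = j then 1 else 0 :: real"
  have k: "(\<Sum>i\<in>UNIV. \<Sum>j\<in>UNIV. h $ i $ j * (v $ i * v $ j)) = k"
    by (simp add: k_def inner_vec_def matrix_vector_mult_def sum_distrib_left ac_simps)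
  have 1: "(\<Sum>i\<in>UNIV. \<Sum>j\<in>UNIV. (v $ i * v $ j) * (v $ i * v $ j)) = 1"
  proof -
    have "(\<Sum>i\<in>UNIV. \<Sum>j\<in>UNIV. (v $ i * v $ j) * (v $ i * v $ j))
        = (\<Sum>i\<in>UNIV. v $ i * v $ i * (\<Sum>j\<in>UNIV. v $ j * v $ j))"
      by (simp add: sum_distrib_left ac_simps)
    then show ?thesis by (simp add: vv)
  qed
  have 2: "(\<Sum>i\<in>UNIV. \<Sum>j\<in>UNIV. h $ i $ j * ?d i j) = ?H"
    "(\<Sum>i\<in>UNIV. \<Sum>j\<in>UNIV. (v $ i * v $ j) * ?d i j) = 1"
    "(\<Sum>i::'n\<in>UNIV. \<Sum>j\<in>UNIV. ?d i j) = ?n"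
    by (simp_all add: sum_Kronecker vv)
  have "0 \<le> (\<Sum>i\<in>UNIV. \<Sum>j\<in>UNIV. (h $ i $ j - (k - \<alpha>) * (v $ i * v $ j) - \<alpha> * ?d i j)\<^sup>2)"
    by (intro sum_nonneg zero_le_power2)
  also have "\<dots> = (\<Sum>i\<in>UNIV. \<Sum>j\<in>UNIV. (h $ i $ j)\<^sup>2 + (k - \<alpha>)\<^sup>2 * ((v $ i * v $ j) * (v $ i * v $ j))
      + \<alpha>\<^sup>2 * ?d i j - 2 * (k - \<alpha>) * (h $ i $ j * (v $ i * v $ j)) - 2 * \<alpha> * (h $ i $ j * ?d i j)
      + 2 * (k - \<alpha>) * \<alpha> * ((v $ i * v $ j) * ?d i j))"
    by (intro sum.cong refl) (simp add: power2_eq_square algebra_simps)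
  also have "\<dots> = ?S + (k - \<alpha>)\<^sup>2 + \<alpha>\<^sup>2 * ?n - 2 * (k - \<alpha>) * k - 2 * \<alpha> * ?H + 2 * (k - \<alpha>) * \<alpha>"
    unfolding sum.distrib sum_subtractf sum_distrib_left[symmetric] 1 2 k by simp
  also have "\<dots> = ?S - k\<^sup>2 - 2 * \<alpha> * (?H - k) + \<alpha> * (\<alpha> * (?n - 1))"
    by (simp add: power2_eq_square algebra_simps)
  also have "\<alpha> * (?n - 1) = ?H - k" using n by (simp add: \<alpha>_def)
  finally have "k\<^sup>2 + \<alpha> * (?H - k) \<le> ?S" by (simp add: algebra_simps)
  also have "\<dots> \<le> ?H\<^sup>2 / (?n - 1)" by (rule S)
  finally have "k\<^sup>2 + (?H - k)\<^sup>2 / (?n - 1) \<le> ?H\<^sup>2 / (?n - 1)"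
    by (simp add: \<alpha>_def power2_eq_square)
  moreover have n1: "?n - 1 > 0" using n by simp
  ultimately have "(k\<^sup>2 + (?H - k)\<^sup>2 / (?n - 1)) * (?n - 1) \<le> ?H\<^sup>2 / (?n - 1) * (?n - 1)"
    by (intro mult_right_mono) simp_all
  then have "k\<^sup>2 * (?n - 1) + (?H - k)\<^sup>2 \<le> ?H\<^sup>2" using n1 by (simp add: distrib_right)
  then have "k\<^sup>2 * ?n \<le> 2 * (?H * k)" by (simp add: power2_eq_square algebra_simps)
  then have "0 \<le> ?H * k" using n by (smt (verit) mult_nonneg_nonneg of_nat_0_le_iff zero_le_power2)
  then show ?thesis using H by (simp add: k_def zero_le_mult_iff)
qed

text \<open>The diagonal entries are nonnegative with sum zero, so every basis vector is a null
  vector and every column vanishes by \<open>psd_null_vector\<close>.\<close>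

lemma psd_trace_zero:
  fixes B :: "real ^ 'n::finite ^ 'n"
  assumes sym: "transpose B = B" and psd: "\<And>v. v \<bullet> (B *v v) \<ge> 0" and tr: "(\<Sum>i\<in>UNIV. B $ i $ i) = 0"
  shows "B = 0"
proof -
  have d: "axis i 1 \<bullet> (B *v axis i 1) = B $ i $ i" for i
    by (simp add: inner_axis' matrix_vector_mul_component inner_axis)
  have "B $ i $ i \<ge> 0" for i using psd[of "axis i 1"] d by simp
  then have "B $ i $ i = 0" for i
    using tr sum_nonneg_eq_0_iff[of UNIV "\<lambda>i. B $ i $ i"] by simp
  then have "B *v axis i 1 = 0" for i
    using psd_null_vector[OF sym psd] d by simp
  then have "column i B = 0" for i by (simp add: matrix_vector_mult_basis)
  then have "B $ j $ i = 0" for i j by (simp add: column_def vec_eq_iff)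
  then show ?thesis by (simp add: vec_eq_iff)
qed

text \<open>For B = h - \<mu> I the assumption on the squared norm reads |B|^2 + \<mu> tr B \<le> 0,
  while the diagonal of B is nonnegative; so tr B = 0.\<close>

lemma umbilic_from_trace_bound:
  fixes h :: "real ^ 'n::finite ^ 'n"
  assumes sym: "transpose h = h" and \<mu>: "\<mu> > 0" and ge: "\<And>v. v \<bullet> (h *v v) \<ge> \<mu> * (v \<bullet> v)"
    and S: "(\<Sum>i\<in>UNIV. \<Sum>j\<in>UNIV. (h $ i $ j)\<^sup>2) \<le> \<mu> * (\<Sum>i\<in>UNIV. h $ i $ i)"
  shows "(\<Sum>i\<in>UNIV. h $ i $ i) = real CARD('n) * \<mu>"
proof -
  let ?d = "\<lambda>i j. if i = j then 1 else 0 :: real"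
  define B where "B = h - \<mu> *\<^sub>R mat 1"
  have B: "h $ i $ j = B $ i $ j + \<mu> * ?d i j" for i j by (simp add: B_def mat_def)
  have "axis i 1 \<bullet> (h *v axis i 1) = h $ i $ i" for i
    by (simp add: inner_axis' matrix_vector_mul_component inner_axis)
  then have tr: "B $ i $ i \<ge> 0" for i using ge[of "axis i 1"] by (simp add: B inner_axis)
  have H: "(\<Sum>i\<in>UNIV. h $ i $ i) = (\<Sum>i\<in>UNIV. B $ i $ i) + \<mu> * real CARD('n)"
    by (simp add: B sum.distrib)
  have "(\<Sum>i\<in>UNIV. \<Sum>j\<in>UNIV. (h $ i $ j)\<^sup>2)
      = (\<Sum>i\<in>UNIV. \<Sum>j\<in>UNIV. (B $ i $ j)\<^sup>2 + 2 * \<mu> * (B $ i $ j * ?d i j) + \<mu>\<^sup>2 * ?d i j)"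
    unfolding B by (intro sum.cong refl) (simp add: power2_eq_square algebra_simps)
  also have "\<dots> = (\<Sum>i\<in>UNIV. \<Sum>j\<in>UNIV. (B $ i $ j)\<^sup>2) + 2 * \<mu> * (\<Sum>i\<in>UNIV. B $ i $ i) + \<mu>\<^sup>2 * real CARD('n)"
    unfolding sum.distrib sum_distrib_left[symmetric] by (simp add: sum_Kronecker)
  finally have "(\<Sum>i\<in>UNIV. \<Sum>j\<in>UNIV. (B $ i $ j)\<^sup>2) + \<mu> * (\<Sum>i\<in>UNIV. B $ i $ i) \<le> 0"
    using S unfolding H by (simp add: power2_eq_square algebra_simps)
  moreover have "(\<Sum>i\<in>UNIV. \<Sum>j\<in>UNIV. (B $ i $ j)\<^sup>2) \<ge> 0" by (intro sum_nonneg) simp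
  ultimately have "\<mu> * (\<Sum>i\<in>UNIV. B $ i $ i) \<le> 0" by linarith
  moreover have "(\<Sum>i\<in>UNIV. B $ i $ i) \<ge> 0" by (intro sum_nonneg tr)
  ultimately have "(\<Sum>i\<in>UNIV. B $ i $ i) = 0" using \<mu> by (simp add: mult_le_0_iff)
  then show ?thesis by (simp add: H)
qed

section \<open>Graph coordinates over a tangent plane\<close>

lemma has_derivative_axis_expand:
  fixes f :: "real ^ 'n::finite \<Rightarrow> 'b::real_normed_vector"
  assumes "smooth_on S f" "u \<in> S"
  shows "dir_deriv v f u = (\<Sum>k\<in>UNIV. v $ k *\<^sub>R dir_deriv (axis k 1) f u)"
proof -
  have lin: "linear (\<lambda>v. dir_deriv v f u)"
    using has_derivative_linear[OF smooth_on_has_derivative[OF assms]] .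
  have "dir_deriv v f u = dir_deriv (\<Sum>k\<in>UNIV. v $ k *\<^sub>R axis k 1) f u"
    by (simp add: basis_expansion flip: scalar_mult_eq_scaleR)
  also have "\<dots> = (\<Sum>k\<in>UNIV. v $ k *\<^sub>R dir_deriv (axis k 1) f u)"
    by (simp add: linear_sum[OF lin] linear_cmul[OF lin])
  finally show ?thesis .
qed

text \<open>A parametrised piece of hypersurface that projects to its tangent plane at
  \<open>u0\<close> with invertible differential. The given parametrisation is kept throughout:
  graph coordinates enter only through their coordinate vector fields, obtained pointwise by
  inverting a matrix. \<open>span_\<tau>\<close> says that the \<open>\<tau> i\<close> and
  \<open>N u0\<close> form an orthonormal basis.\<close>

locale graph_patch =
  fixes X N :: "real ^ 'n::finite \<Rightarrow> real ^ 'k::finite" and U :: "(real ^ 'n) set" and u0 :: "real ^ 'n"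
    and \<tau> :: "'n \<Rightarrow> real ^ 'k"
  assumes open_U: "open U" and u0: "u0 \<in> U"
    and smooth_X: "smooth_on U X" and smooth_N: "smooth_on U N"
    and unit_N: "\<And>u. u \<in> U \<Longrightarrow> N u \<bullet> N u = 1"
    and normal_N: "\<And>u v. u \<in> U \<Longrightarrow> N u \<bullet> dir_deriv v X u = 0"
    and orthonormal_\<tau>: "\<And>i j. \<tau> i \<bullet> \<tau> j = (if i = j then 1 else 0)"
    and tangent_\<tau>: "\<And>i. \<tau> i \<bullet> N u0 = 0"
    and span_\<tau>: "\<And>w. w = (\<Sum>i\<in>UNIV. (w \<bullet> \<tau> i) *\<^sub>R \<tau> i) + (w \<bullet> N u0) *\<^sub>R N u0"
    and det_nz: "\<And>u. u \<in> U \<Longrightarrow> det (\<chi> i j. dir_deriv (axis j 1) X u \<bullet> \<tau> i) \<noteq> 0"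
begin

text \<open>The Jacobian of the projection to the tangent plane at \<open>u0\<close>.\<close>

definition J :: "real ^ 'n \<Rightarrow> real ^ 'n ^ 'n" where
  "J u = (\<chi> i j. dir_deriv (axis j 1) X u \<bullet> \<tau> i)"

text \<open>Cramer's rule makes the smooth dependence of \<open>J u\<inverse> v\<close> on \<open>u\<close> evident.\<close>

definition E :: "real ^ 'n \<Rightarrow> real ^ 'n \<Rightarrow> real ^ 'n" where
  "E v u = (\<chi> k. det (\<chi> i j. if j = k then v $ i else J u $ i $ j) * inverse (det (J u)))"

text \<open>The \<open>E v\<close> are the coordinate fields of the coordinates \<open>X u \<bullet> \<tau> i\<close>, so the \<open>D v\<close> commute.\<close>

definition D :: "real ^ 'n \<Rightarrow> (real ^ 'n \<Rightarrow> 'b::real_normed_vector) \<Rightarrow> real ^ 'n \<Rightarrow> 'b" where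
  "D v \<phi> u = dir_deriv (E v u) \<phi> u"

lemmas smooth_intros = open_U smooth_on_add smooth_on_diff smooth_on_minus smooth_on_mult smooth_on_scaleR
  smooth_on_sum smooth_on_const smooth_on_inner smooth_X smooth_N smooth_on_det smooth_on_inverse

lemma J_E: "u \<in> U \<Longrightarrow> J u *v E v u = v"
  using cramer[of "J u" "E v u" v] det_nz[of u] by (simp add: J_def[symmetric] E_def divide_inverse)

lemma E_unique: "u \<in> U \<Longrightarrow> J u *v e = v \<Longrightarrow> e = E v u"
  using cramer[of "J u" e v] det_nz[of u] by (simp add: J_def[symmetric] E_def divide_inverse)

lemma E_sum: "u \<in> U \<Longrightarrow> E (\<Sum>i\<in>I. c i *\<^sub>R v i) u = (\<Sum>i\<in>I. c i *\<^sub>R E (v i) u)"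
  by (rule E_unique[symmetric])
    (simp_all add: linear_sum[OF matrix_vector_mul_linear] linear_cmul[OF matrix_vector_mul_linear] J_E)

lemma smooth_E: "smooth_on U (\<lambda>u. E v u $ k)"
proof -
  have J: "smooth_on U (\<lambda>u. J u $ i $ j)" for i j
    unfolding J_def by (simp add: smooth_intros smooth_on_dir_deriv)
  have "smooth_on U (\<lambda>u. if j = k then v $ i else J u $ i $ j)" for i j
    by (cases "j = k") (simp_all add: J smooth_on_const)
  then have "smooth_on U (\<lambda>u. det (\<chi> i j. if j = k then v $ i else J u $ i $ j))"
    by (intro smooth_on_det[OF open_U]) simp
  moreover have "smooth_on U (\<lambda>u. inverse (det (J u)))"
    using det_nz by (intro smooth_on_inverse smooth_on_det open_U J) (simp add: J_def)
  ultimately show ?thesis by (simp add: E_def smooth_on_mult open_U)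
qed

lemma D_axis: "smooth_on U \<phi> \<Longrightarrow> u \<in> U \<Longrightarrow> D v \<phi> u = (\<Sum>k\<in>UNIV. E v u $ k *\<^sub>R dir_deriv (axis k 1) \<phi> u)"
  unfolding D_def by (rule has_derivative_axis_expand)

lemma smooth_D: "smooth_on U \<phi> \<Longrightarrow> smooth_on U (D v \<phi>)"
  by (rule smooth_on_cong[OF open_U _ D_axis[symmetric]])
    (auto intro!: smooth_on_sum open_U smooth_on_scaleR smooth_E smooth_on_dir_deriv)

lemma D_eqI: "(\<phi> has_derivative \<phi>') (at u) \<Longrightarrow> D v \<phi> u = \<phi>' (E v u)"
  unfolding D_def by (rule dir_deriv_eqI)

lemma D_cong: "(\<And>z. z \<in> U \<Longrightarrow> \<phi> z = \<psi> z) \<Longrightarrow> u \<in> U \<Longrightarrow> D v \<phi> u = D v \<psi> u"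
  unfolding D_def by (rule dir_deriv_cong[OF open_U])

lemma D_sum_dir:
  assumes "smooth_on U \<phi>" "u \<in> U"
  shows "D v \<phi> u = (\<Sum>i\<in>UNIV. v $ i *\<^sub>R D (axis i 1) \<phi> u)"
proof -
  have lin: "linear (\<lambda>v. dir_deriv v \<phi> u)"
    using has_derivative_linear[OF smooth_on_has_derivative[OF assms]] .
  have "D v \<phi> u = dir_deriv (E (\<Sum>i\<in>UNIV. v $ i *\<^sub>R axis i 1) u) \<phi> u"
    by (simp add: D_def basis_expansion flip: scalar_mult_eq_scaleR)
  then show ?thesis
    by (simp add: E_sum[OF assms(2)] linear_sum[OF lin] linear_cmul[OF lin] D_def)
qed

lemma D_const [simp]: "D v (\<lambda>_. c) u = 0"
  using D_eqI[OF has_derivative_const] .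

lemma D_bilinear:
  assumes "bounded_bilinear prd" "smooth_on U \<phi>" "smooth_on U \<psi>" "u \<in> U"
  shows "D v (\<lambda>z. prd (\<phi> z) (\<psi> z)) u = prd (\<phi> u) (D v \<psi> u) + prd (D v \<phi> u) (\<psi> u)"
  using D_eqI[OF bounded_bilinear.FDERIV[OF assms(1) smooth_on_has_derivative smooth_on_has_derivative]] assms
  by (simp add: D_def)

lemma D_mult:
  fixes \<phi> \<psi> :: "real ^ 'n \<Rightarrow> real"
  shows "smooth_on U \<phi> \<Longrightarrow> smooth_on U \<psi> \<Longrightarrow> u \<in> U \<Longrightarrow>
    D v (\<lambda>z. \<phi> z * \<psi> z) u = \<phi> u * D v \<psi> u + D v \<phi> u * \<psi> u"
  by (rule D_bilinear[OF bounded_bilinear_mult])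

lemma D_inner:
  "smooth_on U \<phi> \<Longrightarrow> smooth_on U \<psi> \<Longrightarrow> u \<in> U \<Longrightarrow>
    D v (\<lambda>z. \<phi> z \<bullet> \<psi> z) u = \<phi> u \<bullet> D v \<psi> u + D v \<phi> u \<bullet> \<psi> u"
  by (rule D_bilinear[OF bounded_bilinear_inner])

lemma D_add: "smooth_on U \<phi> \<Longrightarrow> smooth_on U \<psi> \<Longrightarrow> u \<in> U \<Longrightarrow>
    D v (\<lambda>z. \<phi> z + \<psi> z) u = D v \<phi> u + D v \<psi> u"
  using D_eqI[OF has_derivative_add[OF smooth_on_has_derivative smooth_on_has_derivative]] by (simp add: D_def)

lemma D_minus: "smooth_on U \<phi> \<Longrightarrow> u \<in> U \<Longrightarrow> D v (\<lambda>z. - \<phi> z) u = - D v \<phi> u"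
  using D_eqI[OF has_derivative_minus[OF smooth_on_has_derivative]] by (simp add: D_def)

lemma D_diff: "smooth_on U \<phi> \<Longrightarrow> smooth_on U \<psi> \<Longrightarrow> u \<in> U \<Longrightarrow>
    D v (\<lambda>z. \<phi> z - \<psi> z) u = D v \<phi> u - D v \<psi> u"
  using D_eqI[OF has_derivative_diff[OF smooth_on_has_derivative smooth_on_has_derivative]] by (simp add: D_def)

lemma D_sum: "(\<And>i. i \<in> I \<Longrightarrow> smooth_on U (\<phi> i)) \<Longrightarrow> u \<in> U \<Longrightarrow>
    D v (\<lambda>z. \<Sum>i\<in>I. \<phi> i z) u = (\<Sum>i\<in>I. D v (\<phi> i) u)"
  unfolding D_def by (rule dir_deriv_eqI, rule has_derivative_sum, rule smooth_on_has_derivative)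

lemma D_inner_const: "smooth_on U \<phi> \<Longrightarrow> u \<in> U \<Longrightarrow> D v (\<lambda>z. \<phi> z \<bullet> w) u = D v \<phi> u \<bullet> w"
  by (simp add: D_inner smooth_on_const)

lemma D_cmult:
  fixes \<phi> :: "real ^ 'n \<Rightarrow> real"
  shows "smooth_on U \<phi> \<Longrightarrow> u \<in> U \<Longrightarrow> D v (\<lambda>z. c * \<phi> z) u = c * D v \<phi> u"
  by (simp add: D_mult smooth_on_const)

text \<open>The graph coordinates. At \<open>u0\<close> they are also the components of the
  tangential part of \<open>X\<close>, which is how the drift in \<open>Lap\<close> is
  expressed.\<close>

definition s :: "'n \<Rightarrow> real ^ 'n \<Rightarrow> real" where "s i u = X u \<bullet> \<tau> i"

lemma smooth_s: "smooth_on U (s i)"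
  unfolding s_def[abs_def] by (intro smooth_intros)

lemma D_X_tau: assumes "u \<in> U" shows "D v X u \<bullet> \<tau> i = v $ i"
proof -
  have "D v X u \<bullet> \<tau> i = (\<Sum>k\<in>UNIV. J u $ i $ k * E v u $ k)"
    using D_axis[OF smooth_X assms] by (simp add: inner_sum_left J_def mult.commute)
  also have "\<dots> = (J u *v E v u) $ i" by (simp add: matrix_vector_mult_def)
  finally show ?thesis by (simp add: J_E assms)
qed

lemma D_s: "u \<in> U \<Longrightarrow> D v (s i) u = v $ i"
  unfolding s_def[abs_def] by (simp add: D_inner_const smooth_X D_X_tau)

lemma D_D:
  fixes \<phi> :: "real ^ 'n \<Rightarrow> real"
  assumes \<phi>: "smooth_on U \<phi>" and u: "u \<in> U"
  shows "D v (D w \<phi>) u = (\<Sum>k\<in>UNIV. D v (\<lambda>u. E w u $ k) u * dir_deriv (axis k 1) \<phi> u) +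
     (\<Sum>k\<in>UNIV. \<Sum>j\<in>UNIV. E w u $ k * E v u $ j * dir_deriv (axis j 1) (dir_deriv (axis k 1) \<phi>) u)"
proof -
  have "D v (D w \<phi>) u = D v (\<lambda>u. \<Sum>k\<in>UNIV. E w u $ k * dir_deriv (axis k 1) \<phi> u) u"
    by (rule D_cong[OF _ u]) (simp add: D_axis \<phi>)
  also have "\<dots> = (\<Sum>k\<in>UNIV. E w u $ k * D v (dir_deriv (axis k 1) \<phi>) u
        + D v (\<lambda>u. E w u $ k) u * dir_deriv (axis k 1) \<phi> u)"
    by (simp add: D_sum D_mult smooth_E smooth_on_mult smooth_on_dir_deriv \<phi> u open_U)
  also have "\<dots> = (\<Sum>k\<in>UNIV. D v (\<lambda>u. E w u $ k) u * dir_deriv (axis k 1) \<phi> u) +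
     (\<Sum>k\<in>UNIV. E w u $ k * (\<Sum>j\<in>UNIV. E v u $ j * dir_deriv (axis j 1) (dir_deriv (axis k 1) \<phi>) u))"
    by (simp add: sum.distrib D_axis[OF smooth_on_dir_deriv[OF \<phi>] u])
  finally show ?thesis by (simp add: sum_distrib_left mult.assoc)
qed

text \<open>By \<open>D_D\<close> and the symmetry of second derivatives the commutator is a
  first-order operator with some coefficient vector \<open>b\<close>. It annihilates the coordinates
  \<open>s i\<close>, whose first derivatives are constant; this says \<open>J u *v b = 0\<close>,
  so \<open>b\<close> is zero.\<close>

lemma D_commute:
  fixes \<phi> :: "real ^ 'n \<Rightarrow> real"
  assumes \<phi>: "smooth_on U \<phi>" and u: "u \<in> U"
  shows "D v (D w \<phi>) u = D w (D v \<phi>) u"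
proof -
  define b where "b = (\<chi> k. D v (\<lambda>u. E w u $ k) u - D w (\<lambda>u. E v u $ k) u)"
  have sym: "(\<Sum>k\<in>UNIV. \<Sum>j\<in>UNIV. E w u $ k * E v u $ j * dir_deriv (axis j 1) (dir_deriv (axis k 1) \<psi>) u)
    = (\<Sum>k\<in>UNIV. \<Sum>j\<in>UNIV. E v u $ k * E w u $ j * dir_deriv (axis j 1) (dir_deriv (axis k 1) \<psi>) u)"
    if "smooth_on U \<psi>" for \<psi> :: "real ^ 'n \<Rightarrow> real"
    by (subst sum.swap) (intro sum.cong refl, simp add: dir_deriv_commute[OF open_U that u] mult.commute)
  have comm: "D v (D w \<psi>) u - D w (D v \<psi>) u = (\<Sum>k\<in>UNIV. b $ k * dir_deriv (axis k 1) \<psi> u)"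
    if "smooth_on U \<psi>" for \<psi> :: "real ^ 'n \<Rightarrow> real"
    unfolding D_D[OF that u] using sym[OF that] by (simp add: b_def left_diff_distrib sum_subtractf)
  have "J u *v b = 0"
  proof (rule vec_eq_iff[THEN iffD2], rule allI)
    fix i
    have Ds: "D v (D w (s i)) u = 0" for v w
      by (subst D_cong[where \<psi> = "\<lambda>_. w $ i"]) (simp_all add: D_s u)
    have "(J u *v b) $ i = (\<Sum>k\<in>UNIV. b $ k * dir_deriv (axis k 1) (s i) u)"
      using u smooth_X unfolding s_def[abs_def]
      by (simp add: matrix_vector_mult_def J_def mult.commute
        dir_deriv_eqI[OF has_derivative_inner_left[OF smooth_on_has_derivative]])
    also have "\<dots> = 0" using comm[OF smooth_s, of i] Ds by simp
    finally show "(J u *v b) $ i = 0 $ i" by simp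
  qed
  then have "b = 0"
    using E_unique[OF u, of b 0] E_unique[OF u, of 0 0] by simp
  then show ?thesis using comm[OF \<phi>] by simp
qed

lemma D_min:
  fixes \<phi> :: "real ^ 'n \<Rightarrow> real"
  assumes \<phi>: "smooth_on U \<phi>" and u: "u \<in> U" and mn: "\<And>z. z \<in> U \<Longrightarrow> \<phi> u \<le> \<phi> z"
  shows "D v \<phi> u = 0" "D v (D v \<phi>) u \<ge> 0"
proof -
  have z: "dir_deriv w \<phi> u = 0" for w using local_min_second_deriv(1)[OF open_U \<phi> u mn] .
  then show "D v \<phi> u = 0" by (simp add: D_def)
  let ?e = "E v u"
  have "dir_deriv ?e (dir_deriv ?e \<phi>) u = dir_deriv ?e (\<lambda>z. \<Sum>k\<in>UNIV. ?e $ k * dir_deriv (axis k 1) \<phi> z) u"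
    by (rule dir_deriv_cong[OF open_U u]) (simp add: has_derivative_axis_expand[OF \<phi>])
  also have "\<dots> = (\<Sum>k\<in>UNIV. ?e $ k * dir_deriv ?e (dir_deriv (axis k 1) \<phi>) u)"
    by (rule dir_deriv_eqI)
      (intro has_derivative_sum has_derivative_mult_right smooth_on_has_derivative[OF smooth_on_dir_deriv[OF \<phi>] u])
  also have "\<dots> = D v (D v \<phi>) u"
    unfolding D_D[OF \<phi> u] z
    by (simp add: has_derivative_axis_expand[OF smooth_on_dir_deriv[OF \<phi>] u, of ?e] sum_distrib_left mult.assoc)
  finally show "D v (D v \<phi>) u \<ge> 0"
    using local_min_second_deriv(2)[OF open_U \<phi> u mn, of ?e] by simp
qed

text \<open>The hypersurface is the graph of \<open>f\<close> over its tangent plane at \<open>u0\<close>, and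
  \<open>\<rho> = 1 / sqrt (1 + |\<nabla>f|\<^sup>2)\<close> near \<open>u0\<close>.\<close>

definition f :: "real ^ 'n \<Rightarrow> real" where "f u = X u \<bullet> N u0"
definition \<rho> :: "real ^ 'n \<Rightarrow> real" where "\<rho> u = N u \<bullet> N u0"
abbreviation Di :: "'n \<Rightarrow> (real ^ 'n \<Rightarrow> 'b::real_normed_vector) \<Rightarrow> real ^ 'n \<Rightarrow> 'b" where
  "Di i \<equiv> D (axis i 1)"

lemma smooth_f: "smooth_on U f" and smooth_\<rho>: "smooth_on U \<rho>"
  unfolding f_def[abs_def] \<rho>_def[abs_def] by (intro smooth_intros)+

lemmas sm = smooth_D smooth_f smooth_\<rho> smooth_s smooth_X smooth_N smooth_on_const
  smooth_on_mult[OF open_U] smooth_on_add[OF open_U] smooth_on_diff[OF open_U] smooth_on_minus[OF open_U]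
  smooth_on_sum[OF open_U] smooth_on_inner[OF open_U] smooth_on_scaleR[OF open_U]

lemma DD_mult:
  fixes \<phi> \<psi> :: "real ^ 'n \<Rightarrow> real"
  assumes "smooth_on U \<phi>" "smooth_on U \<psi>" "u \<in> U"
  shows "D w (D v (\<lambda>z. \<phi> z * \<psi> z)) u =
    \<phi> u * D w (D v \<psi>) u + D w \<phi> u * D v \<psi> u + D v \<phi> u * D w \<psi> u + D w (D v \<phi>) u * \<psi> u"
proof -
  have "D w (D v (\<lambda>z. \<phi> z * \<psi> z)) u = D w (\<lambda>z. \<phi> z * D v \<psi> z + D v \<phi> z * \<psi> z) u"
    by (rule D_cong[OF _ assms(3)]) (simp add: D_mult assms)
  then show ?thesis using assms by (simp add: D_add D_mult sm)
qed

lemma D_X: assumes "u \<in> U" shows "D v X u = (\<Sum>i\<in>UNIV. v $ i *\<^sub>R \<tau> i) + D v f u *\<^sub>R N u0"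
proof -
  have "D v f u = D v X u \<bullet> N u0"
    unfolding f_def[abs_def] by (simp add: D_inner_const sm assms)
  then show ?thesis using span_\<tau>[of "D v X u"] by (simp add: D_X_tau assms)
qed

lemma normal_D: "u \<in> U \<Longrightarrow> N u \<bullet> D v X u = 0"
  unfolding D_def by (rule normal_N)

lemma N_tau: assumes "u \<in> U" shows "N u \<bullet> \<tau> i = - (\<rho> u * Di i f u)"
proof -
  have "(\<Sum>j\<in>UNIV. axis i 1 $ j *\<^sub>R \<tau> j) = \<tau> i"
    by (simp add: axis_def if_distrib[of "\<lambda>a. a *\<^sub>R _"] cong: if_cong)
  then have "D (axis i 1) X u = \<tau> i + Di i f u *\<^sub>R N u0"
    using D_X[OF assms] by metis
  then show ?thesis using normal_D[OF assms, of "axis i 1"]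
    by (simp add: inner_add_right \<rho>_def mult.commute eq_neg_iff_add_eq_0)
qed

lemma inner_expand: "v \<bullet> w = (\<Sum>i\<in>UNIV. (v \<bullet> \<tau> i) * (w \<bullet> \<tau> i)) + (v \<bullet> N u0) * (w \<bullet> N u0)"
  by (subst span_\<tau>[of w]) (simp add: inner_add_right inner_sum_right mult.commute)

lemma \<rho>_norm: "u \<in> U \<Longrightarrow> \<rho> u * \<rho> u * (1 + (\<Sum>i\<in>UNIV. Di i f u * Di i f u)) = 1"
  using inner_expand[of "N u" "N u"]
  by (simp add: unit_N N_tau \<rho>_def[symmetric] sum_distrib_left algebra_simps)

text \<open>Obtained by differentiating the polynomial identity \<open>\<rho>_norm\<close>, which
  avoids square roots and the sign of \<rho>.\<close>

lemma D_\<rho>: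
  assumes u: "u \<in> U"
  shows "D v \<rho> u = - (\<rho> u * \<rho> u * \<rho> u * (\<Sum>i\<in>UNIV. Di i f u * D v (Di i f) u))"
proof -
  let ?q = "\<lambda>u. \<Sum>i\<in>UNIV. Di i f u * Di i f u" and ?p = "\<Sum>i\<in>UNIV. Di i f u * D v (Di i f) u"
  have q: "D v ?q u = 2 * ?p"
    by (simp add: D_sum D_mult sm u sum_distrib_left mult.commute sum.distrib)
  have "D v (\<lambda>u. \<rho> u * \<rho> u * (1 + ?q u)) u = 0"
    by (subst D_cong[where \<psi>="\<lambda>_. 1"]) (simp_all add: \<rho>_norm u)
  \<comment> \<open>The extra factor \<rho> turns the coefficient of \<open>D v \<rho> u\<close>
    into twice the left side of \<open>\<rho>_norm\<close>.\<close>
  then have "\<rho> u * (\<rho> u * (\<rho> u * 2 * ?p) + 2 * \<rho> u * D v \<rho> u * (1 + ?q u)) = 0"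
    by (simp add: D_mult D_add sm u q algebra_simps)
  then have "2 * (\<rho> u * \<rho> u * \<rho> u * ?p) + 2 * D v \<rho> u * (\<rho> u * \<rho> u * (1 + ?q u)) = 0"
    by (simp only: algebra_simps)
  then show ?thesis unfolding \<rho>_norm[OF u] by simp
qed

lemma \<rho>_0 [simp]: "\<rho> u0 = 1"
  by (simp add: \<rho>_def unit_N u0)

lemma Df_0 [simp]: "D v f u0 = 0"
  using D_inner_const[OF smooth_X u0, of v "N u0"] normal_D[OF u0, of v]
  by (simp add: f_def[abs_def] inner_commute[of "D v X u0"])

lemma D\<rho>_0 [simp]: "D v \<rho> u0 = 0"
  by (simp add: D_\<rho> u0)

lemma DD\<rho>_0: "D w (D v \<rho>) u0 = - (\<Sum>i\<in>UNIV. D w (Di i f) u0 * D v (Di i f) u0)"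
proof -
  have "D w (D v \<rho>) u0 = D w (\<lambda>u. - (\<rho> u * \<rho> u * \<rho> u * (\<Sum>i\<in>UNIV. Di i f u * D v (Di i f) u))) u0"
    by (rule D_cong[OF D_\<rho> u0])
  then show ?thesis by (simp add: D_minus D_mult D_sum sm u0)
qed

text \<open>The height over the origin at which the tangent plane meets the normal axis, that is,
  minus the Legendre transform of \<open>f\<close>. The support function is \<rho> times
  \<open>m\<close>, and first derivatives of \<open>f\<close> cancel in the derivative of
  \<open>m\<close>.\<close>

definition m :: "real ^ 'n \<Rightarrow> real" where "m u = f u - (\<Sum>i\<in>UNIV. s i u * Di i f u)"

lemma smooth_m: "smooth_on U m"
  unfolding m_def[abs_def] by (simp add: sm)

lemma X_N: assumes "u \<in> U" shows "X u \<bullet> N u = \<rho> u * m u"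
  using inner_expand[of "X u" "N u"] unfolding N_tau[OF assms]
  by (simp add: \<rho>_def[symmetric] f_def[symmetric] s_def[symmetric] m_def sum_distrib_left algebra_simps sum_negf)

lemma m_0 [simp]: "m u0 = X u0 \<bullet> N u0"
  by (simp add: m_def f_def)

lemma Df_sum: "u \<in> U \<Longrightarrow> D v f u = (\<Sum>i\<in>UNIV. v $ i * Di i f u)"
  using D_sum_dir[OF smooth_f] by simp

lemma DDf_sum: "u \<in> U \<Longrightarrow> D w (D v f) u = (\<Sum>i\<in>UNIV. v $ i * D w (Di i f) u)"
  by (subst D_cong[OF Df_sum]) (simp_all add: D_sum D_cmult sm)

lemma D_m: "u \<in> U \<Longrightarrow> D v m u = - (\<Sum>i\<in>UNIV. s i u * D v (Di i f) u)"
  unfolding m_def[abs_def]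
  by (simp add: D_diff D_sum D_mult D_s sm sum.distrib Df_sum[of u v])

lemma DD_m: "u \<in> U \<Longrightarrow> D w (D v m) u = - D v (D w f) u - (\<Sum>i\<in>UNIV. s i u * D w (D v (Di i f)) u)"
  by (subst D_cong[OF D_m]) (simp_all add: D_minus D_sum D_mult D_s sm sum.distrib DDf_sum)

lemma DD_X:
  assumes u: "u \<in> U" shows "D v (D w X) u = D v (D w f) u *\<^sub>R N u0"
proof -
  have "D v (D w X) u = D v (\<lambda>z. (\<Sum>i\<in>UNIV. w $ i *\<^sub>R \<tau> i) + D w f z *\<^sub>R N u0) u"
    by (rule D_cong[OF D_X u])
  then show ?thesis
    by (simp add: D_add D_bilinear[OF bounded_bilinear_scaleR] sm u)
qed

lemma second_form:
  assumes u: "u \<in> U" shows "D v N u \<bullet> D w X u = - (\<rho> u * D v (D w f) u)"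
proof -
  have "D v (\<lambda>z. N z \<bullet> D w X z) u = 0"
    by (subst D_cong[where \<psi>="\<lambda>_. 0"]) (simp_all add: normal_D u)
  then show ?thesis by (simp add: D_inner sm u DD_X \<rho>_def algebra_simps)
qed

lemma first_form:
  assumes u: "u \<in> U" shows "D v X u \<bullet> D w X u = v \<bullet> w + D v f u * D w f u"
proof -
  have "D v X u \<bullet> N u0 = D v f u" for v
    unfolding f_def[abs_def] by (simp add: D_inner_const sm u)
  moreover have "v \<bullet> w = (\<Sum>i\<in>UNIV. v $ i * w $ i)" by (simp add: inner_vec_def)
  ultimately show ?thesis by (subst inner_expand) (simp add: D_X_tau[OF u])
qed

text \<open>Since \<open>D\<^sub>j X \<bullet> \<tau> i = \<delta>\<^sub>i\<^sub>j\<close> and \<open>dN\<close> is tangential, this is the trace of the shape operator.\<close>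

definition Hm :: "real ^ 'n \<Rightarrow> real" where "Hm u = - (\<Sum>i\<in>UNIV. Di i N u \<bullet> \<tau> i)"

text \<open>The classical divergence form of the mean curvature of a graph, read off from
  \<open>N_tau\<close>.\<close>

lemma Hm_divergence: assumes u: "u \<in> U" shows "Hm u = (\<Sum>i\<in>UNIV. Di i (\<lambda>z. \<rho> z * Di i f z) u)"
proof -
  have "Di i N u \<bullet> \<tau> i = - Di i (\<lambda>z. \<rho> z * Di i f z) u" for i
  proof -
    have "Di i N u \<bullet> \<tau> i = Di i (\<lambda>z. N z \<bullet> \<tau> i) u" by (simp add: D_inner_const sm u)
    also have "\<dots> = Di i (\<lambda>z. - (\<rho> z * Di i f z)) u" by (rule D_cong[OF N_tau u])
    finally show ?thesis by (simp add: D_minus sm u)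
  qed
  then show ?thesis by (simp add: Hm_def sum_negf)
qed

lemma smooth_Hm: "smooth_on U Hm"
  unfolding Hm_def[abs_def] by (simp add: sm)

text \<open>Since \<rho> is 1 and the metric is the identity at \<open>u0\<close>, this Hessian is
  the second fundamental form there in the frame \<tau>.\<close>

definition hs :: "real ^ 'n ^ 'n" where "hs = (\<chi> i j. Di i (Di j f) u0)"

lemma hs_sym: "transpose hs = hs"
  by (simp add: hs_def transpose_def vec_eq_iff D_commute[OF smooth_f u0])

lemma DDf_hs: "D v (Di i f) u0 = (hs *v v) $ i"
proof -
  have "D v (Di i f) u0 = Di i (D v f) u0" by (rule D_commute[OF smooth_f u0])
  also have "\<dots> = (\<Sum>j\<in>UNIV. v $ j * Di i (Di j f) u0)" by (rule DDf_sum[OF u0])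
  finally show ?thesis by (simp add: hs_def matrix_vector_mult_def mult.commute)
qed

lemma DDf_form: "D w (D v f) u0 = v \<bullet> (hs *v w)"
  by (subst DDf_sum[OF u0]) (simp add: DDf_hs inner_vec_def)

definition H0 :: real where "H0 = (\<Sum>i\<in>UNIV. hs $ i $ i)"
definition S0 :: real where "S0 = (\<Sum>i\<in>UNIV. \<Sum>j\<in>UNIV. (hs $ i $ j)\<^sup>2)"

lemma D\<rho>f: "u \<in> U \<Longrightarrow> Di k (\<lambda>z. \<rho> z * Di k f z) u = \<rho> u * Di k (Di k f) u + Di k \<rho> u * Di k f u"
  by (simp add: D_mult sm)

lemma Hm_0: "Hm u0 = H0"
  by (simp add: Hm_divergence u0 D\<rho>f H0_def hs_def)

text \<open>Only third derivatives of \<open>f\<close> survive, because the first derivatives of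
  \<open>f\<close> and \<rho> vanish at \<open>u0\<close>. Moving \<open>v\<close> innermost is the
  Codazzi equation in these coordinates.\<close>

lemma D_Hm_0: "D v Hm u0 = (\<Sum>k\<in>UNIV. Di k (Di k (D v f)) u0)"
proof -
  have "D v Hm u0 = D v (\<lambda>z. \<Sum>k\<in>UNIV. \<rho> z * Di k (Di k f) z + Di k \<rho> z * Di k f z) u0"
    by (rule D_cong[OF _ u0]) (simp add: Hm_divergence D\<rho>f)
  also have "\<dots> = (\<Sum>k\<in>UNIV. D v (Di k (Di k f)) u0)"
    by (simp add: D_sum D_add D_mult sm u0)
  also have "\<dots> = (\<Sum>k\<in>UNIV. Di k (Di k (D v f)) u0)"
  proof (rule sum.cong[OF refl])
    fix k
    have "D v (Di k (Di k f)) u0 = Di k (D v (Di k f)) u0" by (simp add: D_commute sm u0)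
    also have "\<dots> = Di k (Di k (D v f)) u0"
      by (rule D_cong[OF _ u0]) (simp add: D_commute sm)
    finally show "D v (Di k (Di k f)) u0 = Di k (Di k (D v f)) u0" .
  qed
  finally show ?thesis .
qed

lemma DD_Hm_0:
  "D w (D w Hm) u0 = (\<Sum>k\<in>UNIV. D w (D w (Di k (Di k f))) u0 + D w (D w \<rho>) u0 * hs $ k $ k
      + 2 * D w (Di k \<rho>) u0 * D w (Di k f) u0)"
proof -
  have "D w (D w Hm) u0 = D w (D w (\<lambda>z. \<Sum>k\<in>UNIV. \<rho> z * Di k (Di k f) z + Di k \<rho> z * Di k f z)) u0"
    by (rule D_cong[OF D_cong u0]) (simp add: Hm_divergence D\<rho>f)
  also have "\<dots> = D w (\<lambda>z. \<Sum>k\<in>UNIV. D w (\<lambda>z. \<rho> z * Di k (Di k f) z) z + D w (\<lambda>z. Di k \<rho> z * Di k f z) z) u0"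
    by (rule D_cong[OF _ u0]) (simp add: D_sum D_add sm)
  also have "\<dots> = (\<Sum>k\<in>UNIV. D w (D w (\<lambda>z. \<rho> z * Di k (Di k f) z)) u0 + D w (D w (\<lambda>z. Di k \<rho> z * Di k f z)) u0)"
    by (simp add: D_sum D_add sm u0)
  finally show ?thesis by (simp add: DD_mult sm u0 hs_def algebra_simps)
qed

lemma D_scale: "smooth_on U \<phi> \<Longrightarrow> u \<in> U \<Longrightarrow> D (r *\<^sub>R v) \<phi> u = r *\<^sub>R D v \<phi> u"
  by (subst (1 2) D_sum_dir) (simp_all add: scaleR_sum_right)

lemma D_add_dir: "smooth_on U \<phi> \<Longrightarrow> u \<in> U \<Longrightarrow> D (v + w) \<phi> u = D v \<phi> u + D w \<phi> u"
  by (subst (1 2 3) D_sum_dir) (simp_all add: sum.distrib scaleR_left_distrib)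

lemma DD_scale:
  assumes "u \<in> U" shows "D (r *\<^sub>R v) (D (r *\<^sub>R v) f) u = r\<^sup>2 * D v (D v f) u"
proof -
  have "D (r *\<^sub>R v) (D (r *\<^sub>R v) f) u = D (r *\<^sub>R v) (\<lambda>z. r * D v f z) u"
    by (rule D_cong[OF _ assms]) (simp add: D_scale sm)
  then show ?thesis by (simp add: D_cmult D_scale sm assms power2_eq_square)
qed

lemma D_exp:
  fixes \<phi> :: "real ^ 'n \<Rightarrow> real"
  assumes "smooth_on U \<phi>" "u \<in> U"
  shows "D v (\<lambda>u. exp (\<phi> u)) u = exp (\<phi> u) * D v \<phi> u"
  using D_eqI[OF DERIV_exp[THEN DERIV_compose_FDERIV, OF smooth_on_has_derivative[OF assms]]]
  by (simp add: D_def mult.commute)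

end

section \<open>The self-expander equation at the base point\<close>

locale expander_patch = graph_patch X N U u0 \<tau>
  for X N :: "real ^ 'n::finite \<Rightarrow> real ^ 'k::finite" and U :: "(real ^ 'n) set" and u0 :: "real ^ 'n"
    and \<tau> :: "'n \<Rightarrow> real ^ 'k" +
  fixes lam :: real
  assumes expander: "\<And>u. u \<in> U \<Longrightarrow> Hm u = lam + (X u \<bullet> N u) / 2"
begin

lemma Hm_alt: "u \<in> U \<Longrightarrow> Hm u = lam + 1/2 * (\<rho> u * m u)"
  by (simp add: expander X_N)

lemma D_Hm_alt: "u \<in> U \<Longrightarrow> D v Hm u = 1/2 * D v (\<lambda>z. \<rho> z * m z) u"
  by (subst D_cong[OF Hm_alt]) (simp_all add: D_add D_cmult sm smooth_m del: times_divide_eq_left)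

lemma D_Hm_0': "D v Hm u0 = - (1/2) * (\<Sum>i\<in>UNIV. s i u0 * D v (Di i f) u0)"
  by (simp add: D_Hm_alt u0 D_mult sm smooth_m D_m)

lemma DD_Hm_0': "D w (D v Hm) u0 = 1/2 * (D w (D v m) u0 + D w (D v \<rho>) u0 * m u0)"
proof -
  have "D w (D v Hm) u0 = D w (\<lambda>u. 1/2 * D v (\<lambda>z. \<rho> z * m z) u) u0"
    by (rule D_cong[OF D_Hm_alt u0])
  also have "\<dots> = 1/2 * D w (D v (\<lambda>z. \<rho> z * m z)) u0"
    by (rule D_cmult) (simp_all add: sm smooth_m u0)
  finally show ?thesis by (simp add: DD_mult sm smooth_m u0 del: m_0)
qed

lemma b_eq: "m u0 = 2 * (H0 - lam)"
  using Hm_alt[OF u0] by (simp add: Hm_0)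

lemma sum_DD\<rho>: "(\<Sum>k\<in>UNIV. Di k (Di k \<rho>) u0) = - S0"
  by (simp add: DD\<rho>_0 S0_def hs_def sum_negf power2_eq_square)

text \<open>The Christoffel symbols of the coordinates vanish at \<open>u0\<close>, so this is \<open>\<Delta> + 1/2 \<langle>x\<^sup>T, \<nabla>\<rangle>\<close> there.\<close>

definition Lap :: "(real ^ 'n \<Rightarrow> real) \<Rightarrow> real" where
  "Lap \<phi> = (\<Sum>k\<in>UNIV. Di k (Di k \<phi>) u0) + 1/2 * (\<Sum>k\<in>UNIV. s k u0 * Di k \<phi> u0)"

text \<open>The third derivatives of \<open>f\<close> coming from \<open>DD_m\<close> add up, by
  \<open>D_Hm_0\<close>, to the drift term of \<open>Lap\<close> with the opposite sign. This
  cancellation is why the drift is part of the operator.\<close>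

lemma Lap_Hm: "Lap Hm = - (1/2) * H0 - S0 * (H0 - lam)"
proof -
  have "(\<Sum>k\<in>UNIV. Di k (Di k Hm) u0) = 1/2 * ((\<Sum>k\<in>UNIV. Di k (Di k m) u0) + (\<Sum>k\<in>UNIV. Di k (Di k \<rho>) u0) * m u0)"
    by (simp add: DD_Hm_0' sum.distrib sum_distrib_left sum_distrib_right distrib_left del: m_0)
  also have "(\<Sum>k\<in>UNIV. Di k (Di k m) u0) = - H0 - (\<Sum>k\<in>UNIV. \<Sum>i\<in>UNIV. s i u0 * Di k (Di k (Di i f)) u0)"
    by (simp add: DD_m u0 sum_subtractf sum_negf H0_def hs_def)
  also have "(\<Sum>k\<in>UNIV. \<Sum>i\<in>UNIV. s i u0 * Di k (Di k (Di i f)) u0) = (\<Sum>i\<in>UNIV. s i u0 * Di i Hm u0)"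
    by (subst sum.swap) (simp add: D_Hm_0 sum_distrib_left)
  finally show ?thesis
    unfolding Lap_def sum_DD\<rho> b_eq by (simp add: algebra_simps)
qed

text \<open>The twice differentiated equation for \<open>H\<close> in a direction \<open>w\<close> in which the smallest
  eigenvalue of \<open>h - \<Phi> g\<close> vanishes replaces Simons' identity.\<close>

lemma tensor_maximum_principle:
  assumes \<Phi>: "smooth_on U \<Phi>" and w: "w \<bullet> w = 1"
    and ge: "\<And>u v. u \<in> U \<Longrightarrow> \<Phi> u * (v \<bullet> v + D v f u * D v f u) \<le> \<rho> u * D v (D v f) u"
    and eq: "D w (D w f) u0 = \<Phi> u0"
  shows "Lap \<Phi> \<le> lam * (\<Phi> u0)\<^sup>2 - (1/2 + S0) * \<Phi> u0"
proof -
  let ?c = "\<Phi> u0"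
  let ?B = "hs - ?c *\<^sub>R mat 1"
  have form: "v \<bullet> (?B *v v) = v \<bullet> (hs *v v) - ?c * (v \<bullet> v)" for v
    by (simp add: matrix_vector_mult_diff_rdistrib inner_diff_right scaleR_matrix_vector_assoc[symmetric])
  \<comment> \<open>The direction \<open>w\<close> minimises the form of \<open>hs\<close>, so it is
    an eigenvector with eigenvalue \<open>?c\<close>.\<close>
  have "?B *v w = 0"
  proof (rule psd_null_vector)
    show "transpose ?B = ?B" using hs_sym by (simp add: transpose_def vec_eq_iff mat_def)
    show "v \<bullet> (?B *v v) \<ge> 0" for v using ge[OF u0, of v] by (simp add: form DDf_form)
    show "w \<bullet> (?B *v w) = 0" using eq w by (simp add: form DDf_form)
  qed
  then have eig: "hs *v w = ?c *\<^sub>R w"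
    by (simp add: matrix_vector_mult_diff_rdistrib scaleR_matrix_vector_assoc[symmetric])
  have fw: "D w (Di i f) u0 = ?c * w $ i" "Di i (D w f) u0 = ?c * w $ i" for i
    by (simp_all add: D_commute[OF smooth_f u0, of _ w] DDf_hs eig)
  \<comment> \<open>The direction \<open>w\<close> is extended with constant graph coordinates, and
    \<open>1 + D w f u * D w f u\<close> is its squared length in the induced metric. So
    \<open>?P\<close> is the form of h - \<Phi> g at \<open>w\<close>: nonnegative on the patch and
    zero at \<open>u0\<close>.\<close>
  let ?P = "\<lambda>u. \<rho> u * D w (D w f) u - \<Phi> u * (1 + D w f u * D w f u)"
  have P: "smooth_on U ?P" by (simp add: sm \<Phi>)
  have min: "?P u0 \<le> ?P u" if "u \<in> U" for u using ge[OF that, of w] eq w by simp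
  have P1: "Di k (D w (D w f)) u0 = Di k \<Phi> u0" for k
    using D_min(1)[OF P u0 min, of "axis k 1"] by (simp add: D_diff D_mult D_add sm \<Phi> u0)
  \<comment> \<open>The second derivative test for \<open>?P\<close>. Cross terms vanish at
    \<open>u0\<close>; the squared length of \<open>w\<close> contributes
    \<open>2 * (?c * w $ k)\<^sup>2\<close> because
    \<open>Di k (D w f) u0 = ?c * w $ k\<close>.\<close>
  have P2: "Di k (Di k (D w (D w f))) u0 + Di k (Di k \<rho>) u0 * ?c - Di k (Di k \<Phi>) u0 - 2 * ?c * (?c * w $ k)\<^sup>2 \<ge> 0" for k
  proof -
    have "0 \<le> Di k (Di k ?P) u0" using D_min(2)[OF P u0 min] .
    also have "\<dots> = Di k (\<lambda>u. Di k (\<lambda>u. \<rho> u * D w (D w f) u) u - Di k (\<lambda>u. \<Phi> u * (1 + D w f u * D w f u)) u) u0"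
      by (rule D_cong[OF _ u0]) (simp add: D_diff sm \<Phi>)
    also have "\<dots> = Di k (Di k (\<lambda>u. \<rho> u * D w (D w f) u)) u0 - Di k (Di k (\<lambda>u. \<Phi> u * (1 + D w f u * D w f u))) u0"
      by (simp add: D_diff sm \<Phi> u0)
    also have "Di k (Di k (\<lambda>u. \<Phi> u * (1 + D w f u * D w f u))) u0
        = ?c * Di k (Di k (\<lambda>u. 1 + D w f u * D w f u)) u0 + Di k (Di k \<Phi>) u0"
      by (simp add: DD_mult D_add D_mult sm \<Phi> u0)
    also have "Di k (Di k (\<lambda>u. 1 + D w f u * D w f u)) u0 = Di k (Di k (\<lambda>u. D w f u * D w f u)) u0"
      by (rule D_cong[OF _ u0]) (simp add: D_add sm)
    also have "\<dots> = 2 * (?c * w $ k)\<^sup>2"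
      by (simp add: DD_mult sm u0 fw power2_eq_square)
    also have "Di k (Di k (\<lambda>u. \<rho> u * D w (D w f) u)) u0 = Di k (Di k (D w (D w f))) u0 + Di k (Di k \<rho>) u0 * ?c"
      by (simp add: DD_mult sm u0 eq)
    finally show ?thesis by (simp add: algebra_simps)
  qed
  have "0 \<le> (\<Sum>k\<in>UNIV. Di k (Di k (D w (D w f))) u0 + Di k (Di k \<rho>) u0 * ?c - Di k (Di k \<Phi>) u0 - 2 * ?c * (?c * w $ k)\<^sup>2)"
    by (rule sum_nonneg) (rule P2)
  also have "\<dots> = (\<Sum>k\<in>UNIV. Di k (Di k (D w (D w f))) u0) - S0 * ?c - (\<Sum>k\<in>UNIV. Di k (Di k \<Phi>) u0)
      - (\<Sum>k\<in>UNIV. 2 * ?c * (?c * w $ k)\<^sup>2)"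
    by (simp add: sum_subtractf sum.distrib sum_distrib_right[symmetric] sum_DD\<rho>)
  also have "(\<Sum>k\<in>UNIV. 2 * ?c * (?c * w $ k)\<^sup>2) = 2 * ?c ^ 3 * (w \<bullet> w)"
    by (simp add: inner_vec_def sum_distrib_left power2_eq_square power3_eq_cube ac_simps)
  finally have I: "0 \<le> (\<Sum>k\<in>UNIV. Di k (Di k (D w (D w f))) u0) - S0 * ?c - (\<Sum>k\<in>UNIV. Di k (Di k \<Phi>) u0) - 2 * ?c ^ 3"
    using w by simp
  have \<rho>ww: "D w (D w \<rho>) u0 = - ?c\<^sup>2"
  proof -
    have "D w (D w \<rho>) u0 = - (?c\<^sup>2 * (w \<bullet> w))"
      by (simp add: DD\<rho>_0 fw inner_vec_def sum_distrib_left power2_eq_square ac_simps)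
    then show ?thesis using w by simp
  qed
  have \<rho>wk: "D w (Di k \<rho>) u0 = - ?c\<^sup>2 * w $ k" for k
  proof -
    have "D w (Di k \<rho>) u0 = - ?c * (\<Sum>i\<in>UNIV. w $ i * Di k (Di i f) u0)"
      by (simp add: DD\<rho>_0 fw sum_distrib_left sum_negf ac_simps)
    also have "(\<Sum>i\<in>UNIV. w $ i * Di k (Di i f) u0) = Di k (D w f) u0"
      by (simp add: DDf_sum u0)
    finally show ?thesis by (simp add: fw power2_eq_square)
  qed
  \<comment> \<open>In Simons' identity reordering the derivatives costs curvature terms. Here the
    derivatives commute, and those terms come from \<rho> and from the squared length of
    \<open>w\<close>.\<close>
  have comm: "D w (D w (Di k (Di k f))) u0 = Di k (Di k (D w (D w f))) u0" for k
  proof -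
    have 1: "D w (Di k (Di k f)) u = Di k (Di k (D w f)) u" if "u \<in> U" for u
    proof -
      have "D w (Di k (Di k f)) u = Di k (D w (Di k f)) u" by (simp add: D_commute sm that)
      also have "\<dots> = Di k (Di k (D w f)) u" by (rule D_cong[OF _ that]) (simp add: D_commute sm)
      finally show ?thesis .
    qed
    have "D w (D w (Di k (Di k f))) u0 = D w (Di k (Di k (D w f))) u0"
      by (rule D_cong[OF 1 u0])
    also have "\<dots> = Di k (D w (Di k (D w f))) u0" by (simp add: D_commute sm u0)
    also have "\<dots> = Di k (Di k (D w (D w f))) u0"
      by (rule D_cong[OF _ u0]) (simp add: D_commute sm)
    finally show ?thesis .
  qed
  have "D w (D w Hm) u0 = (\<Sum>k\<in>UNIV. Di k (Di k (D w (D w f))) u0) - ?c\<^sup>2 * H0 - (\<Sum>k\<in>UNIV. 2 * ?c ^ 3 * (w $ k * w $ k))"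
    unfolding DD_Hm_0 comm \<rho>ww \<rho>wk fw
    by (simp add: sum.distrib sum_subtractf sum_negf H0_def sum_distrib_left power2_eq_square power3_eq_cube ac_simps)
  also have "(\<Sum>k\<in>UNIV. 2 * ?c ^ 3 * (w $ k * w $ k)) = 2 * ?c ^ 3 * (w \<bullet> w)"
    by (simp add: inner_vec_def sum_distrib_left)
  finally have II: "D w (D w Hm) u0 = (\<Sum>k\<in>UNIV. Di k (Di k (D w (D w f))) u0) - ?c\<^sup>2 * H0 - 2 * ?c ^ 3"
    using w by simp
  \<comment> \<open>By \<open>P1\<close> the third derivatives of \<open>f\<close> in
    \<open>DD_m\<close> become the gradient of \<Phi>, which matches the drift term of
    \<open>Lap\<close>.\<close>
  have "(\<Sum>i\<in>UNIV. s i u0 * D w (D w (Di i f)) u0) = (\<Sum>i\<in>UNIV. s i u0 * Di i \<Phi> u0)"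
  proof (rule sum.cong[OF refl])
    fix i
    have "D w (D w (Di i f)) u0 = D w (Di i (D w f)) u0"
      by (rule D_cong[OF _ u0]) (simp add: D_commute sm)
    also have "\<dots> = Di i (D w (D w f)) u0" by (simp add: D_commute sm u0)
    finally show "s i u0 * D w (D w (Di i f)) u0 = s i u0 * Di i \<Phi> u0" by (simp add: P1)
  qed
  then have "D w (D w Hm) u0 = 1/2 * (- ?c - (\<Sum>i\<in>UNIV. s i u0 * Di i \<Phi> u0) - ?c\<^sup>2 * (2 * (H0 - lam)))"
    unfolding DD_Hm_0' DD_m[OF u0] \<rho>ww b_eq by (simp add: eq)
  \<comment> \<open>\<open>I\<close> and \<open>II\<close> share the fourth derivatives and the term
    \<open>2 * ?c ^ 3\<close>, so both are eliminated. The terms with \<open>H0\<close> then cancel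
    against the one from \<open>b_eq\<close>, which leaves \<open>lam * ?c\<^sup>2\<close>.\<close>
  with I II show ?thesis unfolding Lap_def
    by (simp add: algebra_simps power2_eq_square power3_eq_cube)
qed

end

section \<open>Hypersurfaces and their patches\<close>

text \<open>The chart hidden in \<open>sff_matrix_at\<close> may be a different one; pushing its
  frame through the transition map does not change the matrix.\<close>

lemma sff_matrix_in_chart:
  assumes A: "smooth_atlas M A" and x: "smooth_map A x" and \<xi>: "smooth_map A \<xi>"
    and h: "sff_matrix_at A x \<xi> p h" and c: "c \<in> A" "p \<in> fst c"
  obtains e where "orthonormal_frame c x p e" "second_fundamental_form c x \<xi> p e h"
proof -
  obtain d e where d: "d \<in> A" "p \<in> fst d" and e: "orthonormal_frame d x p e"
    and he: "second_fundamental_form d x \<xi> p e h" using h unfolding sff_matrix_at_def by blast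
  let ?e = "\<lambda>i. differential d (snd c) p (e i)"
  have 1: "differential d x p v = differential c x p (differential d (snd c) p v)" for v
    using differential_change_of_chart[OF A x d c] .
  have 2: "differential d \<xi> p v = differential c \<xi> p (differential d (snd c) p v)" for v
    using differential_change_of_chart[OF A \<xi> d c] .
  show thesis
  proof (rule that)
    show "orthonormal_frame c x p ?e" using e unfolding orthonormal_frame_def 1 .
    show "second_fundamental_form c x \<xi> p ?e h" using he unfolding second_fundamental_form_def 1 2 .
  qed
qed

locale hypersurface =
  fixes M :: "'a topology" and A :: "('a, 'n::finite) chart set" and x \<xi> :: "'a \<Rightarrow> real ^ 'k::finite"
  assumes card_k: "CARD('k) = CARD('n) + 1" and closed_M: "closed_connected_manifold M A"
    and imm: "immersion A x" and normal: "unit_normal_field A x \<xi>"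
begin

lemma atlas: "smooth_atlas M A" and compact_M: "compact_space M" and connected_M: "connected_space M"
  and nonempty_M: "topspace M \<noteq> {}" and smooth_x: "smooth_map A x" and smooth_\<xi>: "smooth_map A \<xi>"
  using closed_M imm normal
  unfolding closed_connected_manifold_def smooth_manifold_def immersion_def unit_normal_field_def by auto

lemma chart: "c \<in> A \<Longrightarrow> chart_on M c"
  using atlas unfolding smooth_atlas_def by blast

lemma chart_dom: "c \<in> A \<Longrightarrow> openin M (fst c)" "c \<in> A \<Longrightarrow> q \<in> fst c \<Longrightarrow> q \<in> topspace M"
  using chart openin_subset unfolding chart_on_def by blast+

lemma chart_exists: "p \<in> topspace M \<Longrightarrow> \<exists>c\<in>A. p \<in> fst c"
  using atlas unfolding smooth_atlas_def by blast

lemma coord_rep_apply: "c \<in> A \<Longrightarrow> q \<in> fst c \<Longrightarrow> coord_rep c \<phi> (snd c q) = \<phi> q"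
  using chart_inj_on[OF chart] by (simp add: coord_rep_def)

lemma continuous_chart: "c \<in> A \<Longrightarrow> continuous_map (subtopology M (fst c)) euclidean (snd c)"
  using chart homeomorphic_imp_continuous_map continuous_map_into_fulltopology
  unfolding chart_on_def by blast

lemma openin_chart_preimage:
  assumes "c \<in> A" "open V" shows "openin M {q \<in> fst c. snd c q \<in> V}"
proof -
  have "openin (subtopology M (fst c)) {q \<in> topspace (subtopology M (fst c)). snd c q \<in> V}"
    by (rule openin_continuous_map_preimage[OF continuous_chart[OF assms(1)]]) (simp add: assms)
  moreover have "topspace (subtopology M (fst c)) = fst c"
    using chart_dom[OF assms(1)] openin_subset by fastforce
  ultimately show ?thesis using chart_dom(1)[OF assms(1)] openin_trans_full by metis
qed

lemma continuous_map_coord_rep: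
  assumes "c \<in> A" "continuous_on V g" "W = {q \<in> fst c. snd c q \<in> V}"
  shows "continuous_map (subtopology M W) euclidean (\<lambda>q. g (snd c q))"
proof -
  have "continuous_map (subtopology M W) (top_of_set V) (snd c)"
    using continuous_map_from_subtopology_mono[OF continuous_chart[OF assms(1)], of W] assms(3)
    by (auto simp: continuous_map_in_subtopology)
  from continuous_map_compose[OF this, of euclidean g] show ?thesis
    using assms(2) by (simp add: o_def)
qed

lemma continuous_smooth_map:
  assumes \<phi>: "smooth_map A \<phi>" shows "continuous_map M euclidean \<phi>"
proof (rule pasting_lemma[of A M fst euclidean "\<lambda>_. \<phi>"])
  fix c assume c: "c \<in> A"
  show "openin M (fst c)" using chart_dom c by blast
  have "continuous_map (subtopology M (fst c)) euclidean (\<lambda>q. coord_rep c \<phi> (snd c q))"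
    using \<phi> c smooth_on_continuous unfolding smooth_map_def
    by (intro continuous_map_coord_rep[where V="snd c ` fst c"]) auto
  then show "continuous_map (subtopology M (fst c)) euclidean \<phi>"
    by (rule continuous_map_eq) (simp add: coord_rep_apply[OF c])
next
  fix p assume "p \<in> topspace M"
  then show "\<exists>j. j \<in> A \<and> p \<in> fst j \<and> \<phi> p = \<phi> p" using chart_exists by blast
qed auto

lemma normal_dx: "c \<in> A \<Longrightarrow> p \<in> fst c \<Longrightarrow> \<xi> p \<bullet> differential c x p v = 0"
  and norm_\<xi>: "c \<in> A \<Longrightarrow> p \<in> fst c \<Longrightarrow> norm (\<xi> p) = 1"
  using normal unfolding unit_normal_field_def by auto

lemma unit_\<xi>: assumes "p \<in> topspace M" shows "\<xi> p \<bullet> \<xi> p = 1"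
proof -
  obtain c where "c \<in> A" "p \<in> fst c" using chart_exists[OF assms] by blast
  then show ?thesis using norm_\<xi> by (simp add: dot_square_norm)
qed

lemmas linear_dx = linear_differential[OF smooth_x] and linear_d\<xi> = linear_differential[OF smooth_\<xi>]

lemma inj_dx: "c \<in> A \<Longrightarrow> p \<in> fst c \<Longrightarrow> inj (differential c x p)"
  using imm unfolding immersion_def by auto

lemma tangent_space:
  assumes c: "c \<in> A" "p \<in> fst c"
  shows "range (differential c x p) = {w. \<xi> p \<bullet> w = 0}"
proof (rule subspace_dim_equal)
  have perp: "\<xi> p \<bullet> differential c x p v = 0" for v by (rule normal_dx[OF c])
  have nz: "\<xi> p \<noteq> 0" using unit_\<xi>[OF chart_dom(2)[OF c]] by auto
  show "subspace (range (differential c x p))"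
    using linear_dx[OF c] linear_subspace_image subspace_UNIV by blast
  show "subspace {w. \<xi> p \<bullet> w = 0}" by (rule subspace_hyperplane)
  show "range (differential c x p) \<subseteq> {w. \<xi> p \<bullet> w = 0}" using perp by blast
  show "dim {w. \<xi> p \<bullet> w = 0} \<le> dim (range (differential c x p))"
    using dim_image_eq[OF linear_dx[OF c], of UNIV] inj_dx[OF c] dim_hyperplane[OF nz] card_k by simp
qed

text \<open>The quadratic form of \<open>h\<close> as a function of the ambient vector \<open>dx(v)\<close>. The choice of chart is immaterial
  by \<open>sff_form_eq\<close>; the value is junk unless \<open>w\<close> is tangent at \<open>p\<close>.\<close>

definition sff_form :: "'a \<Rightarrow> real ^ 'k \<Rightarrow> real" where
  "sff_form p w = (let c = (SOME c. c \<in> A \<and> p \<in> fst c) in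
     - (differential c \<xi> p (inv (differential c x p) w) \<bullet> w))"

lemma sff_form_eq:
  assumes c: "c \<in> A" "p \<in> fst c"
  shows "sff_form p (differential c x p v) = - (differential c \<xi> p v \<bullet> differential c x p v)"
proof -
  define d where "d = (SOME c. c \<in> A \<and> p \<in> fst c)"
  have d: "d \<in> A" "p \<in> fst d"
    using someI[of "\<lambda>c. c \<in> A \<and> p \<in> fst c" c] c unfolding d_def by auto
  let ?v = "differential c (snd d) p v"
  have 1: "differential c x p v = differential d x p ?v" "differential c \<xi> p v = differential d \<xi> p ?v"
    by (rule differential_change_of_chart[OF atlas smooth_x c d], rule differential_change_of_chart[OF atlas smooth_\<xi> c d])
  show ?thesis
    unfolding sff_form_def Let_def d_def[symmetric] 1 by (simp add: inj_dx[OF d])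
qed

end

locale hypersurface_patch =
  hypersurface M A x \<xi> + graph_patch "coord_rep c x" "coord_rep c \<xi>" V "snd c p" \<tau>
  for M :: "'a topology" and A :: "('a, 'n::finite) chart set" and x \<xi> :: "'a \<Rightarrow> real ^ 'k::finite"
    and c :: "('a, 'n) chart" and p :: 'a and V :: "(real ^ 'n) set" and \<tau> :: "'n \<Rightarrow> real ^ 'k" +
  assumes c: "c \<in> A" and p: "p \<in> fst c" and V: "V \<subseteq> snd c ` fst c"
begin

abbreviation X :: "real ^ 'n \<Rightarrow> real ^ 'k" where "X \<equiv> coord_rep c x"
abbreviation N :: "real ^ 'n \<Rightarrow> real ^ 'k" where "N \<equiv> coord_rep c \<xi>"

lemma dir_deriv_differential: "dir_deriv v (coord_rep c \<phi>) (snd c q) = differential c \<phi> q v"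
  by (simp add: dir_deriv_def differential_def)

lemma D_differential: "D v (coord_rep c \<phi>) (snd c q) = differential c \<phi> q (E v (snd c q))"
  by (simp add: D_def dir_deriv_differential)

lemma patch_point: "u \<in> V \<Longrightarrow> \<exists>q\<in>fst c. u = snd c q"
  using V by blast

text \<open>If \<open>e\<close> are the chart components of \<open>w\<close>, then
  \<open>J (snd c q) *v e\<close> lists the products \<open>w \<bullet> \<tau> i\<close>; inverting
  \<open>J\<close> recovers \<open>e\<close>.\<close>

lemma tangent_D_X:
  assumes q: "q \<in> fst c" "snd c q \<in> V" and w: "w \<bullet> \<xi> q = 0"
  shows "w = D (\<chi> i. w \<bullet> \<tau> i) X (snd c q)"
proof -
  obtain e where e: "w = differential c x q e"
    using tangent_space[OF c q(1)] w by (metis (mono_tags, lifting) inner_commute mem_Collect_eq rangeE)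
  have "J (snd c q) *v e = (\<chi> i. w \<bullet> \<tau> i)"
  proof (rule vec_eq_iff[THEN iffD2], rule allI)
    fix i
    have "w = (\<Sum>k\<in>UNIV. e $ k *\<^sub>R dir_deriv (axis k 1) X (snd c q))"
      unfolding e dir_deriv_differential[symmetric] by (rule has_derivative_axis_expand[OF smooth_X q(2)])
    then have "w \<bullet> \<tau> i = (\<Sum>k\<in>UNIV. J (snd c q) $ i $ k * e $ k)"
      by (simp add: inner_sum_left J_def mult.commute)
    then show "(J (snd c q) *v e) $ i = (\<chi> i. w \<bullet> \<tau> i) $ i" by (simp add: matrix_vector_mult_def)
  qed
  then have "e = E (\<chi> i. w \<bullet> \<tau> i) (snd c q)" using E_unique[OF q(2)] by blast
  then show ?thesis using e D_differential by metis
qed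

lemma sff_form_D:
  assumes "q \<in> fst c" "snd c q \<in> V"
  shows "sff_form q (D v X (snd c q)) = \<rho> (snd c q) * D v (D v f) (snd c q)"
  using second_form[OF assms(2), of v v] by (simp add: D_differential sff_form_eq[OF c assms(1)])

lemma D_N_normal: assumes "q \<in> fst c" shows "D v N (snd c q) \<bullet> \<xi> q = 0"
  unfolding D_differential by (rule differential_normal_tangent[OF atlas normal c assms])

lemma D_X_0: "Di i X (snd c p) = \<tau> i"
proof -
  have "(\<Sum>j\<in>UNIV. axis i 1 $ j *\<^sub>R \<tau> j) = \<tau> i"
    by (simp add: axis_def if_distrib[of "\<lambda>a. a *\<^sub>R _"] cong: if_cong)
  then show ?thesis using D_X[OF u0, of "axis i 1"] by simp
qed

lemma N_0: "N (snd c p) = \<xi> p" by (rule coord_rep_apply[OF c p])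

lemma sff_matrix_hs: "sff_matrix_at A x \<xi> p hs"
proof -
  let ?e = "\<lambda>i. E (axis i 1) (snd c p)"
  have dx: "differential c x p (?e i) = \<tau> i" for i
    using D_X_0 by (simp add: D_differential)
  have "orthonormal_frame c x p ?e"
    unfolding orthonormal_frame_def dx by (simp add: orthonormal_\<tau>)
  moreover have "second_fundamental_form c x \<xi> p ?e hs"
    unfolding second_fundamental_form_def dx
  proof
    fix j
    have "Di j N (snd c p) \<bullet> \<tau> i = - (hs $ i $ j)" for i
      using second_form[OF u0, of "axis j 1" "axis i 1"] D_commute[OF smooth_f u0, of "axis j 1" "axis i 1"]
      by (simp add: D_X_0 hs_def)
    moreover have "Di j N (snd c p) \<bullet> N (snd c p) = 0" using D_N_normal[OF p] N_0 by simp
    ultimately have "Di j N (snd c p) = (\<Sum>i\<in>UNIV. - (hs $ i $ j) *\<^sub>R \<tau> i)"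
      using span_\<tau>[of "Di j N (snd c p)"] by simp
    then show "differential c \<xi> p (?e j) = - (\<Sum>i\<in>UNIV. hs $ i $ j *\<^sub>R \<tau> i)"
      by (simp add: D_differential sum_negf)
  qed
  ultimately show ?thesis using c p unfolding sff_matrix_at_def by blast
qed

lemma mean_curvature_H0: "mean_curvature A x \<xi> p = H0"
  unfolding H0_def by (rule mean_curvature_eq[OF atlas smooth_x smooth_\<xi> sff_matrix_hs])

lemma sff_norm_sq_S0: "sff_norm_sq A x \<xi> p = S0"
  unfolding S0_def by (rule sff_norm_sq_eq[OF atlas smooth_x smooth_\<xi> sff_matrix_hs])

text \<open>Agreement at all points of the patch, and not just at \<open>p\<close>, is what permits
  differentiating the self-expander equation there.\<close>

lemma mean_curvature_Hm:
  assumes q: "q \<in> fst c" "snd c q \<in> V"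
  shows "mean_curvature A x \<xi> q = Hm (snd c q)"
proof -
  let ?u = "snd c q"
  have qM: "q \<in> topspace M" using chart_dom c q by blast
  obtain h where h: "sff_matrix_at A x \<xi> q h"
    using sff_matrix_exists[OF card_k atlas imm normal qM] .
  obtain e where e: "orthonormal_frame c x q e" and he: "second_fundamental_form c x \<xi> q e h"
    using sff_matrix_in_chart[OF atlas smooth_x smooth_\<xi> h c q(1)] .
  define t where "t = (\<lambda>a. differential c x q (e a))"
  define T where "T = (\<lambda>a. differential c \<xi> q (e a))"
  have on: "t a \<bullet> t b = (if a = b then 1 else 0)" for a b
    using e unfolding orthonormal_frame_def t_def by blast
  have T: "T a = - (\<Sum>i\<in>UNIV. h $ i $ a *\<^sub>R t i)" for a
    using he unfolding second_fundamental_form_def t_def T_def by blast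
  have t_normal: "t a \<bullet> \<xi> q = 0" for a
    using normal_dx[OF c q(1)] by (simp add: t_def inner_commute)
  have DN: "Di i N ?u = (\<Sum>a\<in>UNIV. (Di i X ?u \<bullet> t a) *\<^sub>R T a)" for i
  proof -
    obtain k where k: "E (axis i 1) ?u = (\<Sum>a\<in>UNIV. k a *\<^sub>R e a)"
      using orthonormal_frame_spans[OF linear_dx[OF c q(1)] e] .
    have DX: "Di i X ?u = (\<Sum>a\<in>UNIV. k a *\<^sub>R t a)"
      unfolding D_differential k t_def
      by (simp add: linear_sum[OF linear_dx[OF c q(1)]] linear_cmul[OF linear_dx[OF c q(1)]])
    have "k a = Di i X ?u \<bullet> t a" for a
      unfolding DX by (rule orthonormal_inner_sum[symmetric, OF on])
    moreover have "Di i N ?u = (\<Sum>a\<in>UNIV. k a *\<^sub>R T a)"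
      unfolding D_differential k T_def
      by (simp add: linear_sum[OF linear_d\<xi>[OF c q(1)]] linear_cmul[OF linear_d\<xi>[OF c q(1)]])
    ultimately show ?thesis by simp
  qed
  \<comment> \<open>The error made when the \<open>\<tau> i\<close>, which need not be tangent at
    \<open>q\<close>, serve as dual vectors of the \<open>Di i X\<close>. It is orthogonal to all
    tangent vectors at \<open>q\<close>, in particular to \<open>T a\<close>.\<close>
  define r where "r = (\<lambda>a. (\<Sum>i\<in>UNIV. (Di i X ?u \<bullet> t a) *\<^sub>R \<tau> i) - t a)"
  have "Di j X ?u \<bullet> r a = 0" for j a
    by (simp add: r_def inner_diff_right inner_sum_right D_X_tau[OF q(2)] axis_def sum_Kronecker)
  then have "D v X ?u \<bullet> r a = 0" for v a
    by (subst D_sum_dir[OF smooth_X q(2)]) (simp add: inner_sum_left)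
  then have "t b \<bullet> r a = 0" for a b
    using tangent_D_X[OF q t_normal] by metis
  then have Tr: "T a \<bullet> r a = 0" for a
    unfolding T by (simp add: inner_sum_left)
  have "Hm ?u = - (\<Sum>i\<in>UNIV. \<Sum>a\<in>UNIV. (Di i X ?u \<bullet> t a) * (T a \<bullet> \<tau> i))"
    by (simp add: Hm_def DN inner_sum_left)
  also have "\<dots> = - (\<Sum>a\<in>UNIV. T a \<bullet> (\<Sum>i\<in>UNIV. (Di i X ?u \<bullet> t a) *\<^sub>R \<tau> i))"
    by (subst sum.swap) (simp add: inner_sum_right)
  also have "\<dots> = - (\<Sum>a\<in>UNIV. T a \<bullet> t a)"
    using Tr by (simp add: r_def inner_diff_right)
  also have "\<dots> = (\<Sum>a\<in>UNIV. h $ a $ a)"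
    by (simp add: T sum_negf orthonormal_inner_sum[OF on])
  finally show ?thesis using mean_curvature_eq[OF atlas smooth_x smooth_\<xi> h] by simp
qed

end

text \<open>The vectors \<tau> are the images under \<open>dx\<close> of an orthonormal frame at
  \<open>p\<close>, and \<open>V\<close> is the part of the chart where the Jacobian of the
  projection is invertible. It is invertible at \<open>p\<close>: a kernel vector has an image
  orthogonal to all \<open>\<tau> i\<close> and to \<open>\<xi> p\<close>, hence zero, and
  \<open>dx\<close> is injective.\<close>

lemma (in hypersurface) patch_exists:
  assumes p: "p \<in> topspace M"
  obtains c V \<tau> where "hypersurface_patch M A x \<xi> c p V \<tau>"
proof -
  obtain c where c: "c \<in> A" "p \<in> fst c" using chart_exists[OF p] by blast
  obtain e where e: "orthonormal_frame c x p e" using orthonormal_frame_exists[OF imm c] .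
  define \<tau> where "\<tau> = (\<lambda>i. differential c x p (e i))"
  let ?X = "coord_rep c x" and ?N = "coord_rep c \<xi>" and ?U = "snd c ` fst c"
  let ?J = "\<lambda>u. (\<chi> i j. dir_deriv (axis j 1) ?X u \<bullet> \<tau> i)"
  define V where "V = {u \<in> ?U. det (?J u) \<noteq> 0}"
  have U: "open ?U" using chart[OF c(1)] unfolding chart_on_def by blast
  have sX: "smooth_on ?U ?X" and sN: "smooth_on ?U ?N"
    using smooth_x smooth_\<xi> c unfolding smooth_map_def by auto
  have "smooth_on ?U (\<lambda>u. det (?J u))"
    by (intro smooth_on_det[OF U]) (simp add: smooth_on_inner[OF U] smooth_on_dir_deriv sX smooth_on_const)
  from continuous_open_preimage[OF smooth_on_continuous[OF this] U open_delete[OF open_UNIV, of 0]]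
  have "open (?U \<inter> (\<lambda>u. det (?J u)) -` (UNIV - {0}))" .
  also have "?U \<inter> (\<lambda>u. det (?J u)) -` (UNIV - {0}) = V" by (unfold V_def, blast)
  finally have "open V" .
  have on: "\<tau> i \<bullet> \<tau> j = (if i = j then 1 else 0)" for i j
    using e unfolding orthonormal_frame_def \<tau>_def by blast
  have perp: "\<xi> p \<bullet> differential c x p v = 0" for v by (rule normal_dx[OF c])
  have \<xi>1: "\<xi> p \<bullet> \<xi> p = 1" using unit_\<xi>[OF p] .
  have N0: "?N (snd c p) = \<xi> p" using coord_rep_apply[OF c] .
  have span: "w = (\<Sum>i\<in>UNIV. (w \<bullet> \<tau> i) *\<^sub>R \<tau> i) + (w \<bullet> \<xi> p) *\<^sub>R \<xi> p" for w
  proof -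
    define r where "r = w - ((\<Sum>i\<in>UNIV. (w \<bullet> \<tau> i) *\<^sub>R \<tau> i) + (w \<bullet> \<xi> p) *\<^sub>R \<xi> p)"
    have perp': "\<xi> p \<bullet> \<tau> i = 0" "\<tau> i \<bullet> \<xi> p = 0" for i
      using perp[of "e i"] by (simp_all add: \<tau>_def inner_commute[of _ "\<xi> p"])
    have "\<xi> p \<bullet> r = 0"
      by (simp add: r_def inner_diff_right inner_add_right inner_sum_right perp' \<xi>1 inner_commute[of w])
    then obtain v where v: "r = differential c x p v" using tangent_space[OF c] by blast
    obtain k where "v = (\<Sum>i\<in>UNIV. k i *\<^sub>R e i)"
      using orthonormal_frame_spans[OF linear_dx[OF c] e] .
    then have r: "r = (\<Sum>i\<in>UNIV. k i *\<^sub>R \<tau> i)"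
      by (simp add: v \<tau>_def linear_sum[OF linear_dx[OF c]] linear_cmul[OF linear_dx[OF c]])
    have "k i = r \<bullet> \<tau> i" for i unfolding r by (rule orthonormal_inner_sum[symmetric, OF on])
    moreover have "r \<bullet> \<tau> i = 0" for i
      by (simp add: r_def inner_diff_left inner_add_left orthonormal_inner_sum[OF on] perp')
    ultimately have "r = 0" unfolding r by simp
    then show ?thesis by (simp add: r_def)
  qed
  have "?J (snd c p) *v v = 0 \<Longrightarrow> v = 0" for v
  proof -
    assume J0: "?J (snd c p) *v v = 0"
    let ?w = "differential c x p v"
    have "?w = (\<Sum>k\<in>UNIV. v $ k *\<^sub>R dir_deriv (axis k 1) ?X (snd c p))"
      using has_derivative_axis_expand[OF sX, of "snd c p" v] c by (simp add: dir_deriv_def differential_def)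
    then have "?w \<bullet> \<tau> i = (?J (snd c p) *v v) $ i" for i
      by (simp add: inner_sum_left matrix_vector_mult_def mult.commute)
    then have "?w \<bullet> \<tau> i = 0" for i using J0 by simp
    then have "?w = 0" using span[of ?w] perp[of v] by (simp add: inner_commute[of _ "\<xi> p"])
    then show "v = 0" using inj_dx[OF c] linear_injective_0[OF linear_dx[OF c]] by blast
  qed
  then have "det (?J (snd c p)) \<noteq> 0"
    using det_nz_iff_inj[OF matrix_vector_mul_linear, of "?J (snd c p)"]
      linear_injective_0[OF matrix_vector_mul_linear, of "?J (snd c p)"] by simp
  then have u0: "snd c p \<in> V" using c by (simp add: V_def)
  have VU: "V \<subseteq> ?U" by (auto simp: V_def)
  have "graph_patch ?X ?N V (snd c p) \<tau>"
  proof
    show "smooth_on V ?X" "smooth_on V ?N" using sX sN smooth_on_subset VU by blast+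
    fix u assume "u \<in> V"
    then obtain q where q: "q \<in> fst c" "u = snd c q" using VU by blast
    then have qM: "q \<in> topspace M" using chart_dom c by blast
    show "?N u \<bullet> ?N u = 1" using unit_\<xi>[OF qM] coord_rep_apply[OF c(1) q(1), of \<xi>] q(2) by simp
    show "?N u \<bullet> dir_deriv v ?X u = 0" for v
      using normal_dx[OF c(1) q(1)] coord_rep_apply[OF c(1) q(1), of \<xi>] q(2)
      by (simp add: dir_deriv_def differential_def)
    show "det (?J u) \<noteq> 0" using \<open>u \<in> V\<close> by (simp add: V_def)
  next
    show "\<tau> i \<bullet> ?N (snd c p) = 0" for i unfolding N0 \<tau>_def using perp[of "e i"] by (simp add: inner_commute)
    show "w = (\<Sum>i\<in>UNIV. (w \<bullet> \<tau> i) *\<^sub>R \<tau> i) + (w \<bullet> ?N (snd c p)) *\<^sub>R ?N (snd c p)" for w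
      unfolding N0 by (rule span)
  qed (use \<open>open V\<close> u0 on in auto)
  then have "hypersurface_patch M A x \<xi> c p V \<tau>"
    using hypersurface_axioms c VU by (simp add: hypersurface_patch_def hypersurface_patch_axioms_def)
  then show thesis by (rule that)
qed

section \<open>Sard's theorem for Gauss maps\<close>

text \<open>The library proves Sard's theorem only for wellordered index types.\<close>

typedef ('n::finite) ordered_index = "{..<CARD('n)}"
  by (rule exI[of _ 0]) simp

instance ordered_index :: (finite) finite
proof
  have "(UNIV :: 'a ordered_index set) = Abs_ordered_index ` {..<CARD('a)}"
    by (rule type_definition.Abs_image[OF type_definition_ordered_index, symmetric])
  then show "finite (UNIV :: 'a ordered_index set)" by (metis finite_imageI finite_lessThan)
qed

instantiation ordered_index :: (finite) wellorder
begin

definition "a \<le> b \<longleftrightarrow> Rep_ordered_index a \<le> Rep_ordered_index b"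
definition "a < b \<longleftrightarrow> Rep_ordered_index a < Rep_ordered_index b"

instance
proof
  fix P :: "'a ordered_index \<Rightarrow> bool" and a
  assume step: "\<And>x. (\<And>y. y < x \<Longrightarrow> P y) \<Longrightarrow> P x"
  show "P a"
    by (induction a rule: measure_induct_rule[of Rep_ordered_index])
      (use step less_ordered_index_def in blast)
qed (auto simp: less_eq_ordered_index_def less_ordered_index_def Rep_ordered_index_inject)

end

lemma card_ordered_index: "CARD(('n::finite) ordered_index) = CARD('n)"
  using type_definition.card[OF type_definition_ordered_index] by simp

text \<open>\<open>baby_Sard\<close> is applied to \<open>g\<close> composed with the relabelling of
  coordinates \<iota>, which changes neither the image nor the presence of a kernel vector. The
  kernel vector makes the rank drop.\<close>

lemma Sard_finite_index:
  fixes g :: "real ^ 'n::finite \<Rightarrow> real ^ 'n ordered_index"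
  assumes der: "\<And>u. u \<in> S \<Longrightarrow> (g has_derivative g' u) (at u)"
    and crit: "\<And>u. u \<in> S \<Longrightarrow> \<exists>e. e \<noteq> 0 \<and> g' u e = 0"
  shows "negligible (g ` S)"
proof -
  have "card (UNIV :: 'n set) = card (UNIV :: 'n ordered_index set)" by (simp add: card_ordered_index)
  then obtain b :: "'n \<Rightarrow> 'n ordered_index" where b: "bij b"
    using finite_same_card_bij[of "UNIV :: 'n set" "UNIV :: 'n ordered_index set"] by auto
  define \<iota> :: "real ^ 'n ordered_index \<Rightarrow> real ^ 'n" where "\<iota> = (\<lambda>z. \<chi> i. z $ b i)"
  have lin: "linear \<iota>" by (rule linearI) (simp_all add: \<iota>_def vec_eq_iff)
  have surj: "\<iota> (\<chi> a. u $ inv b a) = u" for u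
    using b by (simp add: \<iota>_def bij_is_inj)
  have "negligible ((g \<circ> \<iota>) ` (\<iota> -` S))"
  proof (rule baby_Sard)
    fix z assume z: "z \<in> \<iota> -` S"
    have "(g \<circ> \<iota> has_derivative g' (\<iota> z) \<circ> \<iota>) (at z)"
      using z by (intro diff_chain_at linear_imp_has_derivative lin der) simp
    then show "(g \<circ> \<iota> has_derivative g' (\<iota> z) \<circ> \<iota>) (at z within \<iota> -` S)"
      by (rule has_derivative_at_withinI)
    have lin': "matrix (g' (\<iota> z) \<circ> \<iota>) *v v = (g' (\<iota> z) \<circ> \<iota>) v" for v
      using has_derivative_linear[OF \<open>(g \<circ> \<iota> has_derivative g' (\<iota> z) \<circ> \<iota>) (at z)\<close>]
      by (simp add: matrix_works linear_matrix_vector_mul_eq)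
    obtain e where e: "e \<noteq> 0" "g' (\<iota> z) e = 0" using crit z by blast
    let ?e = "\<chi> a. e $ inv b a"
    have "(g' (\<iota> z) \<circ> \<iota>) ?e = 0" using e by (simp add: surj)
    moreover have "?e \<noteq> 0" using surj[of e] linear_0[OF lin] e(1) by metis
    ultimately have "\<not> inj ((*v) (matrix (g' (\<iota> z) \<circ> \<iota>)))"
      unfolding linear_injective_0[OF matrix_vector_mul_linear] lin' by blast
    then show "rank (matrix (g' (\<iota> z) \<circ> \<iota>)) < CARD('n ordered_index)"
      by (simp add: less_rank_noninjective)
  qed simp
  moreover have "(g \<circ> \<iota>) ` (\<iota> -` S) = g ` S"
  proof -
    have "\<iota> ` (\<iota> -` S) = S" by (rule surj_image_vimage_eq[OF surjI[where f="\<lambda>u. \<chi> a. u $ inv b a"]]) (rule surj)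
    then show ?thesis by (metis image_comp)
  qed
  ultimately show ?thesis by simp
qed

context hypersurface
begin

text \<open>Sard's theorem on the sphere is reduced to euclidean space of dimension n by orthogonal
  projection to one tangent plane. A kernel vector of d\<xi> stays one after projection, so the
  projected critical values are negligible and miss a point \<open>z\<close> of the open unit ball;
  a point of the sphere above \<open>z\<close> is then not a critical value.\<close>

lemma regular_direction:
  obtains y :: "real ^ 'k" where "y \<bullet> y = 1"
    "\<And>c p e. c \<in> A \<Longrightarrow> p \<in> fst c \<Longrightarrow> differential c \<xi> p e = 0 \<Longrightarrow> e \<noteq> 0 \<Longrightarrow> \<xi> p \<noteq> - y"
proof -
  obtain p0 where p0: "p0 \<in> topspace M" using nonempty_M by blast
  obtain c0 V \<tau> where "hypersurface_patch M A x \<xi> c0 p0 V \<tau>" using patch_exists[OF p0] .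
  then interpret P: hypersurface_patch M A x \<xi> c0 p0 V \<tau> .
  have on: "\<tau> i \<bullet> \<tau> j = (if i = j then 1 else 0)" for i j by (rule P.orthonormal_\<tau>)
  have perp: "\<tau> i \<bullet> \<xi> p0 = 0" for i using P.tangent_\<tau> P.N_0 by simp
  have "card (UNIV :: 'n ordered_index set) = card (UNIV :: 'n set)" by (simp add: card_ordered_index)
  then obtain b :: "'n ordered_index \<Rightarrow> 'n" where b: "bij b"
    using finite_same_card_bij[of "UNIV :: 'n ordered_index set" "UNIV :: 'n set"] by auto
  define proj :: "real ^ 'k \<Rightarrow> real ^ 'n ordered_index" where "proj = (\<lambda>w. \<chi> a. w \<bullet> \<tau> (b a))"
  have lin: "linear proj" by (rule linearI) (simp_all add: proj_def vec_eq_iff inner_add_left)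
  define C where "C = (\<lambda>c :: ('a, 'n) chart. {p \<in> fst c. \<exists>e. e \<noteq> 0 \<and> differential c \<xi> p e = 0})"
  have neg: "negligible (proj ` \<xi> ` C c)" if c: "c \<in> A" for c
  proof -
    have "negligible ((proj \<circ> coord_rep c \<xi>) ` snd c ` C c)"
    proof (rule Sard_finite_index)
      fix u assume "u \<in> snd c ` C c"
      then obtain p e where p: "p \<in> fst c" "u = snd c p" "e \<noteq> 0" "differential c \<xi> p e = 0"
        unfolding C_def by blast
      have "((coord_rep c \<xi>) has_derivative (\<lambda>v. dir_deriv v (coord_rep c \<xi>) u)) (at u)"
        using differential_has_derivative[OF smooth_\<xi> c p(1)] p(2)
        by (simp add: dir_deriv_def differential_def)
      then show "(proj \<circ> coord_rep c \<xi> has_derivative proj \<circ> (\<lambda>v. dir_deriv v (coord_rep c \<xi>) u)) (at u)"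
        by (intro diff_chain_at linear_imp_has_derivative lin)
      show "\<exists>e. e \<noteq> 0 \<and> (proj \<circ> (\<lambda>v. dir_deriv v (coord_rep c \<xi>) u)) e = 0"
        using p linear_0[OF lin] by (auto simp: dir_deriv_def differential_def)
    qed
    moreover have "(proj \<circ> coord_rep c \<xi>) ` snd c ` C c = proj ` \<xi> ` C c"
      by (auto simp: image_image C_def coord_rep_apply[OF c] intro!: image_cong)
    ultimately show ?thesis by simp
  qed
  \<comment> \<open>The atlas may be uncountable. Compactness leaves finitely many charts, so that
    the union of the negligible sets is negligible.\<close>
  have "compactin M (topspace M)" using compact_M by (simp add: compact_space_def)
  moreover have "openin M W" if "W \<in> fst ` A" for W using chart_dom(1) that by blast
  moreover have "topspace M \<subseteq> \<Union> (fst ` A)" using chart_exists by blast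
  ultimately obtain F where F: "finite F" "F \<subseteq> fst ` A" "topspace M \<subseteq> \<Union> F"
    using compactinD[of M "topspace M" "fst ` A"] by meson
  then obtain B where B: "finite B" "B \<subseteq> A" "topspace M \<subseteq> \<Union> (fst ` B)"
    by (metis finite_subset_image)
  have "negligible (\<Union>c\<in>B. proj ` \<xi> ` C c)"
    using B neg by (intro negligible_Union) auto
  moreover have "\<not> negligible (ball (0 :: real ^ 'n ordered_index) 1)"
    by (rule open_not_negligible) auto
  ultimately have "\<not> ball 0 1 \<subseteq> (\<Union>c\<in>B. proj ` \<xi> ` C c)"
    using negligible_subset by metis
  then obtain z where "z \<in> ball 0 1" and z2: "z \<notin> (\<Union>c\<in>B. proj ` \<xi> ` C c)" by blast
  then have z: "norm z < 1" by simp
  \<comment> \<open>\<open>- y\<close> is the lift of \<open>z\<close> to the hemisphere around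
    \<open>\<xi> p0\<close>; a point with normal \<open>- y\<close> would project to
    \<open>z\<close>.\<close>
  define y where "y = - ((\<Sum>i\<in>UNIV. z $ inv b i *\<^sub>R \<tau> i) + sqrt (1 - z \<bullet> z) *\<^sub>R \<xi> p0)"
  have zz: "z \<bullet> z < 1" using z by (metis norm_eq_sqrt_inner real_sqrt_lt_1_iff)
  have y\<tau>: "y \<bullet> \<tau> i = - (z $ inv b i)" for i
    using perp[of i] by (simp add: y_def inner_add_left orthonormal_inner_sum[OF on] inner_commute[of "\<xi> p0"] inner_diff_left)
  have y\<xi>: "y \<bullet> \<xi> p0 = - sqrt (1 - z \<bullet> z)"
    using perp unit_\<xi>[OF p0] by (simp add: y_def inner_add_left inner_sum_left inner_diff_left)
  show thesis
  proof (rule that)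
    have "(\<Sum>i\<in>UNIV. z $ inv b i * z $ inv b i) = z \<bullet> z"
      using sum.reindex_bij_betw[OF bij_imp_bij_inv[OF b], of "\<lambda>a. z $ a * z $ a"]
      by (simp add: inner_vec_def)
    then show "y \<bullet> y = 1"
      using zz by (simp add: P.inner_expand[of y y] y\<tau> P.N_0 y\<xi>)
    fix c p e assume c: "c \<in> A" "p \<in> fst c" and e: "differential c \<xi> p e = 0" "e \<noteq> 0"
    show "\<xi> p \<noteq> - y"
    proof
      assume eq: "\<xi> p = - y"
      have "p \<in> topspace M" using chart_dom c by blast
      then obtain d where d: "d \<in> B" "p \<in> fst d" using B(3) by blast
      then have dA: "d \<in> A" using B by blast
      have "\<exists>e. e \<noteq> 0 \<and> differential d \<xi> p e = 0"
      proof (intro exI conjI)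
        let ?e = "differential c (snd d) p e"
        show "differential d \<xi> p ?e = 0"
          using differential_change_of_chart[OF atlas smooth_\<xi> c dA d(2)] e by simp
        have "differential c x p e \<noteq> 0"
          using inj_dx[OF c] linear_0[OF linear_dx[OF c]] e(2) by (metis injD)
        then show "?e \<noteq> 0"
          using differential_change_of_chart[OF atlas smooth_x c dA d(2), of e] linear_0[OF linear_dx[OF dA d(2)]]
          by auto
      qed
      then have "p \<in> C d" using d by (simp add: C_def)
      moreover have "proj (\<xi> p) = z"
        unfolding eq proj_def vec_eq_iff using b by (simp add: y\<tau> bij_is_inj)
      ultimately show False using z2 d(1) by blast
    qed
  qed
qed

end

section \<open>Compactness\<close>

lemma continuous_map_binop:
  assumes "continuous_map T euclidean F" "continuous_map T euclidean G"
    and "continuous_on UNIV (\<lambda>p. h (fst p) (snd p))"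
  shows "continuous_map T euclidean (\<lambda>z. h (F z) (G z))"
proof -
  have "continuous_map T (prod_topology euclidean euclidean) (\<lambda>z. (F z, G z))"
    by (intro continuous_map_pairedI assms)
  then have "continuous_map T euclidean (\<lambda>z. (F z, G z))"
    by (simp only: prod_topology_euclidean)
  from continuous_map_compose[OF this, of euclidean "\<lambda>p. h (fst p) (snd p)"] show ?thesis
    using assms(3) by (simp add: o_def)
qed

lemma continuous_map_inner:
  fixes F G :: "'a \<Rightarrow> 'b::real_inner"
  shows "continuous_map T euclidean F \<Longrightarrow> continuous_map T euclidean G \<Longrightarrow>
    continuous_map T euclideanreal (\<lambda>z. F z \<bullet> G z)"
  by (rule continuous_map_binop) (auto intro!: continuous_intros)

lemma compact_space_attains_min:
  fixes g :: "'a \<Rightarrow> real"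
  assumes "compact_space T" "topspace T \<noteq> {}" "continuous_map T euclidean g"
  shows "\<exists>z\<in>topspace T. \<forall>z'\<in>topspace T. g z \<le> g z'"
proof -
  have "compact (g ` topspace T)"
    using image_compactin[OF _ assms(3)] assms(1) unfolding compact_space_def by simp
  then obtain m where "m \<in> g ` topspace T" "\<And>m'. m' \<in> g ` topspace T \<Longrightarrow> m \<le> m'"
    using compact_attains_inf[of "g ` topspace T"] assms(2) by blast
  then show ?thesis by blast
qed

lemma compact_space_attains_max:
  fixes g :: "'a \<Rightarrow> real"
  assumes "compact_space T" "topspace T \<noteq> {}" "continuous_map T euclidean g"
  shows "\<exists>z\<in>topspace T. \<forall>z'\<in>topspace T. g z' \<le> g z"
  using compact_space_attains_min[OF assms(1,2), of "\<lambda>z. - g z"] assms(3)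
  by (simp add: continuous_map_minus)

text \<open>On the compact set where \<open>s\<close> is not positive, \<open>t\<close> has a
  positive minimum, so a large multiple of \<open>t\<close> outweighs \<open>s\<close> there. It
  supplies both constants in \<open>strictly_convex\<close>.\<close>

lemma compact_space_penalty:
  fixes s t :: "'a \<Rightarrow> real"
  assumes T: "compact_space T" and s: "continuous_map T euclidean s" and t: "continuous_map T euclidean t"
    and nonneg: "\<And>z. z \<in> topspace T \<Longrightarrow> t z \<ge> 0"
    and pos: "\<And>z. z \<in> topspace T \<Longrightarrow> t z = 0 \<Longrightarrow> s z > 0"
  shows "\<exists>b>0. \<forall>z\<in>topspace T. s z + b * t z > 0"
proof -
  define C where "C = {z \<in> topspace T. s z \<in> {..0}}"
  have C: "closedin T C"
    unfolding C_def by (rule closedin_continuous_map_preimage[OF s]) simp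
  let ?T = "subtopology T C"
  have cT: "compact_space ?T"
    by (rule compact_space_subtopology[OF closedin_compact_space[OF T C]])
  have tT: "topspace ?T = C" using closedin_subset[OF C] by auto
  have outside: "s z > 0" if "z \<in> topspace T" "z \<notin> C" for z using that by (auto simp: C_def)
  show ?thesis
  proof (cases "C = {}")
    case True
    then have "s z + 1 * t z > 0" if "z \<in> topspace T" for z
      using outside[OF that] nonneg[OF that] by (simp add: add_pos_nonneg)
    then show ?thesis using zero_less_one by blast
  next
    case False
    obtain z1 where z1: "z1 \<in> C" "\<And>z. z \<in> C \<Longrightarrow> t z1 \<le> t z"
      using compact_space_attains_min[OF cT _ continuous_map_from_subtopology[OF t]] False unfolding tT by blast
    obtain z2 where z2: "z2 \<in> C" "\<And>z. z \<in> C \<Longrightarrow> s z2 \<le> s z"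
      using compact_space_attains_min[OF cT _ continuous_map_from_subtopology[OF s]] False unfolding tT by blast
    have d: "t z1 > 0" using z1(1) nonneg[of z1] pos[of z1] unfolding C_def by force
    \<comment> \<open>With the minima at \<open>z1\<close> and \<open>z2\<close>, this gives
      \<open>b * t z \<ge> 1 + \<bar>s z2\<bar>\<close> on \<open>C\<close>, which exceeds
      \<open>- s z\<close>.\<close>
    define b where "b = (1 + \<bar>s z2\<bar>) / t z1"
    have b: "b > 0" using d by (simp add: b_def add_pos_nonneg)
    have "s z + b * t z > 0" if z: "z \<in> topspace T" for z
    proof (cases "z \<in> C")
      case True
      have "b * t z \<ge> b * t z1" using z1(2)[OF True] b by simp
      moreover have "b * t z1 = 1 + \<bar>s z2\<bar>" using d by (simp add: b_def)
      ultimately show ?thesis using z2(2)[OF True] by linarith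
    next
      case False
      then show ?thesis using b nonneg[OF z] outside[OF z] by (simp add: add_pos_nonneg)
    qed
    then show ?thesis using b by blast
  qed
qed

context hypersurface
begin

text \<open>The unit tangent bundle, with tangent vectors represented by their images under
  \<open>dx\<close>. As a subspace of a product with euclidean space it needs no bundle charts, and
  its compactness follows from that of \<open>M\<close> and of a sphere.\<close>

definition unit_tangent :: "('a \<times> (real ^ 'k)) topology" where
  "unit_tangent = subtopology (prod_topology M euclidean) {z. snd z \<bullet> snd z = 1 \<and> snd z \<bullet> \<xi> (fst z) = 0}"

lemma topspace_unit_tangent:
  "z \<in> topspace unit_tangent \<longleftrightarrow> fst z \<in> topspace M \<and> snd z \<bullet> snd z = 1 \<and> snd z \<bullet> \<xi> (fst z) = 0"
  by (cases z) (auto simp: unit_tangent_def)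

lemma continuous_fst_unit_tangent: "continuous_map unit_tangent M fst"
  unfolding unit_tangent_def by (intro continuous_map_from_subtopology continuous_map_fst)

lemma continuous_snd_unit_tangent: "continuous_map unit_tangent euclidean snd"
  unfolding unit_tangent_def by (intro continuous_map_from_subtopology continuous_map_snd)

lemma continuous_on_unit_tangent:
  "continuous_map M euclidean \<phi> \<Longrightarrow> continuous_map unit_tangent euclidean (\<lambda>z. \<phi> (fst z))"
  using continuous_map_compose[OF continuous_fst_unit_tangent] by (simp add: o_def)

lemma compact_unit_tangent: "compact_space unit_tangent"
proof -
  let ?P = "prod_topology M (euclidean :: (real ^ 'k) topology)"
  let ?C = "{z \<in> topspace ?P. snd z \<bullet> snd z \<in> {1}} \<inter> {z \<in> topspace ?P. snd z \<bullet> \<xi> (fst z) \<in> {0}}"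
  have s: "continuous_map ?P euclidean snd" by (rule continuous_map_snd)
  have f: "continuous_map ?P euclidean (\<lambda>z. \<xi> (fst z))"
    using continuous_map_compose[OF continuous_map_fst continuous_smooth_map[OF smooth_\<xi>]] by (simp add: o_def)
  have C: "closedin ?P ?C"
    by (intro closedin_Int closedin_continuous_map_preimage[where Y=euclideanreal] continuous_map_inner s f) auto
  have "compactin ?P (topspace M \<times> sphere 0 1)"
    using compact_M by (simp add: compactin_Times compact_space_def)
  moreover have "?C \<subseteq> topspace M \<times> sphere 0 1"
    by (auto simp: norm_eq_sqrt_inner)
  ultimately have "compactin ?P ?C" using closed_compactin C by blast
  then have "compact_space (subtopology ?P ?C)" by (rule compact_space_subtopology)
  moreover have "?C = topspace ?P \<inter> {z. snd z \<bullet> snd z = 1 \<and> snd z \<bullet> \<xi> (fst z) = 0}" by auto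
  then have "subtopology ?P ?C = unit_tangent"
    unfolding unit_tangent_def by (simp only: subtopology_restrict)
  ultimately show ?thesis by simp
qed

end

context hypersurface_patch
begin

lemma sff_form_coordinates:
  assumes q: "q \<in> fst c" "snd c q \<in> V" and w: "w \<bullet> \<xi> q = 0"
  shows "sff_form q w = (\<Sum>i\<in>UNIV. \<Sum>j\<in>UNIV. (w \<bullet> \<tau> i) * (w \<bullet> \<tau> j) * (\<rho> (snd c q) * Di j (Di i f) (snd c q)))"
proof -
  let ?v = "\<chi> i. w \<bullet> \<tau> i"
  have "sff_form q w = \<rho> (snd c q) * D ?v (D ?v f) (snd c q)"
    using sff_form_D[OF q, of ?v] tangent_D_X[OF q w] by simp
  also have "D ?v (D ?v f) (snd c q) = (\<Sum>i\<in>UNIV. (w \<bullet> \<tau> i) * (\<Sum>j\<in>UNIV. (w \<bullet> \<tau> j) * Di j (Di i f) (snd c q)))"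
    by (subst DDf_sum[OF q(2)]) (subst D_sum_dir[OF _ q(2), of _ ?v], simp_all add: sm)
  finally show ?thesis by (simp add: sum_distrib_left ac_simps)
qed

definition W :: "'a set" where "W = {q \<in> fst c. snd c q \<in> V}"

lemma openin_W: "openin M W"
  unfolding W_def by (rule openin_chart_preimage[OF c open_U])

lemma p_W: "p \<in> W"
  using p u0 by (simp add: W_def)

text \<open>In a patch the chosen chart and the inverse of \<open>dx\<close> in
  \<open>sff_form\<close> disappear: what remains is a quadratic polynomial in the
  \<open>w \<bullet> \<tau> i\<close> with smooth coefficients.\<close>

lemma continuous_sff_form_patch:
  "continuous_map (subtopology unit_tangent {z \<in> topspace unit_tangent. fst z \<in> W}) euclidean (\<lambda>z. sff_form (fst z) (snd z))"
proof -
  let ?T = "subtopology unit_tangent {z \<in> topspace unit_tangent. fst z \<in> W}"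
  have 1: "continuous_map ?T (subtopology M W) fst"
    using continuous_map_from_subtopology[OF continuous_fst_unit_tangent]
    by (auto simp: continuous_map_in_subtopology)
  have 2: "continuous_map ?T euclidean (\<lambda>z. g (snd c (fst z)))" if "smooth_on V g" for g :: "real ^ 'n \<Rightarrow> real"
    using continuous_map_compose[OF 1 continuous_map_coord_rep[OF c smooth_on_continuous[OF that] W_def]]
    by (simp add: o_def)
  have 3: "continuous_map ?T euclidean (\<lambda>z. snd z \<bullet> \<tau> i)" for i
    by (intro continuous_map_inner continuous_map_from_subtopology[OF continuous_snd_unit_tangent]) simp
  have "continuous_map ?T euclidean (\<lambda>z. \<Sum>i\<in>UNIV. \<Sum>j\<in>UNIV. (snd z \<bullet> \<tau> i) * (snd z \<bullet> \<tau> j) *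
      (\<rho> (snd c (fst z)) * Di j (Di i f) (snd c (fst z))))"
    by (intro continuous_map_sum continuous_map_real_mult 3 2) (simp_all add: sm)
  then show ?thesis
  proof (rule continuous_map_eq)
    fix z assume "z \<in> topspace ?T"
    then have "fst z \<in> fst c" "snd c (fst z) \<in> V" "snd z \<bullet> \<xi> (fst z) = 0"
      by (auto simp: W_def topspace_unit_tangent)
    from sff_form_coordinates[OF this] show "(\<Sum>i\<in>UNIV. \<Sum>j\<in>UNIV. (snd z \<bullet> \<tau> i) * (snd z \<bullet> \<tau> j) *
      (\<rho> (snd c (fst z)) * Di j (Di i f) (snd c (fst z)))) = sff_form (fst z) (snd z)" by simp
  qed
qed

end

context hypersurface
begin

lemma continuous_sff_form: "continuous_map unit_tangent euclidean (\<lambda>z. sff_form (fst z) (snd z))"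
proof -
  let ?g = "\<lambda>z. sff_form (fst z) (snd z)" and ?T = "\<lambda>W. {z \<in> topspace unit_tangent. fst z \<in> W}"
  let ?I = "{W. openin M W \<and> continuous_map (subtopology unit_tangent (?T W)) euclidean ?g}"
  show ?thesis
  proof (rule pasting_lemma[of ?I unit_tangent ?T euclidean "\<lambda>_. ?g"])
    show "openin unit_tangent (?T W)" if "W \<in> ?I" for W
      using that openin_continuous_map_preimage[OF continuous_fst_unit_tangent] by blast
  next
    fix z assume z: "z \<in> topspace unit_tangent"
    then obtain c V \<tau> where "hypersurface_patch M A x \<xi> c (fst z) V \<tau>"
      using patch_exists topspace_unit_tangent by metis
    then interpret P: hypersurface_patch M A x \<xi> c "fst z" V \<tau> .
    show "\<exists>W. W \<in> ?I \<and> z \<in> ?T W \<and> ?g z = ?g z"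
      using P.openin_W P.continuous_sff_form_patch P.p_W z by blast
  qed auto
qed

lemma nonempty_unit_tangent: "topspace unit_tangent \<noteq> {}"
proof -
  obtain p where p: "p \<in> topspace M" using nonempty_M by blast
  obtain c V \<tau> where "hypersurface_patch M A x \<xi> c p V \<tau>" using patch_exists[OF p] .
  then interpret P: hypersurface_patch M A x \<xi> c p V \<tau> .
  have "(p, \<tau> undefined) \<in> topspace unit_tangent"
    using p P.orthonormal_\<tau> P.tangent_\<tau> P.N_0 by (simp add: topspace_unit_tangent)
  then show ?thesis by blast
qed

text \<open>On a ball inside a chart the derivative vanishes and \<phi> is constant, so the preimage
  of every set is open. A level set is then clopen, and the manifold is connected.\<close>

lemma locally_constant_imp_constant:
  fixes \<phi> :: "'a \<Rightarrow> real"
  assumes \<phi>: "\<And>c p. c \<in> A \<Longrightarrow> p \<in> fst c \<Longrightarrow> (coord_rep c \<phi> has_derivative (\<lambda>v. 0)) (at (snd c p))"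
    and pq: "p \<in> topspace M" "q \<in> topspace M"
  shows "\<phi> p = \<phi> q"
proof -
  have op: "openin M {r \<in> topspace M. \<phi> r \<in> B}" for B
  proof (subst openin_subopen, intro ballI)
    fix r assume r: "r \<in> {r \<in> topspace M. \<phi> r \<in> B}"
    then obtain c where c: "c \<in> A" "r \<in> fst c" using chart_exists by blast
    have "open (snd c ` fst c)" using chart[OF c(1)] unfolding chart_on_def by blast
    then obtain e where e: "e > 0" "ball (snd c r) e \<subseteq> snd c ` fst c"
      using c(2) open_contains_ball by blast
    let ?T = "{r' \<in> fst c. snd c r' \<in> ball (snd c r) e}"
    have "\<exists>k. \<forall>u\<in>ball (snd c r) e. coord_rep c \<phi> u = k"
    proof (rule has_derivative_zero_constant[OF convex_ball])
      fix u assume "u \<in> ball (snd c r) e"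
      then obtain r' where "r' \<in> fst c" "u = snd c r'" using e(2) by blast
      then show "(coord_rep c \<phi> has_derivative (\<lambda>h. 0)) (at u within ball (snd c r) e)"
        using \<phi>[OF c(1)] has_derivative_at_withinI by blast
    qed
    then obtain k where k: "\<And>u. u \<in> ball (snd c r) e \<Longrightarrow> coord_rep c \<phi> u = k" by blast
    have "\<phi> r' = \<phi> r" if "r' \<in> ?T" for r'
      using k[of "snd c r'"] k[of "snd c r"] that e(1) coord_rep_apply[OF c, of \<phi>]
        coord_rep_apply[OF c(1), of r' \<phi>] by simp
    then have "?T \<subseteq> {r \<in> topspace M. \<phi> r \<in> B}" using r chart_dom(2)[OF c(1)] by auto
    moreover have "openin M ?T" by (rule openin_chart_preimage[OF c(1) open_ball])
    moreover have "r \<in> ?T" using c e(1) by simp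
    ultimately show "\<exists>T. openin M T \<and> r \<in> T \<and> T \<subseteq> {r \<in> topspace M. \<phi> r \<in> B}" by blast
  qed
  let ?L = "{r \<in> topspace M. \<phi> r \<in> {\<phi> p}}"
  have eq: "topspace M - ?L = {r \<in> topspace M. \<phi> r \<in> - {\<phi> p}}" by auto
  have "openin M (topspace M - ?L)" unfolding eq by (rule op)
  then have "closedin M ?L" unfolding closedin_def by auto
  then have "?L = {} \<or> ?L = topspace M"
    using op connected_M unfolding connected_space_clopen_in by blast
  moreover have "p \<in> ?L" using pq by simp
  ultimately have "q \<in> ?L" using pq(2) by blast
  then show ?thesis by simp
qed

end

section \<open>The maximum principle on a closed self-expander\<close>

context hypersurface_patch
begin

text \<open>\<open>D v X\<close> is scaled to length one; the last factor of the equation is its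
  squared length by \<open>first_form\<close>.\<close>

lemma sff_form_direction:
  assumes q: "q \<in> fst c" "snd c q \<in> V" and v: "v \<noteq> 0"
  obtains w where "w \<bullet> w = 1" "w \<bullet> \<xi> q = 0"
    "\<rho> (snd c q) * D v (D v f) (snd c q) = sff_form q w * (v \<bullet> v + D v f (snd c q) * D v f (snd c q))"
proof -
  let ?u = "snd c q" and ?k = "v \<bullet> v + D v f (snd c q) * D v f (snd c q)"
  have k: "?k > 0" using v by (simp add: add_pos_nonneg)
  let ?r = "1 / sqrt ?k"
  have r2: "?r\<^sup>2 = 1 / ?k" using k by (simp add: power_divide)
  let ?w = "D (?r *\<^sub>R v) X ?u"
  show thesis
  proof (rule that)
    have "?w \<bullet> ?w = ?r\<^sup>2 * (D v X ?u \<bullet> D v X ?u)"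
      by (simp add: D_scale[OF smooth_X q(2)] power2_eq_square)
    also have "\<dots> = 1" unfolding r2 first_form[OF q(2)] using k by simp
    finally show "?w \<bullet> ?w = 1" .
    have "N ?u = \<xi> q" using coord_rep_apply[OF c q(1)] .
    then show "?w \<bullet> \<xi> q = 0" using normal_D[OF q(2), of "?r *\<^sub>R v"] by (simp add: inner_commute)
    have "sff_form q ?w = (1 / ?k) * (\<rho> ?u * D v (D v f) ?u)"
      unfolding sff_form_D[OF q] DD_scale[OF q(2)] r2 by (simp add: ac_simps)
    then show "\<rho> ?u * D v (D v f) ?u = sff_form q ?w * ?k" using k by (simp add: field_simps)
  qed
qed

lemma D_zero: "u \<in> V \<Longrightarrow> D 0 f u = 0" "u \<in> V \<Longrightarrow> D 0 (D 0 f) u = 0"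
  using D_scale[OF smooth_f, of u 0 0] DD_scale[of u 0 0] by simp_all

lemma sff_form_ge_scaled:
  assumes q: "q \<in> fst c" "snd c q \<in> V"
    and ge: "\<And>w. w \<bullet> w = 1 \<Longrightarrow> w \<bullet> \<xi> q = 0 \<Longrightarrow> r \<le> sff_form q w"
  shows "r * (v \<bullet> v + D v f (snd c q) * D v f (snd c q)) \<le> \<rho> (snd c q) * D v (D v f) (snd c q)"
proof (cases "v = 0")
  case True
  then show ?thesis using D_zero[OF q(2)] by simp
next
  case False
  then obtain w where "w \<bullet> w = 1" "w \<bullet> \<xi> q = 0"
    and eq: "\<rho> (snd c q) * D v (D v f) (snd c q) = sff_form q w * (v \<bullet> v + D v f (snd c q) * D v f (snd c q))"
    using sff_form_direction[OF q] by metis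
  then show ?thesis unfolding eq by (intro mult_right_mono ge) (simp_all add: add_nonneg_nonneg)
qed

lemma sff_form_hs:
  assumes w: "w \<bullet> \<xi> p = 0" shows "sff_form p w = (\<chi> i. w \<bullet> \<tau> i) \<bullet> (hs *v (\<chi> i. w \<bullet> \<tau> i))"
  using sff_form_D[OF p u0, of "\<chi> i. w \<bullet> \<tau> i"] tangent_D_X[OF p u0 w] DDf_form by simp

lemma inner_tangent:
  assumes w: "w \<bullet> \<xi> p = 0" shows "(\<chi> i. w \<bullet> \<tau> i) \<bullet> (\<chi> i. w \<bullet> \<tau> i) = w \<bullet> w"
  using w N_0 by (simp only: inner_expand[of w w]) (simp add: inner_vec_def[of "\<chi> i. w \<bullet> \<tau> i"])

lemma hs_ge:
  assumes "\<And>w. w \<bullet> w = 1 \<Longrightarrow> w \<bullet> \<xi> p = 0 \<Longrightarrow> r \<le> sff_form p w"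
  shows "r * (v \<bullet> v) \<le> v \<bullet> (hs *v v)"
  using sff_form_ge_scaled[OF p u0 assms, of v] DDf_form by simp

text \<open>A null vector of a semidefinite form lies in its kernel, so d\<xi> vanishes in that
  direction. Thus degenerate points are critical points of the Gauss map, which is what
  \<open>regular_direction\<close> controls.\<close>

lemma degenerate_direction:
  assumes w: "w \<bullet> w = 1" "w \<bullet> \<xi> p = 0" "sff_form p w = 0"
    and ge: "\<And>w. w \<bullet> w = 1 \<Longrightarrow> w \<bullet> \<xi> p = 0 \<Longrightarrow> 0 \<le> sff_form p w"
  shows "\<exists>e. e \<noteq> 0 \<and> differential c \<xi> p e = 0"
proof -
  let ?v = "\<chi> i. w \<bullet> \<tau> i"
  have "hs *v ?v = 0"
  proof (rule psd_null_vector[OF hs_sym])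
    show "0 \<le> v \<bullet> (hs *v v)" for v using hs_ge[OF ge, of v] by simp
    show "?v \<bullet> (hs *v ?v) = 0" using sff_form_hs w by simp
  qed
  then have 1: "D ?v (Di i f) (snd c p) = 0" for i by (simp add: DDf_hs)
  have "D ?v N (snd c p) \<bullet> \<tau> i = 0" for i
    using second_form[OF u0, of ?v "axis i 1"] 1[of i] by (simp add: D_X_0)
  moreover have "D ?v N (snd c p) \<bullet> N (snd c p) = 0" using D_N_normal[OF p] N_0 by simp
  ultimately have "D ?v N (snd c p) = 0" using span_\<tau>[of "D ?v N (snd c p)"] by simp
  then have "differential c \<xi> p (E ?v (snd c p)) = 0" by (simp add: D_differential)
  moreover have "E ?v (snd c p) \<noteq> 0"
  proof
    assume "E ?v (snd c p) = 0"
    then have "?v = 0" using J_E[OF u0, of ?v] by simp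
    then show False using inner_tangent[OF w(2)] w(1) by simp
  qed
  ultimately show ?thesis by blast
qed

end

section \<open>Closed self-expanders of positive mean curvature\<close>

locale expander_hypersurface = hypersurface M A x \<xi>
  for M :: "'a topology" and A :: "('a, 'n::finite) chart set" and x \<xi> :: "'a \<Rightarrow> real ^ 'k::finite" +
  fixes lam :: real
  assumes self_expander: "self_expander lam A M x \<xi>"
    and mean_convex: "\<And>p. p \<in> topspace M \<Longrightarrow> mean_curvature A x \<xi> p > 0"
begin

abbreviation H :: "'a \<Rightarrow> real" where "H \<equiv> mean_curvature A x \<xi>"

lemma H_eq: "p \<in> topspace M \<Longrightarrow> H p = lam + (x p \<bullet> \<xi> p) / 2"
  using self_expander unfolding self_expander_def by force

lemma continuous_H: "continuous_map M euclidean H"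
proof (rule continuous_map_eq)
  show "continuous_map M euclidean (\<lambda>p. lam + (x p \<bullet> \<xi> p) * (1/2))"
    by (intro continuous_map_add continuous_map_real_mult continuous_map_inner
        continuous_smooth_map[OF smooth_x] continuous_smooth_map[OF smooth_\<xi>]) simp_all
qed (simp add: H_eq)

end

locale expander_hypersurface_patch =
  hypersurface_patch M A x \<xi> c p V \<tau> + expander_hypersurface M A x \<xi> lam
  for M :: "'a topology" and A :: "('a, 'n::finite) chart set" and x \<xi> :: "'a \<Rightarrow> real ^ 'k::finite"
    and c :: "('a, 'n) chart" and p :: 'a and V :: "(real ^ 'n) set" and \<tau> :: "'n \<Rightarrow> real ^ 'k" and lam :: real

sublocale expander_hypersurface_patch \<subseteq> expander_patch "coord_rep c x" "coord_rep c \<xi>" V "snd c p" \<tau> lam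
proof
  fix u assume u: "u \<in> V"
  then obtain q where q: "q \<in> fst c" "u = snd c q" using patch_point by blast
  then have "Hm u = H q" using mean_curvature_Hm[of q] u by simp
  then show "Hm u = lam + coord_rep c x u \<bullet> coord_rep c \<xi> u / 2"
    using H_eq[of q] chart_dom(2)[OF c q(1)] coord_rep_apply[OF c q(1), of x] coord_rep_apply[OF c q(1), of \<xi>] q(2)
    by simp
qed

context expander_hypersurface_patch
begin

lemma pM: "p \<in> topspace M" using chart_dom(2)[OF c p] .

lemma H0_pos: "H0 > 0" using mean_convex[OF pM] mean_curvature_H0 by simp

text \<open>\<open>tensor_maximum_principle\<close> with its coordinate inequality replaced by a
  bound on unit tangent vectors, the form in which a minimum over \<open>unit_tangent\<close>
  provides it.\<close>

lemma touching_from_below: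
  assumes \<Phi>: "smooth_on V \<Phi>"
    and ge: "\<And>q w. q \<in> fst c \<Longrightarrow> snd c q \<in> V \<Longrightarrow> w \<bullet> w = 1 \<Longrightarrow> w \<bullet> \<xi> q = 0 \<Longrightarrow> \<Phi> (snd c q) \<le> sff_form q w"
    and w: "w \<bullet> w = 1" "w \<bullet> \<xi> p = 0" and eq: "sff_form p w = \<Phi> (snd c p)"
  shows "Lap \<Phi> \<le> lam * (\<Phi> (snd c p))\<^sup>2 - (1/2 + S0) * \<Phi> (snd c p)"
proof (rule tensor_maximum_principle[OF \<Phi>])
  let ?v = "\<chi> i. w \<bullet> \<tau> i"
  show "?v \<bullet> ?v = 1" using inner_tangent[OF w(2)] w(1) by simp
  show "D ?v (D ?v f) (snd c p) = \<Phi> (snd c p)"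
    using sff_form_D[OF p u0, of ?v] tangent_D_X[OF p u0 w(2)] eq by simp
  fix u v assume u: "u \<in> V"
  then obtain q where q: "q \<in> fst c" "u = snd c q" using patch_point by blast
  then show "\<Phi> u * (v \<bullet> v + D v f u * D v f u) \<le> \<rho> u * D v (D v f) u"
    using sff_form_ge_scaled[of q "\<Phi> u" v] ge[of q] u by simp
qed

lemma Hess_inner_x:
  "Di k (\<lambda>u. X u \<bullet> y) (snd c p) = \<tau> k \<bullet> y"
  "Di k (Di k (\<lambda>u. X u \<bullet> y)) (snd c p) = hs $ k $ k * (\<xi> p \<bullet> y)"
proof -
  show "Di k (\<lambda>u. X u \<bullet> y) (snd c p) = \<tau> k \<bullet> y" by (simp add: D_inner_const sm u0 D_X_0)
  have "Di k (Di k (\<lambda>u. X u \<bullet> y)) (snd c p) = Di k (\<lambda>u. Di k X u \<bullet> y) (snd c p)"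
    by (rule D_cong[OF _ u0]) (simp add: D_inner_const sm)
  then show "Di k (Di k (\<lambda>u. X u \<bullet> y)) (snd c p) = hs $ k $ k * (\<xi> p \<bullet> y)"
    by (simp add: D_inner_const sm u0 DD_X N_0 hs_def)
qed

lemma Hess_norm_x:
  "Di k (Di k (\<lambda>u. X u \<bullet> X u)) (snd c p) = 2 * (1 + hs $ k $ k * (x p \<bullet> \<xi> p))"
proof -
  have "Di k (Di k (\<lambda>u. X u \<bullet> X u)) (snd c p) = Di k (\<lambda>u. X u \<bullet> Di k X u + Di k X u \<bullet> X u) (snd c p)"
    by (rule D_cong[OF _ u0]) (simp add: D_inner sm)
  also have "\<dots> = 2 * (\<tau> k \<bullet> \<tau> k + hs $ k $ k * (x p \<bullet> \<xi> p))"
    by (simp add: D_add D_inner sm u0 DD_X D_X_0 N_0 hs_def coord_rep_apply[OF c p] inner_commute[of "\<xi> p"])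
  finally show ?thesis by (simp add: orthonormal_\<tau>)
qed

text \<open>At a maximum the trace of the Hessian of |x|^2, which is 2 (n + H (x \<bullet> \<xi>)),
  is not positive, and H is positive. This gives the sign of \<open>lam\<close>, and later the sign
  of the radial component of \<open>x\<close>.\<close>

lemma max_norm_imp:
  assumes mx: "\<And>q. q \<in> topspace M \<Longrightarrow> x q \<bullet> x q \<le> x p \<bullet> x p"
  shows "x p \<bullet> \<xi> p < 0"
proof -
  have "Di k (Di k (\<lambda>u. - (X u \<bullet> X u))) (snd c p) \<ge> 0" for k
  proof (rule D_min(2)[OF _ u0])
    fix u assume "u \<in> V"
    then obtain q where "q \<in> fst c" "u = snd c q" using patch_point by blast
    then show "- (X (snd c p) \<bullet> X (snd c p)) \<le> - (X u \<bullet> X u)"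
      using mx[of q] chart_dom(2)[OF c] coord_rep_apply[OF c, of _ x] p by simp
  qed (simp add: sm)
  moreover have "Di k (Di k (\<lambda>u. - (X u \<bullet> X u))) (snd c p) = - Di k (Di k (\<lambda>u. X u \<bullet> X u)) (snd c p)" for k
  proof -
    have "Di k (Di k (\<lambda>u. - (X u \<bullet> X u))) (snd c p) = Di k (\<lambda>u. - Di k (\<lambda>u. X u \<bullet> X u) u) (snd c p)"
      by (rule D_cong[OF _ u0]) (simp add: D_minus sm)
    then show ?thesis by (simp add: D_minus sm u0)
  qed
  ultimately have le: "1 + hs $ k $ k * (x p \<bullet> \<xi> p) \<le> 0" for k
    unfolding Hess_norm_x by (smt (verit))
  have "(\<Sum>k::'n\<in>UNIV. 1 + hs $ k $ k * (x p \<bullet> \<xi> p)) \<le> 0" by (rule sum_nonpos) (rule le)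
  then have "real CARD('n) + H0 * (x p \<bullet> \<xi> p) \<le> 0"
    by (simp add: sum.distrib H0_def sum_distrib_right)
  then have "H0 * (x p \<bullet> \<xi> p) < 0" using zero_less_card_finite[where 'a='n] by linarith
  then show ?thesis using H0_pos by (simp add: mult_less_0_iff)
qed

text \<open>The gradient of \<open>x \<bullet> y\<close> is the tangential part of \<open>y\<close>,
  and the trace of its Hessian is H (\<xi> \<bullet> y). In \<open>round_sphere\<close> this locates
  the point that is mapped to \<open>y\<close>.\<close>

lemma max_height_imp:
  assumes mx: "\<And>q. q \<in> topspace M \<Longrightarrow> x q \<bullet> y \<le> x p \<bullet> y"
  shows "y = (\<xi> p \<bullet> y) *\<^sub>R \<xi> p" "\<xi> p \<bullet> y \<le> 0"
proof -
  have min: "X (snd c p) \<bullet> (- y) \<le> X u \<bullet> (- y)" if u: "u \<in> V" for u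
  proof -
    obtain q where "q \<in> fst c" "u = snd c q" using patch_point u by blast
    then show ?thesis
      using mx[of q] chart_dom(2)[OF c] coord_rep_apply[OF c, of _ x] p by simp
  qed
  have s: "smooth_on V (\<lambda>u. X u \<bullet> (- y))" by (simp only: sm)
  have "Di k (\<lambda>u. X u \<bullet> (- y)) (snd c p) = 0" for k by (rule D_min(1)[OF s u0 min])
  then have "\<tau> k \<bullet> (- y) = 0" for k unfolding Hess_inner_x(1) .
  then show "y = (\<xi> p \<bullet> y) *\<^sub>R \<xi> p"
    using span_\<tau>[of y] by (simp add: N_0 inner_commute[of y "\<tau> _"] inner_commute[of y "\<xi> p"])
  have "(\<Sum>k\<in>UNIV. hs $ k $ k * (\<xi> p \<bullet> (- y))) \<ge> 0"
  proof (rule sum_nonneg)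
    fix k
    have "Di k (Di k (\<lambda>u. X u \<bullet> (- y))) (snd c p) \<ge> 0" by (rule D_min(2)[OF s u0 min])
    then show "hs $ k $ k * (\<xi> p \<bullet> (- y)) \<ge> 0" unfolding Hess_inner_x(2) .
  qed
  then have "H0 * (\<xi> p \<bullet> (- y)) \<ge> 0" unfolding H0_def sum_distrib_right .
  then show "\<xi> p \<bullet> y \<le> 0" using H0_pos by (simp add: mult_le_0_iff)
qed

text \<open>The Laplacian of \<open>x \<bullet> y\<close> is H (\<xi> \<bullet> y), and by
  \<open>b_eq\<close> the drift contributes (x \<bullet> y) / 2 - (H - lam) (\<xi> \<bullet> y); so
  H cancels. The term with the second factor \<open>a\<close> comes from the squared gradient of
  \<open>x \<bullet> y\<close>, which is 1 - (\<xi> \<bullet> y)^2.\<close>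

lemma Lap_exp_height:
  assumes y: "y \<bullet> y = 1"
  shows "Lap (\<lambda>u. \<epsilon> * exp (a * (X u \<bullet> y)) + d) =
    \<epsilon> * (a * exp (a * (x p \<bullet> y)) * (lam * (\<xi> p \<bullet> y) + (x p \<bullet> y) / 2 + a * (1 - (\<xi> p \<bullet> y)\<^sup>2)))"
proof -
  let ?\<psi> = "\<lambda>u. X u \<bullet> y" and ?u = "snd c p"
  let ?e = "exp (a * (x p \<bullet> y))"
  have e: "smooth_on V (\<lambda>u. exp (a * ?\<psi> u))" by (rule smooth_on_exp[OF open_U]) (simp add: sm)
  have xp: "X ?u = x p" by (rule coord_rep_apply[OF c p])
  have 1: "Di k (\<lambda>u. \<epsilon> * exp (a * ?\<psi> u) + d) u = \<epsilon> * a * (exp (a * ?\<psi> u) * Di k ?\<psi> u)" if "u \<in> V" for u k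
    by (simp add: D_add D_cmult D_exp e sm that)
  have 2: "Di k (Di k (\<lambda>u. \<epsilon> * exp (a * ?\<psi> u) + d)) ?u
      = \<epsilon> * a * (?e * (hs $ k $ k * (\<xi> p \<bullet> y)) + a * ?e * (\<tau> k \<bullet> y) * (\<tau> k \<bullet> y))" for k
  proof -
    have "Di k (Di k (\<lambda>u. \<epsilon> * exp (a * ?\<psi> u) + d)) ?u = Di k (\<lambda>u. \<epsilon> * a * (exp (a * ?\<psi> u) * Di k ?\<psi> u)) ?u"
      by (rule D_cong[OF 1 u0])
    also have "\<dots> = \<epsilon> * a * (exp (a * ?\<psi> ?u) * Di k (Di k ?\<psi>) ?u + Di k (\<lambda>u. exp (a * ?\<psi> u)) ?u * Di k ?\<psi> ?u)"
      by (simp add: D_cmult[of "\<lambda>u. exp (a * ?\<psi> u) * Di k ?\<psi> u"] D_mult e sm u0)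
    also have "Di k (\<lambda>u. exp (a * ?\<psi> u)) ?u = exp (a * ?\<psi> ?u) * (a * Di k ?\<psi> ?u)"
      by (simp add: D_exp D_cmult sm u0)
    finally show ?thesis unfolding Hess_inner_x xp by (simp add: ac_simps)
  qed
  have yt: "y \<bullet> \<tau> i = \<tau> i \<bullet> y" "y \<bullet> \<xi> p = \<xi> p \<bullet> y" for i by (rule inner_commute)+
  have yy: "(\<Sum>k\<in>UNIV. (\<tau> k \<bullet> y) * (\<tau> k \<bullet> y)) = 1 - (\<xi> p \<bullet> y)\<^sup>2"
    using inner_expand[of y y] y by (simp add: N_0 yt power2_eq_square)
  have xy: "(\<Sum>k\<in>UNIV. s k ?u * (\<tau> k \<bullet> y)) = x p \<bullet> y - 2 * (H0 - lam) * (\<xi> p \<bullet> y)"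
    using inner_expand[of "x p" y] b_eq by (simp add: N_0 s_def xp yt)
  have "Lap (\<lambda>u. \<epsilon> * exp (a * ?\<psi> u) + d)
    = (\<Sum>k\<in>UNIV. \<epsilon> * a * ?e * (\<xi> p \<bullet> y) * hs $ k $ k + \<epsilon> * a * ?e * a * ((\<tau> k \<bullet> y) * (\<tau> k \<bullet> y)))
      + 1/2 * (\<Sum>k\<in>UNIV. \<epsilon> * a * ?e * (s k ?u * (\<tau> k \<bullet> y)))"
    unfolding Lap_def 2 1[OF u0] Hess_inner_x xp by (simp add: algebra_simps)
  also have "\<dots> = \<epsilon> * a * ?e * (\<xi> p \<bullet> y) * H0 + \<epsilon> * a * ?e * a * (1 - (\<xi> p \<bullet> y)\<^sup>2)
      + 1/2 * (\<epsilon> * a * ?e * (x p \<bullet> y - 2 * (H0 - lam) * (\<xi> p \<bullet> y)))"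
    unfolding sum.distrib sum_distrib_left[symmetric] H0_def[symmetric] yy xy ..
  finally show ?thesis by (simp add: algebra_simps)
qed

lemma smooth_exp_height: "smooth_on V (\<lambda>u. \<epsilon> * exp (a * (X u \<bullet> y)) + d)"
  by (intro smooth_on_add smooth_on_mult smooth_on_const smooth_on_exp smooth_on_inner open_U smooth_X)

end

lemma (in expander_hypersurface) expander_patch_exists:
  assumes "p \<in> topspace M"
  obtains c V \<tau> where "expander_hypersurface_patch M A x \<xi> c p V \<tau> lam"
proof -
  obtain c V \<tau> where "hypersurface_patch M A x \<xi> c p V \<tau>" using patch_exists[OF assms] .
  then show thesis using that expander_hypersurface_axioms by (simp add: expander_hypersurface_patch_def)
qed

section \<open>Strict convexity, umbilicity and roundness\<close>

context expander_hypersurface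
begin

lemma lam_pos: "lam > 0"
proof -
  obtain p where p: "p \<in> topspace M" "\<And>q. q \<in> topspace M \<Longrightarrow> x q \<bullet> x q \<le> x p \<bullet> x p"
    using compact_space_attains_max[OF compact_M nonempty_M
        continuous_map_inner[OF continuous_smooth_map[OF smooth_x] continuous_smooth_map[OF smooth_x]]] by blast
  obtain c V \<tau> where "expander_hypersurface_patch M A x \<xi> c p V \<tau> lam" using expander_patch_exists[OF p(1)] .
  then interpret P: expander_hypersurface_patch M A x \<xi> c p V \<tau> lam .
  show ?thesis using P.max_norm_imp[OF p(2)] H_eq[OF p(1)] mean_convex[OF p(1)] by simp
qed

lemma height_term_continuous:
  "continuous_map unit_tangent euclidean (\<lambda>z. lam * (\<xi> (fst z) \<bullet> y) + (x (fst z) \<bullet> y) * (1/2))"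
  "continuous_map unit_tangent euclidean (\<lambda>z. 1 - (\<xi> (fst z) \<bullet> y) * (\<xi> (fst z) \<bullet> y))"
  by (intro continuous_map_add continuous_map_diff continuous_map_real_mult continuous_map_inner
      continuous_on_unit_tangent continuous_smooth_map[OF smooth_x] continuous_smooth_map[OF smooth_\<xi>]; simp)+

lemma strictly_convex:
  assumes nonneg: "\<And>z. z \<in> topspace unit_tangent \<Longrightarrow> sff_form (fst z) (snd z) \<ge> 0"
    and z0: "z0 \<in> topspace unit_tangent"
  shows "sff_form (fst z0) (snd z0) > 0"
proof (rule ccontr)
  let ?Q = "\<lambda>z. sff_form (fst z) (snd z)"
  assume "\<not> ?Q z0 > 0"
  then have Q0: "?Q z0 = 0" using nonneg[OF z0] by simp
  obtain y where y: "y \<bullet> y = 1"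
    and reg: "\<And>c p e. c \<in> A \<Longrightarrow> p \<in> fst c \<Longrightarrow> differential c \<xi> p e = 0 \<Longrightarrow> e \<noteq> 0 \<Longrightarrow> \<xi> p \<noteq> - y"
    using regular_direction by metis
  let ?s = "\<lambda>z :: 'a \<times> (real ^ 'k). lam * (\<xi> (fst z) \<bullet> y) + (x (fst z) \<bullet> y) * (1/2)"
  let ?t = "\<lambda>z :: 'a \<times> (real ^ 'k). 1 - (\<xi> (fst z) \<bullet> y) * (\<xi> (fst z) \<bullet> y)"
  define Z where "Z = {z \<in> topspace unit_tangent. ?Q z \<in> {0}}"
  have clZ: "closedin unit_tangent Z"
    unfolding Z_def by (rule closedin_continuous_map_preimage[OF continuous_sff_form]) simp
  have topZ: "topspace (subtopology unit_tangent Z) = Z" using closedin_subset[OF clZ] by auto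
  have cmpZ: "compact_space (subtopology unit_tangent Z)"
    by (rule compact_space_subtopology[OF closedin_compact_space[OF compact_unit_tangent clZ]])
  have t_nonneg: "?t z \<ge> 0" if "z \<in> topspace unit_tangent" for z
  proof -
    have "\<bar>\<xi> (fst z) \<bullet> y\<bar> \<le> norm (\<xi> (fst z)) * norm y" by (rule Cauchy_Schwarz_ineq2)
    also have "\<dots> = 1" using unit_\<xi> that y by (simp add: norm_eq_sqrt_inner topspace_unit_tangent)
    finally have "(\<xi> (fst z) \<bullet> y)\<^sup>2 \<le> 1" by (simp add: abs_square_le_1)
    then show ?thesis by (simp add: power2_eq_square)
  qed
  \<comment> \<open>Points of \<open>Z\<close> are critical for the Gauss map, so \<open>reg\<close>
    leaves only the pole \<xi> = y, where \<open>?s z\<close> is \<open>H (fst z)\<close>.\<close>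
  have s_pos: "?s z > 0" if z: "z \<in> Z" and t0: "?t z = 0" for z
  proof -
    have zU: "z \<in> topspace unit_tangent" and pM: "fst z \<in> topspace M" and Qz: "?Q z = 0"
      using z topspace_unit_tangent[of z] by (auto simp: Z_def)
    obtain c V \<tau> where "expander_hypersurface_patch M A x \<xi> c (fst z) V \<tau> lam"
      using expander_patch_exists[OF pM] .
    then interpret P: expander_hypersurface_patch M A x \<xi> c "fst z" V \<tau> lam .
    have "0 \<le> sff_form (fst z) w" if "w \<bullet> w = 1" "w \<bullet> \<xi> (fst z) = 0" for w
      using nonneg[of "(fst z, w)"] that pM by (simp add: topspace_unit_tangent)
    then obtain e where "e \<noteq> 0" "differential c \<xi> (fst z) e = 0"
      using P.degenerate_direction[of "snd z"] zU Qz by (auto simp: topspace_unit_tangent)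
    then have ne: "\<xi> (fst z) \<noteq> - y" using reg[OF P.c P.p] by blast
    let ?k = "\<xi> (fst z) \<bullet> y"
    have "?k = 1 \<or> ?k = - 1" using t0 by (simp add: square_eq_1_iff)
    moreover have "?k \<noteq> - 1"
    proof
      assume "?k = - 1"
      then have "(\<xi> (fst z) + y) \<bullet> (\<xi> (fst z) + y) = 0"
        using y unit_\<xi>[OF pM] by (simp add: inner_add_left inner_add_right inner_commute[of y "\<xi> _"])
      then show False using ne by (simp add: eq_neg_iff_add_eq_0)
    qed
    ultimately have k1: "?k = 1" by blast
    then have "(\<xi> (fst z) - y) \<bullet> (\<xi> (fst z) - y) = 0"
      using y unit_\<xi>[OF pM] by (simp add: inner_diff_left inner_diff_right inner_commute[of y "\<xi> _"])
    then have "y = \<xi> (fst z)" by simp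
    then show ?thesis using mean_convex[OF pM] H_eq[OF pM] k1 by simp
  qed
  have "\<exists>a>0. \<forall>z\<in>topspace (subtopology unit_tangent Z). ?s z + a * ?t z > 0"
  proof (rule compact_space_penalty[OF cmpZ continuous_map_from_subtopology[OF height_term_continuous(1)[of y]]
        continuous_map_from_subtopology[OF height_term_continuous(2)[of y]]])
    fix z assume "z \<in> topspace (subtopology unit_tangent Z)"
    then have z: "z \<in> Z" unfolding topZ .
    then show "?t z \<ge> 0" using t_nonneg by (simp add: Z_def)
    show "?s z > 0" if "?t z = 0" using s_pos[OF z that] .
  qed
  then obtain a where a: "a > 0" "\<And>z. z \<in> Z \<Longrightarrow> ?s z + a * ?t z > 0"
    unfolding topZ by blast
  have sat: "continuous_map unit_tangent euclidean (\<lambda>z. ?s z + a * ?t z)"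
    by (intro continuous_map_add continuous_map_real_mult_left height_term_continuous)
  have sat_pos: "?s z + a * ?t z > 0" if "z \<in> topspace unit_tangent" "?Q z = 0" for z
    using a(2)[of z] that by (simp add: Z_def)
  \<comment> \<open>Positivity on the zero set of \<open>?Q\<close> spreads to the whole bundle at
    the price of the error term \<open>b * ?Q z\<close>.\<close>
  obtain b where b: "b > 0" "\<And>z. z \<in> topspace unit_tangent \<Longrightarrow> (?s z + a * ?t z) + b * ?Q z > 0"
    using compact_space_penalty[OF compact_unit_tangent sat continuous_sff_form nonneg sat_pos] by blast
  let ?\<phi> = "\<lambda>z :: 'a \<times> (real ^ 'k). exp (a * (x (fst z) \<bullet> y))"
  have cx: "continuous_map unit_tangent euclidean (\<lambda>z. a * (x (fst z) \<bullet> y))"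
    by (intro continuous_map_real_mult_left continuous_map_inner continuous_on_unit_tangent
        continuous_smooth_map[OF smooth_x]) simp
  have "continuous_map unit_tangent euclidean (exp \<circ> (\<lambda>z. a * (x (fst z) \<bullet> y)))"
    by (rule continuous_map_compose[OF cx]) (simp add: continuous_on_exp)
  then have c\<phi>: "continuous_map unit_tangent euclidean ?\<phi>" by (simp add: o_def)
  obtain zm where zm: "\<And>z. z \<in> topspace unit_tangent \<Longrightarrow> ?\<phi> z \<le> ?\<phi> zm"
    using compact_space_attains_max[OF compact_unit_tangent nonempty_unit_tangent c\<phi>] by blast
  define K where "K = ?\<phi> zm"
  have K: "K > 0" by (simp add: K_def)
  \<comment> \<open>Chosen so that the two error terms at the minimum, from \<open>b\<close> and
    from \<open>lam * (?Q z)\<^sup>2\<close>, are each at most a quarter of \<open>?Q z\<close>.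
    Together they do not exceed the \<open>1/2 * ?Q z\<close> of the maximum principle.\<close>
  define \<epsilon> where "\<epsilon> = 1 / (4 * K * (a * b + lam))"
  have ab: "a * b > 0" using a b by simp
  have \<epsilon>: "\<epsilon> > 0" using K ab lam_pos by (simp add: \<epsilon>_def)
  have "\<epsilon> * K * (a * b + lam) = 1/4" using K ab lam_pos by (simp add: \<epsilon>_def)
  then have \<epsilon>1: "\<epsilon> * K * (a * b) \<le> 1/4" and \<epsilon>2: "lam * (\<epsilon> * K) \<le> 1/4"
    using mult_pos_pos[OF mult_pos_pos[OF \<epsilon> K] ab] mult_pos_pos[OF mult_pos_pos[OF \<epsilon> K] lam_pos]
    by (simp_all add: distrib_left mult.commute)
  have cd: "continuous_map unit_tangent euclidean (\<lambda>z. ?Q z - \<epsilon> * ?\<phi> z)"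
    by (intro continuous_map_diff continuous_map_real_mult_left continuous_sff_form c\<phi>)
  obtain z where z: "z \<in> topspace unit_tangent"
    and min: "\<And>z'. z' \<in> topspace unit_tangent \<Longrightarrow> ?Q z - \<epsilon> * ?\<phi> z \<le> ?Q z' - \<epsilon> * ?\<phi> z'"
    using compact_space_attains_min[OF compact_unit_tangent nonempty_unit_tangent cd] by blast
  define d where "d = ?Q z - \<epsilon> * ?\<phi> z"
  have k: "?Q z \<ge> 0" using nonneg[OF z] .
  \<comment> \<open>The assumed zero \<open>z0\<close> of \<open>?Q\<close> makes the minimal value
    negative, and this bounds \<open>?Q z\<close> by \<open>\<epsilon> * K\<close>.\<close>
  have "d \<le> - (\<epsilon> * ?\<phi> z0)" using min[OF z0] Q0 by (simp add: d_def)
  then have "d \<le> 0" using \<epsilon> by (smt (verit) exp_gt_zero mult_pos_pos)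
  moreover have "\<epsilon> * ?\<phi> z \<le> \<epsilon> * K" unfolding K_def using zm[OF z] \<epsilon> by (intro mult_left_mono) auto
  ultimately have kK: "?Q z \<le> \<epsilon> * K" by (simp add: d_def)
  have pM: "fst z \<in> topspace M" using z topspace_unit_tangent by blast
  obtain c V \<tau> where "expander_hypersurface_patch M A x \<xi> c (fst z) V \<tau> lam"
    using expander_patch_exists[OF pM] .
  then interpret P: expander_hypersurface_patch M A x \<xi> c "fst z" V \<tau> lam .
  let ?\<Phi> = "\<lambda>u. \<epsilon> * exp (a * (coord_rep c x u \<bullet> y)) + d"
  have \<Phi>0: "?\<Phi> (snd c (fst z)) = ?Q z"
    by (simp add: coord_rep_apply[OF P.c P.p, of x] d_def)
  have "P.Lap ?\<Phi> \<le> lam * (?\<Phi> (snd c (fst z)))\<^sup>2 - (1/2 + P.S0) * ?\<Phi> (snd c (fst z))"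
  proof (rule P.touching_from_below[OF P.smooth_exp_height])
    show "snd z \<bullet> snd z = 1" "snd z \<bullet> \<xi> (fst z) = 0" using z topspace_unit_tangent by blast+
    show "?Q z = ?\<Phi> (snd c (fst z))" by (rule \<Phi>0[symmetric])
    fix q w assume "q \<in> fst c" "w \<bullet> w = 1" "w \<bullet> \<xi> q = 0"
    then have "(q, w) \<in> topspace unit_tangent" using chart_dom(2)[OF P.c] by (simp add: topspace_unit_tangent)
    from min[OF this] show "?\<Phi> (snd c q) \<le> sff_form q w"
      by (simp add: coord_rep_apply[OF P.c \<open>q \<in> fst c\<close>, of x] d_def)
  qed
  then have L: "P.Lap ?\<Phi> \<le> lam * (?Q z)\<^sup>2 - (1/2 + P.S0) * ?Q z" unfolding \<Phi>0 .
  have "P.Lap ?\<Phi> = \<epsilon> * (a * ?\<phi> z * (?s z + a * ?t z))"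
    unfolding P.Lap_exp_height[OF y] by (simp add: power2_eq_square)
  \<comment> \<open>This strictness carries the contradiction; it persists even when
    \<open>?Q z\<close> is zero.\<close>
  also have "\<dots> > \<epsilon> * (a * ?\<phi> z * (- (b * ?Q z)))"
    using b(2)[OF z] \<epsilon> a(1) by (intro mult_strict_left_mono) auto
  finally have "P.Lap ?\<Phi> > - ((\<epsilon> * ?\<phi> z * (a * b)) * ?Q z)" by (simp add: ac_simps)
  moreover have "(\<epsilon> * ?\<phi> z * (a * b)) * ?Q z \<le> (\<epsilon> * K * (a * b)) * ?Q z"
    using zm[OF z] \<epsilon> ab k unfolding K_def by (intro mult_right_mono mult_left_mono) auto
  moreover have "(\<epsilon> * K * (a * b)) * ?Q z \<le> (1/4) * ?Q z"
    using \<epsilon>1 k by (rule mult_right_mono)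
  moreover have "lam * (?Q z)\<^sup>2 \<le> (1/4) * ?Q z"
  proof -
    have "lam * ?Q z \<le> lam * (\<epsilon> * K)" using kK lam_pos by simp
    then have "lam * ?Q z * ?Q z \<le> (1/4) * ?Q z" using \<epsilon>2 k by (intro mult_right_mono) auto
    then show ?thesis by (simp add: power2_eq_square mult.assoc)
  qed
  moreover have "P.S0 * ?Q z \<ge> 0" using k unfolding P.S0_def by (intro mult_nonneg_nonneg sum_nonneg) auto
  ultimately show False using L by (simp add: distrib_right)
qed

lemma sff_form_ge_mean:
  assumes nonneg: "\<And>z. z \<in> topspace unit_tangent \<Longrightarrow> sff_form (fst z) (snd z) \<ge> 0"
    and z0: "z0 \<in> topspace unit_tangent"
  shows "sff_form (fst z0) (snd z0) \<ge> H (fst z0) / real CARD('n)"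
proof -
  let ?Q = "\<lambda>z. sff_form (fst z) (snd z)"
  have HM: "H (fst z) > 0" if "z \<in> topspace unit_tangent" for z
    using that mean_convex topspace_unit_tangent by blast
  have "continuous_map unit_tangent euclidean (\<lambda>z. ?Q z / H (fst z))"
    by (intro continuous_map_real_divide continuous_sff_form continuous_on_unit_tangent continuous_H) (use HM in force)
  from compact_space_attains_min[OF compact_unit_tangent nonempty_unit_tangent this]
  obtain z where z: "z \<in> topspace unit_tangent"
    and min: "\<And>z'. z' \<in> topspace unit_tangent \<Longrightarrow> ?Q z / H (fst z) \<le> ?Q z' / H (fst z')"
    by blast
  define r where "r = ?Q z / H (fst z)"
  have r: "r > 0" using strictly_convex[OF nonneg z] HM[OF z] by (simp add: r_def)
  have ge: "r * H q \<le> sff_form q w" if "q \<in> topspace M" "w \<bullet> w = 1" "w \<bullet> \<xi> q = 0" for q w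
    using min[of "(q, w)"] that mean_convex[OF that(1)]
    by (simp add: topspace_unit_tangent r_def[symmetric] pos_le_divide_eq)
  have pM: "fst z \<in> topspace M" using z topspace_unit_tangent by blast
  obtain c V \<tau> where "expander_hypersurface_patch M A x \<xi> c (fst z) V \<tau> lam"
    using expander_patch_exists[OF pM] .
  then interpret P: expander_hypersurface_patch M A x \<xi> c "fst z" V \<tau> lam .
  have H0: "P.H0 = H (fst z)" using P.mean_curvature_H0 by simp
  let ?\<Phi> = "\<lambda>u. r * P.Hm u"
  have \<Phi>0: "?\<Phi> (snd c (fst z)) = r * P.H0" by (simp add: P.Hm_0)
  have "P.Lap ?\<Phi> \<le> lam * (?\<Phi> (snd c (fst z)))\<^sup>2 - (1/2 + P.S0) * ?\<Phi> (snd c (fst z))"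
  proof (rule P.touching_from_below)
    show "smooth_on V ?\<Phi>" by (intro smooth_on_mult smooth_on_const P.smooth_Hm P.open_U)
    show "snd z \<bullet> snd z = 1" "snd z \<bullet> \<xi> (fst z) = 0" using z topspace_unit_tangent by blast+
    show "?Q z = ?\<Phi> (snd c (fst z))" unfolding \<Phi>0 using HM[OF z] by (simp add: H0 r_def)
    fix q w assume q: "q \<in> fst c" "snd c q \<in> V" and w: "w \<bullet> w = 1" "w \<bullet> \<xi> q = 0"
    then show "?\<Phi> (snd c q) \<le> sff_form q w"
      using ge[OF chart_dom(2)[OF P.c q(1)] w] P.mean_curvature_Hm[OF q] by simp
  qed
  then have L: "P.Lap ?\<Phi> \<le> lam * (r * P.H0)\<^sup>2 - (1/2 + P.S0) * (r * P.H0)" unfolding \<Phi>0 .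
  have DHm: "P.Di k ?\<Phi> u = r * P.Di k P.Hm u" if "u \<in> V" for k u
    by (rule P.D_cmult[OF P.smooth_Hm that])
  have "P.Di k (P.Di k ?\<Phi>) (snd c (fst z)) = r * P.Di k (P.Di k P.Hm) (snd c (fst z))" for k
  proof -
    have "P.Di k (P.Di k ?\<Phi>) (snd c (fst z)) = P.Di k (\<lambda>u. r * P.Di k P.Hm u) (snd c (fst z))"
      by (rule P.D_cong[OF DHm P.u0])
    also have "\<dots> = r * P.Di k (P.Di k P.Hm) (snd c (fst z))"
      by (rule P.D_cmult[OF P.smooth_D[OF P.smooth_Hm] P.u0])
    finally show ?thesis .
  qed
  then have "P.Lap ?\<Phi> = r * P.Lap P.Hm"
    unfolding P.Lap_def using DHm[OF P.u0] by (simp add: sum_distrib_left distrib_left ac_simps)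
  \<comment> \<open>Subtracting \<open>r\<close> times \<open>Lap_Hm\<close> cancels the terms with
    \<open>1/2 + P.S0\<close>; only those with \<open>lam\<close> remain.\<close>
  with L have "r * (lam * P.S0) \<le> r * (lam * (r * P.H0\<^sup>2))"
    unfolding P.Lap_Hm by (simp add: algebra_simps power2_eq_square)
  then have S: "P.S0 \<le> r * P.H0 * P.H0"
    using r lam_pos by (simp add: power2_eq_square ac_simps)
  \<comment> \<open>\<open>r * P.H0\<close> bounds the principal curvatures from below, and
    \<open>S\<close> bounds the squared norm by this number times the trace. So equality holds
    throughout.\<close>
  have "P.H0 = real CARD('n) * (r * P.H0)"
    unfolding P.H0_def
  proof (rule umbilic_from_trace_bound[OF P.hs_sym])
    show "r * (\<Sum>i\<in>UNIV. P.hs $ i $ i) > 0" using r P.H0_pos by (simp add: P.H0_def)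
    show "r * (\<Sum>i\<in>UNIV. P.hs $ i $ i) * (v \<bullet> v) \<le> v \<bullet> (P.hs *v v)" for v
      using P.hs_ge[of "r * P.H0"] ge[OF pM] by (simp add: H0 P.H0_def[symmetric])
    show "(\<Sum>i\<in>UNIV. \<Sum>j\<in>UNIV. (P.hs $ i $ j)\<^sup>2) \<le> r * (\<Sum>i\<in>UNIV. P.hs $ i $ i) * (\<Sum>i\<in>UNIV. P.hs $ i $ i)"
      using S by (simp add: P.S0_def P.H0_def)
  qed
  then have "r = 1 / real CARD('n)" using P.H0_pos by (simp add: field_simps)
  then show ?thesis using ge[of "fst z0" "snd z0"] z0 by (simp add: topspace_unit_tangent)
qed

text \<open>By \<open>sff_form_ge_mean\<close> the form h - (H/n) g is semidefinite, and its trace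
  is zero.\<close>

lemma umbilic:
  assumes nonneg: "\<And>z. z \<in> topspace unit_tangent \<Longrightarrow> sff_form (fst z) (snd z) \<ge> 0"
    and p: "p \<in> topspace M" and w: "w \<bullet> w = 1" "w \<bullet> \<xi> p = 0"
  shows "sff_form p w = H p / real CARD('n)"
proof -
  obtain c V \<tau> where "expander_hypersurface_patch M A x \<xi> c p V \<tau> lam" using expander_patch_exists[OF p] .
  then interpret P: expander_hypersurface_patch M A x \<xi> c p V \<tau> lam .
  let ?k = "H p / real CARD('n)" and ?v = "\<chi> i. w \<bullet> \<tau> i"
  let ?B = "P.hs - ?k *\<^sub>R mat 1"
  have form: "v \<bullet> (?B *v v) = v \<bullet> (P.hs *v v) - ?k * (v \<bullet> v)" for v
    by (simp add: matrix_vector_mult_diff_rdistrib inner_diff_right scaleR_matrix_vector_assoc[symmetric])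
  have ge: "?k \<le> sff_form p w'" if "w' \<bullet> w' = 1" "w' \<bullet> \<xi> p = 0" for w'
    using sff_form_ge_mean[OF nonneg, of "(p, w')"] that p by (simp add: topspace_unit_tangent)
  have "?B = 0"
  proof (rule psd_trace_zero)
    show "transpose ?B = ?B" using P.hs_sym by (simp add: transpose_def vec_eq_iff mat_def)
    show "v \<bullet> (?B *v v) \<ge> 0" for v unfolding form using P.hs_ge[OF ge, of v] by simp
    show "(\<Sum>i\<in>UNIV. ?B $ i $ i) = 0"
      using P.mean_curvature_H0 by (simp add: mat_def sum_subtractf P.H0_def)
  qed
  then have "?v \<bullet> (?B *v ?v) = 0" by simp
  then show ?thesis
    unfolding form P.sff_form_hs[OF w(2), symmetric] P.inner_tangent[OF w(2)] w(1) by simp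
qed

text \<open>Schur's argument: umbilicity makes every first derivative of \<open>h\<close> a multiple
  of the identity, and total symmetry of these derivatives forces the multiples to vanish when n
  \<ge> 2. So the gradient of H is zero, and \<open>D_Hm_0'\<close> with h = (H/n) g kills the
  tangential part of \<open>x p\<close>.\<close>

lemma position_normal:
  assumes n: "CARD('n) \<ge> 2"
    and nonneg: "\<And>z. z \<in> topspace unit_tangent \<Longrightarrow> sff_form (fst z) (snd z) \<ge> 0"
    and p: "p \<in> topspace M"
  shows "x p = (x p \<bullet> \<xi> p) *\<^sub>R \<xi> p"
proof -
  obtain c V \<tau> where "expander_hypersurface_patch M A x \<xi> c p V \<tau> lam" using expander_patch_exists[OF p] .
  then interpret P: expander_hypersurface_patch M A x \<xi> c p V \<tau> lam .
  let ?u = "snd c p" and ?n = "real CARD('n)"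
  define \<nu> where "\<nu> = 1 / ?n"
  have umb: "P.\<rho> u * P.D v (P.D v P.f) u = P.Hm u * \<nu> * (v \<bullet> v + P.D v P.f u * P.D v P.f u)" if u: "u \<in> V" for u v
  proof -
    obtain q where q: "q \<in> fst c" "u = snd c q" using P.patch_point u by blast
    have qM: "q \<in> topspace M" using chart_dom(2)[OF P.c q(1)] .
    have eq: "sff_form q w = P.Hm u * \<nu>" if "w \<bullet> w = 1" "w \<bullet> \<xi> q = 0" for w
      using umbilic[OF nonneg qM that] P.mean_curvature_Hm[OF q(1)] u q(2) by (simp add: \<nu>_def)
    show ?thesis
    proof (cases "v = 0")
      case True
      then show ?thesis using P.D_zero[OF u] by simp
    next
      case False
      then obtain w where "w \<bullet> w = 1" "w \<bullet> \<xi> q = 0"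
        "P.\<rho> u * P.D v (P.D v P.f) u = sff_form q w * (v \<bullet> v + P.D v P.f u * P.D v P.f u)"
        using P.sff_form_direction[OF q(1)] u q(2) by metis
      then show ?thesis using eq by simp
    qed
  qed
  define \<mu> where "\<mu> = (\<lambda>k. P.Di k P.Hm ?u * \<nu>)"
  \<comment> \<open>Differentiating \<open>umb\<close> at the base point leaves only third
    derivatives of \<open>f\<close>, since the first derivatives of \<open>f\<close> and \<rho>
    vanish there.\<close>
  have T: "P.Di k (P.D v (P.D v P.f)) ?u = \<mu> k * (v \<bullet> v)" for k v
  proof -
    have "P.Di k (\<lambda>u. P.\<rho> u * P.D v (P.D v P.f) u) ?u
        = P.Di k (\<lambda>u. P.Hm u * \<nu> * (v \<bullet> v + P.D v P.f u * P.D v P.f u)) ?u"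
      by (rule P.D_cong[OF umb P.u0])
    then show ?thesis
      by (simp add: P.D_mult P.D_add P.sm P.smooth_Hm P.u0 \<mu>_def)
  qed
  have \<mu>0: "\<mu> k = 0" for k
  proof -
    have "\<exists>i. i \<noteq> k"
    proof (rule ccontr)
      assume "\<nexists>i. i \<noteq> k"
      then have "UNIV = {k}" by auto
      then have "CARD('n) = 1" by (metis card_1_singleton_iff One_nat_def)
      then show False using n by simp
    qed
    then obtain i where i: "i \<noteq> k" by blast
    let ?i = "axis i 1 :: real ^ 'n" and ?k = "axis k 1 :: real ^ 'n"
    have inner: "?i \<bullet> ?i = 1" "?k \<bullet> ?k = 1" "(?i + ?k) \<bullet> (?i + ?k) = 2"
      using i by (simp_all add: inner_axis_axis inner_add_left inner_add_right)
    have "P.D (?i + ?k) (P.D (?i + ?k) P.f) u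
      = P.Di i (P.Di i P.f) u + 2 * P.Di k (P.Di i P.f) u + P.Di k (P.Di k P.f) u" if u: "u \<in> V" for u
    proof -
      have "P.D (?i + ?k) (P.D (?i + ?k) P.f) u = P.D (?i + ?k) (\<lambda>u. P.Di i P.f u + P.Di k P.f u) u"
        by (rule P.D_cong[OF _ u]) (simp add: P.D_add_dir P.sm)
      then show ?thesis
        using P.D_commute[OF P.smooth_f u, of ?i ?k] by (simp add: P.D_add P.D_add_dir P.sm u)
    qed
    \<comment> \<open>\<open>T\<close> at \<open>?i + ?k\<close> polarises the identity: the mixed
      derivative \<open>P.Di i (P.Di k (P.Di i P.f))\<close> is zero, whereas commuting the outer
      two derivatives shows it to be \<open>\<mu> k\<close>.\<close>
    then have "P.Di i (P.D (?i + ?k) (P.D (?i + ?k) P.f)) ?u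
      = P.Di i (\<lambda>u. P.Di i (P.Di i P.f) u + 2 * P.Di k (P.Di i P.f) u + P.Di k (P.Di k P.f) u) ?u"
      by (rule P.D_cong[OF _ P.u0])
    then have "2 * \<mu> i = \<mu> i + 2 * P.Di i (P.Di k (P.Di i P.f)) ?u + \<mu> i"
      using T[of i] inner by (simp add: P.D_add P.D_cmult P.sm P.u0)
    then have "P.Di i (P.Di k (P.Di i P.f)) ?u = 0" by simp
    moreover have "P.Di i (P.Di k (P.Di i P.f)) ?u = P.Di k (P.Di i (P.Di i P.f)) ?u"
      by (rule P.D_commute) (simp_all add: P.sm P.u0)
    ultimately show "\<mu> k = 0" using T[of k ?i] inner by simp
  qed
  \<comment> \<open>At the base point \<open>umb\<close> says that the whole quadratic form of
    \<open>?B\<close> vanishes, so \<open>psd_null_vector\<close> applies to every vector.\<close>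
  have hs: "P.D v (P.Di i P.f) ?u = H p / ?n * v $ i" for v i
  proof -
    let ?B = "P.hs - (H p / ?n) *\<^sub>R mat 1"
    have form: "v \<bullet> (?B *v v) = 0" for v
      using umb[OF P.u0, of v] P.mean_curvature_H0 P.DDf_form[of v v]
      by (simp add: matrix_vector_mult_diff_rdistrib inner_diff_right scaleR_matrix_vector_assoc[symmetric] P.Hm_0 \<nu>_def)
    have "?B *v v = 0"
    proof (rule psd_null_vector)
      show "transpose ?B = ?B" using P.hs_sym by (simp add: transpose_def vec_eq_iff mat_def)
    qed (simp_all add: form)
    then show ?thesis
      by (simp add: P.DDf_hs matrix_vector_mult_diff_rdistrib scaleR_matrix_vector_assoc[symmetric])
  qed
  have "P.s k ?u = 0" for k
  proof -
    have "0 = P.Di k P.Hm ?u" using \<mu>0[of k] by (simp add: \<mu>_def \<nu>_def)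
    also have "\<dots> = - (1/2) * (\<Sum>i\<in>UNIV. P.s i ?u * (H p / ?n * (if k = i then 1 else 0)))"
      unfolding P.D_Hm_0' hs by (simp add: axis_def eq_commute)
    also have "(\<Sum>i\<in>UNIV. P.s i ?u * (H p / ?n * (if k = i then 1 else 0))) = P.s k ?u * (H p / ?n)"
      using sum_Kronecker(2)[of "\<lambda>i. P.s i ?u * (H p / ?n)" k] by (simp add: mult.assoc)
    finally show ?thesis using mean_convex[OF p] by simp
  qed
  then show ?thesis
    using P.span_\<tau>[of "x p"] by (simp add: P.s_def coord_rep_apply[OF P.c P.p] P.N_0)
qed

lemma round_sphere:
  assumes n: "CARD('n) \<ge> 2"
    and nonneg: "\<And>z. z \<in> topspace unit_tangent \<Longrightarrow> sff_form (fst z) (snd z) \<ge> 0"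
  shows "round_sphere_at_origin M x"
proof -
  have radial: "x p = (x p \<bullet> \<xi> p) *\<^sub>R \<xi> p" if "p \<in> topspace M" for p
    by (rule position_normal[OF n nonneg that])
  \<comment> \<open>The differential of |x|^2 is 2 (x \<bullet> dx), which is zero because
    \<open>x p\<close> is normal.\<close>
  have const: "x p \<bullet> x p = x q \<bullet> x q" if "p \<in> topspace M" "q \<in> topspace M" for p q
  proof (rule locally_constant_imp_constant[of "\<lambda>p. x p \<bullet> x p", OF _ that])
    fix c p assume c: "c \<in> A" "p \<in> fst c"
    have pM: "p \<in> topspace M" using chart_dom(2)[OF c] .
    have "x p \<bullet> differential c x p v = 0" for v
      using normal_dx[OF c, of v] by (subst radial[OF pM]) simp
    then show "(coord_rep c (\<lambda>p. x p \<bullet> x p) has_derivative (\<lambda>v. 0)) (at (snd c p))"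
      using has_derivative_inner[OF differential_has_derivative[OF smooth_x c] differential_has_derivative[OF smooth_x c]]
      by (simp add: coord_rep_apply[OF c] inner_commute[of "differential c x p _"]) (simp add: coord_rep_def o_def)
  qed
  obtain p0 where p0: "p0 \<in> topspace M" using nonempty_M by blast
  define r where "r = norm (x p0)"
  have norm_x: "norm (x p) = r" if "p \<in> topspace M" for p
    using const[OF that p0] by (simp add: r_def norm_eq_sqrt_inner)
  have x_eq: "x p = - r *\<^sub>R \<xi> p" if p: "p \<in> topspace M" for p
  proof -
    obtain c V \<tau> where "expander_hypersurface_patch M A x \<xi> c p V \<tau> lam" using expander_patch_exists[OF p] .
    then interpret P: expander_hypersurface_patch M A x \<xi> c p V \<tau> lam .
    \<comment> \<open>Since |x| is constant, every point is a maximum of it.\<close>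
    have neg: "x p \<bullet> \<xi> p < 0" by (rule P.max_norm_imp) (simp add: const[OF _ p])
    have "r = norm ((x p \<bullet> \<xi> p) *\<^sub>R \<xi> p)" using norm_x[OF p] radial[OF p] by simp
    also have "\<dots> = - (x p \<bullet> \<xi> p)" using neg unit_\<xi>[OF p] by (simp add: norm_eq_sqrt_inner)
    finally show ?thesis using radial[OF p] by simp
  qed
  have r: "r > 0"
  proof -
    obtain c V \<tau> where "expander_hypersurface_patch M A x \<xi> c p0 V \<tau> lam" using expander_patch_exists[OF p0] .
    then interpret P: expander_hypersurface_patch M A x \<xi> c p0 V \<tau> lam .
    have "x p0 \<bullet> \<xi> p0 < 0" by (rule P.max_norm_imp) (simp add: const[OF _ p0])
    then show ?thesis by (auto simp: r_def)
  qed
  \<comment> \<open>Where \<open>x \<bullet> y\<close> is maximal the normal is - y / r, and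
    \<open>x_eq\<close> turns this into x p = y.\<close>
  have "y \<in> x ` topspace M" if y: "norm y = r" for y
  proof -
    obtain p where p: "p \<in> topspace M" "\<And>q. q \<in> topspace M \<Longrightarrow> x q \<bullet> y \<le> x p \<bullet> y"
      using compact_space_attains_max[OF compact_M nonempty_M
          continuous_map_inner[OF continuous_smooth_map[OF smooth_x], of "\<lambda>_. y"]] by auto
    obtain c V \<tau> where "expander_hypersurface_patch M A x \<xi> c p V \<tau> lam" using expander_patch_exists[OF p(1)] .
    then interpret P: expander_hypersurface_patch M A x \<xi> c p V \<tau> lam .
    note h = P.max_height_imp[OF p(2)]
    have "r = norm ((\<xi> p \<bullet> y) *\<^sub>R \<xi> p)" using y h(1) by simp
    also have "\<dots> = - (\<xi> p \<bullet> y)" using h(2) unit_\<xi>[OF p(1)] by (simp add: norm_eq_sqrt_inner)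
    finally have "y = x p" using h(1) x_eq[OF p(1)] by simp
    then show ?thesis using p(1) by blast
  qed
  then have "x ` topspace M = {y. norm y = r}" using norm_x by (intro equalityI subsetI) auto
  then show ?thesis unfolding round_sphere_at_origin_def using r by blast
qed

end

theorem corollary1p1:
  fixes M :: "'a topology"
    and A :: "('a, 'n::finite) chart set"
    and x \<xi> :: "'a \<Rightarrow> real ^ 'k"
    and lam :: real
  assumes "CARD('n) \<ge> 2"
    and "CARD('k) = CARD('n) + 1"
    and "closed_connected_manifold M A"
    and "immersion A x"
    and "unit_normal_field A x \<xi>"
    and "self_expander lam A M x \<xi>"
    and "\<forall>p\<in>topspace M. mean_curvature A x \<xi> p > 0"
    and "\<forall>p\<in>topspace M. sff_norm_sq A x \<xi> p \<le> (mean_curvature A x \<xi> p)\<^sup>2 / (real CARD('n) - 1)"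
  shows "round_sphere_at_origin M x"
proof -
  interpret expander_hypersurface M A x \<xi> lam
    using assms by unfold_locales auto
  show ?thesis
  proof (rule round_sphere[OF assms(1)])
    \<comment> \<open>The pinching hypothesis enters here and nowhere else, through the matrix
      \<open>P.hs\<close> in an orthonormal frame at \<open>?p\<close>.\<close>
    fix z assume z: "z \<in> topspace unit_tangent"
    let ?p = "fst z" and ?w = "snd z"
    have p: "?p \<in> topspace M" and w: "?w \<bullet> ?w = 1" "?w \<bullet> \<xi> ?p = 0" using z topspace_unit_tangent by blast+
    obtain c V \<tau> where "expander_hypersurface_patch M A x \<xi> c ?p V \<tau> lam" using expander_patch_exists[OF p] .
    then interpret P: expander_hypersurface_patch M A x \<xi> c ?p V \<tau> lam .
    show "0 \<le> sff_form ?p ?w"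
      unfolding P.sff_form_hs[OF w(2)]
    proof (rule psd_from_pinching[OF assms(1)])
      show "0 < (\<Sum>i\<in>UNIV. P.hs $ i $ i)" using P.H0_pos by (simp add: P.H0_def)
      show "(\<Sum>i\<in>UNIV. \<Sum>j\<in>UNIV. (P.hs $ i $ j)\<^sup>2) \<le> (\<Sum>i\<in>UNIV. P.hs $ i $ i)\<^sup>2 / (real CARD('n) - 1)"
        using assms(8)[rule_format, OF p] P.mean_curvature_H0 P.sff_norm_sq_S0 by (simp add: P.H0_def P.S0_def)
      show "(\<chi> i. ?w \<bullet> \<tau> i) \<bullet> (\<chi> i. ?w \<bullet> \<tau> i) = 1" using P.inner_tangent[OF w(2)] w(1) by simp
    qed
  qed
qed

end
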